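(* Let $R$ be a commutative noetherian ring and let $\mathfrak{p}$ be a prime ideal of $R$. Then the resolving subcategory $\mathcal{R}(\mathfrak{p})$ of $\operatorname{mod} R$ is dominant, where $\mathcal{R}(\mathfrak{p})$ is the full subcategory of all finitely generated $R$-modules $M$ for which there exists $s\in R\setminus\mathfrak{p}$ such that $sH_I^i(M)=0$ for all ideals $I$ of $R$ and all integers $i<\operatorname{grade}(I,R)$.
   Context: All rings are commutative noetherian with identity; $\operatorname{mod} R$ is the category of finitely generated $R$-modules; all subcategories are full and closed under isomorphism. $H_I^i(-)$ is the $i$-th local cohomology functor with support in $I$. $\operatorname{grade}(I,M)$ is the grade of $I$ on $M$ (length of a maximal $M$-regular sequence in $I$), with $\operatorname{grade}(I,M)=\infty$ if $IM=M$. $\Omega_R^n M$ denotes the $n$-th syzygy of a finitely generated $R$-module $M$ (with respect to a resolution by finitely generated projective modules), which is unique up to projective summands. For a subcategory $\mathcal{X}$ of $\operatorname{mod} R$, $\operatorname{add}\mathcal{X}$ is the subcategory of direct summands of finite direct sums of modules in $\mathcal{X}$, and $\mathcal{X}_\mathfrak{q}=\{X_\mathfrak{q}\in \operatorname{mod} R_\mathfrak{q}\mid X\in\mathcal{X}\}$ for a prime $\mathfrak{q}$. $\mathcal{X}$ is dominant if for each $\mathfrak{q}\in\operatorname{Spec}R$ there exists an integer $n\ge 0$ such that $\Omega_{R_\mathfrak{q}}^n\kappa(\mathfrak{q})\in\operatorname{add}\mathcal{X}_\mathfrak{q}$, where $\kappa(\mathfrak{q})=R_\mathfrak{q}/\mathfrak{q}R_\mathfrak{q}$.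 $\mathcal{X}$ is resolving if it contains the (finitely generated) projective $R$-modules and is closed under direct summands, extensions (if $0\to L\to M\to N\to 0$ is exact and $L,N\in\mathcal{X}$, then $M\in\mathcal{X}$) and syzygies ($M\in\mathcal{X}$ implies $\Omega_R^1M\in\mathcal{X}$). It is a previously known fact (Yoshizawa) that $\mathcal{R}(\mathfrak{p})$ is a resolving subcategory of $\operatorname{mod} R$. *)

theory Defs
  imports
    "HOL-Algebra.Module"
    "HOL-Algebra.Ideal_Product"
    "HOL-Algebra.Ring_Divisibility"
    "HOL-Library.FuncSet"
    "HOL-Library.Extended_Nat"
begin

section \<open>Modules over a commutative ring\<close>

text \<open>
  Modules are the records of \<open>HOL-Algebra.Module\<close>. These records inherit the fields
  \<open>mult\<close> and \<open>one\<close> from rings; the fields are meaningless for modules and are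
  ignored (or left undefined) throughout.
\<close>

definition mod_hom ::
  "('a, 'r) ring_scheme \<Rightarrow> ('a, 'm, 'x) module_scheme \<Rightarrow> ('a, 'n, 'y) module_scheme \<Rightarrow> ('m \<Rightarrow> 'n) set"
  where "mod_hom R M N =
    {f \<in> carrier M \<rightarrow> carrier N.
       (\<forall>x\<in>carrier M. \<forall>y\<in>carrier M. f (x \<oplus>\<^bsub>M\<^esub> y) = f x \<oplus>\<^bsub>N\<^esub> f y) \<and>
       (\<forall>a\<in>carrier R. \<forall>x\<in>carrier M. f (a \<odot>\<^bsub>M\<^esub> x) = a \<odot>\<^bsub>N\<^esub> f x)}"

definition mod_iso ::
  "('a, 'r) ring_scheme \<Rightarrow> ('a, 'm, 'x) module_scheme \<Rightarrow> ('a, 'n, 'y) module_scheme \<Rightarrow> bool"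
  where "mod_iso R M N \<longleftrightarrow> (\<exists>f\<in>mod_hom R M N. bij_betw f (carrier M) (carrier N))"

definition mod_ker ::
  "('a, 'm, 'x) module_scheme \<Rightarrow> ('a, 'n, 'y) module_scheme \<Rightarrow> ('m \<Rightarrow> 'n) \<Rightarrow> 'm set"
  where "mod_ker M N f = {x \<in> carrier M. f x = \<zero>\<^bsub>N\<^esub>}"

definition mod_span :: "('a, 'r) ring_scheme \<Rightarrow> ('a, 'm, 'x) module_scheme \<Rightarrow> 'm set \<Rightarrow> 'm set"
  where "mod_span R M S = \<Inter>{H. submodule H R M \<and> S \<subseteq> H}"

definition fin_gen :: "('a, 'r) ring_scheme \<Rightarrow> ('a, 'm, 'x) module_scheme \<Rightarrow> bool"
  where "fin_gen R M \<longleftrightarrow> (\<exists>S. finite S \<and> S \<subseteq> carrier M \<and> mod_span R M S = carrier M)"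

definition self_module :: "('a, 'r) ring_scheme \<Rightarrow> ('a, 'a) module"
  where "self_module R =
    \<lparr>carrier = carrier R, monoid.mult = monoid.mult R, one = one R, zero = zero R, add = add R,
     smult = monoid.mult R\<rparr>"

definition quotient_module :: "('a, 'm, 'x) module_scheme \<Rightarrow> 'm set \<Rightarrow> ('a, 'm set) module"
  where "quotient_module M N =
    \<lparr>carrier = a_rcosets\<^bsub>M\<^esub> N, monoid.mult = undefined, one = undefined, zero = N,
     add = (\<lambda>X Y. X <+>\<^bsub>M\<^esub> Y), smult = (\<lambda>a X. \<Union>x\<in>X. N +>\<^bsub>M\<^esub> (a \<odot>\<^bsub>M\<^esub> x))\<rparr>"

definition direct_sum :: "('a, 'm, 'x) module_scheme list \<Rightarrow> ('a, nat \<Rightarrow> 'm) module"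
  where "direct_sum Ms =
    \<lparr>carrier = (\<Pi>\<^sub>E i\<in>{..<length Ms}. carrier (Ms ! i)), monoid.mult = undefined, one = undefined,
     zero = (\<lambda>i\<in>{..<length Ms}. \<zero>\<^bsub>Ms ! i\<^esub>),
     add = (\<lambda>f g. \<lambda>i\<in>{..<length Ms}. f i \<oplus>\<^bsub>Ms ! i\<^esub> g i),
     smult = (\<lambda>a f. \<lambda>i\<in>{..<length Ms}. a \<odot>\<^bsub>Ms ! i\<^esub> f i)\<rparr>"

text \<open>
  The lifting and extension properties below quantify over modules whose carrier lies in the
  same type as that of the module under consideration. They are used only at the type
  \<open>'a univ\<close>, introduced next, where this is no restriction.
\<close>

definition projective_module :: "('a, 'r) ring_scheme \<Rightarrow> ('a, 'm) module \<Rightarrow> bool"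
  where "projective_module R P \<longleftrightarrow> module R P \<and>
    (\<forall>(A :: ('a, 'm) module) (B :: ('a, 'm) module) g f.
       module R A \<and> module R B \<and> g \<in> mod_hom R A B \<and> g ` carrier A = carrier B \<and>
       f \<in> mod_hom R P B \<longrightarrow>
       (\<exists>h\<in>mod_hom R P A. \<forall>x\<in>carrier P. g (h x) = f x))"

definition injective_module :: "('a, 'r) ring_scheme \<Rightarrow> ('a, 'm) module \<Rightarrow> bool"
  where "injective_module R E \<longleftrightarrow> module R E \<and>
    (\<forall>(A :: ('a, 'm) module) (B :: ('a, 'm) module) j f.
       module R A \<and> module R B \<and> j \<in> mod_hom R A B \<and> inj_on j (carrier A) \<and>
       f \<in> mod_hom R A E \<longrightarrow>
       (\<exists>h\<in>mod_hom R B E. \<forall>x\<in>carrier A. h (j x) = f x))"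

text \<open>
  A type that serves as universe for modules over a ring \<open>R\<close> with carrier in \<open>'a\<close>:

  \<^item> Every finitely generated \<open>R\<close>-module has an isomorphic copy with carrier in \<open>'a univ\<close>, since
    the elements of a quotient of \<open>R\<close>-tuples are sets of functions \<open>nat \<Rightarrow> 'a\<close>. In particular
    \<open>R\<close>, its ideals and all \<open>R\<^sup>n\<close> have such copies. Lifting against these suffices to make a
    finitely generated module projective, and extending from ideals suffices for injectivity (Baer).
  \<^item> Every \<open>R\<close>-module \<open>M\<close> with carrier in \<open>'a univ\<close> has an injective resolution in \<open>'a univ\<close>:
    assume that \<open>'a\<close> has at least two elements and let \<open>\<kappa>\<close> be the cardinality of \<open>'a univ\<close>; then
    \<open>\<kappa>\<close> to the power \<open>card R\<close> is \<open>\<kappa>\<close>. Embed \<open>M\<close> into a divisible abelian group \<open>D\<close> of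
    cardinality at most \<open>\<kappa>\<close>; the injective \<open>R\<close>-module of additive maps from \<open>R\<close> to \<open>D\<close>
    contains \<open>M\<close> and again has cardinality at most \<open>\<kappa>\<close>.
\<close>

type_synonym 'a univ = "(nat \<Rightarrow> 'a) set"

definition fg_modules :: "('a, 'r) ring_scheme \<Rightarrow> ('a, 'a univ) module set"
  where "fg_modules R = {M. module R M \<and> fin_gen R M}"


section \<open>Grade\<close>

definition set_smult ::
  "('a, 'r) ring_scheme \<Rightarrow> 'a set \<Rightarrow> ('a, 'm, 'x) module_scheme \<Rightarrow> 'm set"
  where "set_smult R A M = mod_span R M {a \<odot>\<^bsub>M\<^esub> m | a m. a \<in> A \<and> m \<in> carrier M}"

definition regular_sequence ::
  "('a, 'r) ring_scheme \<Rightarrow> ('a, 'm, 'x) module_scheme \<Rightarrow> 'a list \<Rightarrow> bool"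
  where "regular_sequence R M xs \<longleftrightarrow>
    set xs \<subseteq> carrier R \<and>
    (\<forall>i<length xs. \<forall>m\<in>carrier M.
       xs ! i \<odot>\<^bsub>M\<^esub> m \<in> set_smult R (set (take i xs)) M \<longrightarrow>
       m \<in> set_smult R (set (take i xs)) M) \<and>
    set_smult R (set xs) M \<noteq> carrier M"

text \<open>
  For \<open>R\<close> noetherian, \<open>M\<close> finitely generated and \<open>I M \<noteq> M\<close>, all maximal regular sequences
  in \<open>I\<close> have the same finite length; the supremum is this length.
\<close>

definition grade :: "('a, 'r) ring_scheme \<Rightarrow> 'a set \<Rightarrow> ('a, 'm, 'x) module_scheme \<Rightarrow> enat"
  where "grade R I M =
    (if set_smult R I M = carrier M then \<infinity>
     else Sup {enat (length xs) | xs. set xs \<subseteq> I \<and> regular_sequence R M xs})"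


section \<open>Local cohomology\<close>

definition torsion :: "('a, 'r) ring_scheme \<Rightarrow> 'a set \<Rightarrow> ('a, 'm) module \<Rightarrow> ('a, 'm) module"
  where "torsion R I M = M\<lparr>carrier := {x \<in> carrier M.
    \<exists>n::nat. \<forall>a \<in> I [^]\<^bsub>ideals_set R\<^esub> n. a \<odot>\<^bsub>M\<^esub> x = \<zero>\<^bsub>M\<^esub>}\<rparr>"

text \<open>Cohomology of a complex \<open>C 0 \<rightarrow> C 1 \<rightarrow> \<dots>\<close> with differentials \<open>d i : C i \<rightarrow> C (i + 1)\<close>.\<close>

definition cohomology ::
  "(nat \<Rightarrow> ('a, 'm) module) \<Rightarrow> (nat \<Rightarrow> 'm \<Rightarrow> 'm) \<Rightarrow> nat \<Rightarrow> ('a, 'm set) module"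
  where "cohomology C d i =
    quotient_module (C i\<lparr>carrier := mod_ker (C i) (C (Suc i)) (d i)\<rparr>)
      (case i of 0 \<Rightarrow> {\<zero>\<^bsub>C 0\<^esub>} | Suc j \<Rightarrow> d j ` carrier (C j))"

definition injective_resolution ::
  "('a, 'r) ring_scheme \<Rightarrow> ('a, 'a univ) module \<Rightarrow> ('a univ \<Rightarrow> 'a univ) \<Rightarrow>
   (nat \<Rightarrow> ('a, 'a univ) module) \<Rightarrow> (nat \<Rightarrow> 'a univ \<Rightarrow> 'a univ) \<Rightarrow> bool"
  where "injective_resolution R M \<epsilon> E d \<longleftrightarrow>
    (\<forall>i. injective_module R (E i)) \<and>
    \<epsilon> \<in> mod_hom R M (E 0) \<and> inj_on \<epsilon> (carrier M) \<and>
    (\<forall>i. d i \<in> mod_hom R (E i) (E (Suc i))) \<and>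
    \<epsilon> ` carrier M = mod_ker (E 0) (E 1) (d 0) \<and>
    (\<forall>i. d i ` carrier (E i) = mod_ker (E (Suc i)) (E (Suc (Suc i))) (d (Suc i)))"

text \<open>
  The right derived functors of the \<open>I\<close>-torsion functor are determined only up to isomorphism,
  so they are given as a relation: \<open>H\<close> is the \<open>i\<close>-th local cohomology of \<open>M\<close>, computed by some
  injective resolution.
\<close>

definition is_local_cohomology ::
  "('a, 'r) ring_scheme \<Rightarrow> 'a set \<Rightarrow> nat \<Rightarrow> ('a, 'a univ) module \<Rightarrow> ('a, 'a univ set) module \<Rightarrow> bool"
  where "is_local_cohomology R I i M H \<longleftrightarrow>
    (\<exists>\<epsilon> E d. injective_resolution R M \<epsilon> E d \<and> H = cohomology (\<lambda>j. torsion R I (E j)) d i)"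

text \<open>
  Only \<open>i \<ge> 0\<close> occurs because local cohomology in negative degrees is zero. The condition on
  \<open>H\<close> does not depend on the choice of the injective resolution and is imposed for all of them.
\<close>

definition R_cat :: "('a, 'r) ring_scheme \<Rightarrow> 'a set \<Rightarrow> ('a, 'a univ) module set"
  where "R_cat R \<pp> = {M \<in> fg_modules R.
    \<exists>s \<in> carrier R - \<pp>. \<forall>I (i::nat) H.
      ideal I R \<and> enat i < grade R I (self_module R) \<and> is_local_cohomology R I i M H \<longrightarrow>
      (\<forall>h\<in>carrier H. s \<odot>\<^bsub>H\<^esub> h = \<zero>\<^bsub>H\<^esub>)}"


section \<open>Localization at a prime ideal\<close>

text \<open>The fraction \<open>m / s\<close>, as a class of pairs.\<close>

definition frac ::
  "('a, 'r) ring_scheme \<Rightarrow> 'a set \<Rightarrow> ('a, 'm, 'x) module_scheme \<Rightarrow> 'm \<Rightarrow> 'a \<Rightarrow> ('m \<times> 'a) set"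
  where "frac R \<qq> M m s = {(m', s'). m' \<in> carrier M \<and> s' \<in> carrier R - \<qq> \<and>
    (\<exists>t \<in> carrier R - \<qq>. t \<odot>\<^bsub>M\<^esub> (s' \<odot>\<^bsub>M\<^esub> m) = t \<odot>\<^bsub>M\<^esub> (s \<odot>\<^bsub>M\<^esub> m'))}"

definition loc_module ::
  "('a, 'r) ring_scheme \<Rightarrow> 'a set \<Rightarrow> ('a, 'm, 'x) module_scheme \<Rightarrow>
   (('a \<times> 'a) set, ('m \<times> 'a) set) module"
  where "loc_module R \<qq> M =
    \<lparr>carrier = {frac R \<qq> M m s | m s. m \<in> carrier M \<and> s \<in> carrier R - \<qq>},
     monoid.mult = undefined, one = undefined,
     zero = frac R \<qq> M \<zero>\<^bsub>M\<^esub> \<one>\<^bsub>R\<^esub>,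
     add = (\<lambda>X Y. \<Union>(m, s)\<in>X. \<Union>(n, t)\<in>Y.
              frac R \<qq> M ((t \<odot>\<^bsub>M\<^esub> m) \<oplus>\<^bsub>M\<^esub> (s \<odot>\<^bsub>M\<^esub> n)) (s \<otimes>\<^bsub>R\<^esub> t)),
     smult = (\<lambda>A X. \<Union>(a, s)\<in>A. \<Union>(m, t)\<in>X. frac R \<qq> M (a \<odot>\<^bsub>M\<^esub> m) (s \<otimes>\<^bsub>R\<^esub> t))\<rparr>"

definition loc_ring :: "('a, 'r) ring_scheme \<Rightarrow> 'a set \<Rightarrow> ('a \<times> 'a) set ring"
  where "loc_ring R \<qq> =
    \<lparr>carrier = carrier (loc_module R \<qq> (self_module R)),
     monoid.mult = smult (loc_module R \<qq> (self_module R)),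
     one = frac R \<qq> (self_module R) \<one>\<^bsub>R\<^esub> \<one>\<^bsub>R\<^esub>,
     zero = zero (loc_module R \<qq> (self_module R)),
     add = add (loc_module R \<qq> (self_module R))\<rparr>"

definition loc_max_ideal :: "('a, 'r) ring_scheme \<Rightarrow> 'a set \<Rightarrow> ('a \<times> 'a) set set"
  where "loc_max_ideal R \<qq> =
    {frac R \<qq> (self_module R) a s | a s. a \<in> \<qq> \<and> s \<in> carrier R - \<qq>}"

definition residue_field_module ::
  "('a, 'r) ring_scheme \<Rightarrow> 'a set \<Rightarrow> (('a \<times> 'a) set, ('a \<times> 'a) set set) module"
  where "residue_field_module R \<qq> = quotient_module (self_module (loc_ring R \<qq>)) (loc_max_ideal R \<qq>)"


section \<open>Syzygies, additive closures and dominance\<close>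

text \<open>\<open>is_syzygy R M n N\<close>: the module \<open>N\<close> is an \<open>n\<close>-th syzygy of \<open>M\<close>.\<close>

inductive is_syzygy ::
  "('a, 'r) ring_scheme \<Rightarrow> ('a, 'm) module \<Rightarrow> nat \<Rightarrow> ('a, 'a univ) module \<Rightarrow> bool"
  for R M where
  zero: "\<lbrakk>module R N; mod_iso R M N\<rbrakk> \<Longrightarrow> is_syzygy R M 0 N"
| step: "\<lbrakk>is_syzygy R M n K; projective_module R P; fin_gen R (P :: ('a, 'a univ) module);
          f \<in> mod_hom R P K; f ` carrier P = carrier K;
          module R N; mod_iso R N (P\<lparr>carrier := mod_ker P K f\<rparr>)\<rbrakk>
         \<Longrightarrow> is_syzygy R M (Suc n) N"

text \<open>\<open>in_add R \<X> N\<close>: the module \<open>N\<close> is (isomorphic to) a direct summand of a finite direct sum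
  of modules in \<open>\<X>\<close>.\<close>

definition in_add ::
  "('a, 'r) ring_scheme \<Rightarrow> ('a, 'm) module set \<Rightarrow> ('a, 'n) module \<Rightarrow> bool"
  where "in_add R \<X> N \<longleftrightarrow>
    (\<exists>Xs A B. set Xs \<subseteq> \<X> \<and>
       submodule A R (direct_sum Xs) \<and> submodule B R (direct_sum Xs) \<and>
       A \<inter> B = {\<zero>\<^bsub>direct_sum Xs\<^esub>} \<and> A <+>\<^bsub>direct_sum Xs\<^esub> B = carrier (direct_sum Xs) \<and>
       mod_iso R N (direct_sum Xs\<lparr>carrier := A\<rparr>))"

text \<open>
  A syzygy is determined only up to projective summands. Over the local ring \<open>R\<^sub>\<qq>\<close> every \<open>n\<close>-th
  syzygy has the minimal one as a direct summand, so asking for some \<open>n\<close>-th syzygy in the additive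
  closure is the same as asking for the minimal one.
\<close>

definition dominant :: "('a, 'r) ring_scheme \<Rightarrow> ('a, 'm) module set \<Rightarrow> bool"
  where "dominant R \<X> \<longleftrightarrow>
    (\<forall>\<qq>. primeideal \<qq> R \<longrightarrow>
       (\<exists>n N. is_syzygy (loc_ring R \<qq>) (residue_field_module R \<qq>) n N \<and>
              in_add (loc_ring R \<qq>) (loc_module R \<qq> ` \<X>) N))"

end

theory Submission
  imports Defs
begin

text \<open>
  \<^bold>\<open>Idea.\<close> The element \<open>s\<close> in the definition of \<open>\<R>(\<pp>)\<close> can be taken to be \<open>\<one>\<close>. For each prime
  \<open>\<qq>\<close>, a sufficiently high syzygy \<open>M\<close> of \<open>R/\<qq>\<close> satisfies \<open>H\<^sub>I\<^sup>i(M) = 0\<close> for all ideals \<open>I\<close> and all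
  \<open>i < grade(I, R)\<close>, and \<open>M\<close> localizes at \<open>\<qq>\<close> to a syzygy of the residue field.

  \<^bold>\<open>Reduction to Ext.\<close> An element of \<open>H\<^sub>I\<^sup>i(M)\<close> is represented by a cocycle that is killed by some
  \<open>J = I\<^sup>k\<close>, and such a cocycle bounds an element killed by \<open>J\<close> if \<open>Ext\<^sup>j(R/J, M) = 0\<close> for all \<open>j \<le> i\<close>
  (\<open>injective_resolution_cocycle\<close>). These Ext modules are computed from a free resolution of \<open>R/J\<close>,
  so that exact sequences in the second argument need no injective modules. By regular sequences
  \<open>Ext\<^sup>i(R/J, R) = 0\<close> for \<open>i < grade(I, R)\<close> (\<open>ext_vanishing_of_regular_sequence\<close>). A syzygy gains one
  degree, hence everything follows from a uniform bound: there is an \<open>n\<close> such that for all \<open>J\<close> and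
  \<open>g\<close>, vanishing of \<open>Ext\<^sup>i(R/J, R)\<close> for \<open>i < g\<close> implies vanishing of \<open>Ext\<^sup>i(R/J, R/\<qq>)\<close> for
  \<open>i < g - n\<close> (\<open>cyclic_grade_defect_bounded\<close>). In other words, the difference between the depths of
  \<open>R\<close> and of \<open>R/\<qq>\<close> is bounded on the whole spectrum, even if \<open>R\<close> has infinite dimension.

  \<^bold>\<open>The uniform bound.\<close> By noetherian induction it may be assumed for \<open>R/A\<close> with \<open>A\<close> strictly larger
  than \<open>\<qq>\<close>. It suffices to find an \<open>s \<notin> \<qq>\<close> such that the \<open>Ext\<^sup>i(R/J, R/\<qq>)\<close> in question are
  \<open>s\<close>-torsion: since the \<open>Ext\<^sup>i\<^sup>-\<^sup>1(R/J, R/(\<qq> + sR))\<close> vanish, they have no \<open>s\<close>-torsion either, so they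
  are zero (\<open>ext_vanishing_of_torsion\<close>). Such an \<open>s\<close> comes from the Koszul complex on \<open>h\<close> generators
  of \<open>\<qq>\<close>. Its terms are free, its homology modules are killed by \<open>\<qq>\<close> and therefore, up to
  multiplication by elements outside \<open>\<qq>\<close>, iterated extensions of copies of \<open>R/\<qq>\<close>, and not all of
  them vanish generically. Comparing the first degree in which Ext is not torsion for \<open>R/\<qq>\<close>, for
  the homology, and for the terms of the complex shows that \<open>R/\<qq>\<close> loses at most \<open>h\<close> degrees
  against \<open>R\<close> (\<open>killed_homology.generic_ext_torsion\<close>).
\<close>



section \<open>Homomorphisms, submodules and short exact sequences\<close>

lemma mod_homI:
  assumes "\<And>x. x \<in> carrier M \<Longrightarrow> f x \<in> carrier N"
    and "\<And>x y. x \<in> carrier M \<Longrightarrow> y \<in> carrier M \<Longrightarrow> f (x \<oplus>\<^bsub>M\<^esub> y) = f x \<oplus>\<^bsub>N\<^esub> f y"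
    and "\<And>a x. a \<in> carrier R \<Longrightarrow> x \<in> carrier M \<Longrightarrow> f (a \<odot>\<^bsub>M\<^esub> x) = a \<odot>\<^bsub>N\<^esub> f x"
  shows "f \<in> mod_hom R M N"
  using assms by (auto simp: mod_hom_def)

lemma mod_hom_closed: "f \<in> mod_hom R M N \<Longrightarrow> x \<in> carrier M \<Longrightarrow> f x \<in> carrier N"
  by (auto simp: mod_hom_def)

lemma mod_hom_add:
  "f \<in> mod_hom R M N \<Longrightarrow> x \<in> carrier M \<Longrightarrow> y \<in> carrier M \<Longrightarrow> f (x \<oplus>\<^bsub>M\<^esub> y) = f x \<oplus>\<^bsub>N\<^esub> f y"
  by (auto simp: mod_hom_def)

lemma mod_hom_smult:
  "f \<in> mod_hom R M N \<Longrightarrow> a \<in> carrier R \<Longrightarrow> x \<in> carrier M \<Longrightarrow> f (a \<odot>\<^bsub>M\<^esub> x) = a \<odot>\<^bsub>N\<^esub> f x"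
  by (auto simp: mod_hom_def)

lemma mod_hom_zero:
  assumes "f \<in> mod_hom R M N" "module R M" "module R N"
  shows "f \<zero>\<^bsub>M\<^esub> = \<zero>\<^bsub>N\<^esub>"
proof -
  interpret M: module R M by fact
  interpret N: module R N by fact
  have "f \<zero>\<^bsub>M\<^esub> = f (\<zero>\<^bsub>R\<^esub> \<odot>\<^bsub>M\<^esub> \<zero>\<^bsub>M\<^esub>)" by simp
  also have "\<dots> = \<zero>\<^bsub>R\<^esub> \<odot>\<^bsub>N\<^esub> f \<zero>\<^bsub>M\<^esub>" by (rule mod_hom_smult[OF assms(1)]) auto
  finally show ?thesis using mod_hom_closed[OF assms(1)] by simp
qed

lemma mod_hom_uminus:
  assumes "f \<in> mod_hom R M N" "module R M" "module R N" "x \<in> carrier M"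
  shows "f (\<ominus>\<^bsub>M\<^esub> x) = \<ominus>\<^bsub>N\<^esub> f x"
proof -
  interpret M: module R M by fact
  interpret N: module R N by fact
  have "f (\<ominus>\<^bsub>M\<^esub> x) \<oplus>\<^bsub>N\<^esub> f x = \<zero>\<^bsub>N\<^esub>"
    using mod_hom_add[OF assms(1), of "\<ominus>\<^bsub>M\<^esub> x" x] assms(4) mod_hom_zero[OF assms(1-3)]
    by (simp add: M.l_neg)
  then show ?thesis using assms mod_hom_closed[OF assms(1)]
    by (metis M.a_inv_closed N.minus_equality)
qed

lemma mod_hom_minus:
  assumes "f \<in> mod_hom R M N" "module R M" "module R N" "x \<in> carrier M" "y \<in> carrier M"
  shows "f (x \<ominus>\<^bsub>M\<^esub> y) = f x \<ominus>\<^bsub>N\<^esub> f y"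
proof -
  interpret M: module R M by fact
  interpret N: module R N by fact
  show ?thesis
    using assms mod_hom_add[OF assms(1), of x "\<ominus>\<^bsub>M\<^esub> y"] mod_hom_uminus[OF assms(1-3)]
    by (simp add: M.minus_eq N.minus_eq)
qed

lemma module_minus_eq_zero_iff:
  assumes "module R M" "x \<in> carrier M" "y \<in> carrier M"
  shows "x \<ominus>\<^bsub>M\<^esub> y = \<zero>\<^bsub>M\<^esub> \<longleftrightarrow> x = y"
proof -
  interpret M: module R M by fact
  show ?thesis using assms(2,3)
    by (metis M.a_inv_closed M.minus_eq M.minus_equality M.minus_minus M.r_neg)
qed

lemma mod_hom_comp:
  "f \<in> mod_hom R L M \<Longrightarrow> g \<in> mod_hom R M N \<Longrightarrow> (\<lambda>x. g (f x)) \<in> mod_hom R L N"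
  by (auto simp: mod_hom_def Pi_def)

lemma mod_hom_id: "(\<lambda>x. x) \<in> mod_hom R M M"
  by (auto simp: mod_hom_def)

lemma mod_hom_zero_map:
  assumes "module R N" shows "(\<lambda>x. \<zero>\<^bsub>N\<^esub>) \<in> mod_hom R M N"
proof -
  interpret N: module R N by fact
  show ?thesis by (auto simp: mod_hom_def)
qed

lemma mod_hom_diff:
  assumes "f \<in> mod_hom R M N" "g \<in> mod_hom R M N" "module R M" "module R N"
  shows "(\<lambda>x. f x \<ominus>\<^bsub>N\<^esub> g x) \<in> mod_hom R M N"
proof -
  interpret M: module R M by fact
  interpret N: module R N by fact
  note c = mod_hom_closed[OF assms(1)] mod_hom_closed[OF assms(2)]
  show ?thesis
    by (rule mod_homI)
      (simp_all add: c mod_hom_add[OF assms(1)] mod_hom_add[OF assms(2)] mod_hom_smult[OF assms(1)]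
        mod_hom_smult[OF assms(2)] N.minus_eq N.minus_add N.a_ac N.smult_r_distr N.smult_r_minus)
qed

lemma mod_hom_sum:
  assumes "f \<in> mod_hom R M N" "g \<in> mod_hom R M N" "module R M" "module R N"
  shows "(\<lambda>x. f x \<oplus>\<^bsub>N\<^esub> g x) \<in> mod_hom R M N"
proof -
  interpret M: module R M by fact
  interpret N: module R N by fact
  note c = mod_hom_closed[OF assms(1)] mod_hom_closed[OF assms(2)]
  show ?thesis
    by (rule mod_homI)
      (simp_all add: c mod_hom_add[OF assms(1)] mod_hom_add[OF assms(2)] mod_hom_smult[OF assms(1)]
        mod_hom_smult[OF assms(2)] N.a_ac N.smult_r_distr)
qed

lemma mod_hom_scale:
  assumes "f \<in> mod_hom R M N" "module R M" "module R N" "a \<in> carrier R"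
  shows "(\<lambda>x. a \<odot>\<^bsub>N\<^esub> f x) \<in> mod_hom R M N"
proof -
  interpret M: module R M by fact
  interpret N: module R N by fact
  note c = mod_hom_closed[OF assms(1)]
  have "a \<odot>\<^bsub>N\<^esub> (b \<odot>\<^bsub>N\<^esub> x) = b \<odot>\<^bsub>N\<^esub> (a \<odot>\<^bsub>N\<^esub> x)" if "b \<in> carrier R" "x \<in> carrier N" for b x
    using N.smult_assoc1[of a b x] N.smult_assoc1[of b a x] M.R.m_comm[of a b] that assms(4) by simp
  then show ?thesis
    by (intro mod_homI)
      (simp_all add: c assms(4) mod_hom_add[OF assms(1)] mod_hom_smult[OF assms(1)] N.smult_r_distr)
qed

lemma submodule_subset: "module R M \<Longrightarrow> submodule H R M \<Longrightarrow> H \<subseteq> carrier M"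
  by (rule module.submoduleE(1))

lemma submodule_zero:
  assumes "submodule H R M" shows "\<zero>\<^bsub>M\<^esub> \<in> H"
  using submodule.axioms(1)[OF assms] subgroup.one_closed by fastforce

lemma submodule_minus:
  assumes "module R M" "submodule H R M" "x \<in> H" "y \<in> H"
  shows "x \<ominus>\<^bsub>M\<^esub> y \<in> H"
  using assms module.submoduleE(3,5)[OF assms(1,2)] by (simp add: a_minus_def)

lemma submodule_restrict_iff:
  assumes "module R M" "submodule H R M"
  shows "submodule X R (M\<lparr>carrier := H\<rparr>) \<longleftrightarrow> submodule X R M \<and> X \<subseteq> H"
proof -
  interpret M: module R M by fact
  interpret H: module R "M\<lparr>carrier := H\<rparr>" by (rule submodule.submodule_is_module[OF assms(2,1)])
  show ?thesis
  proof (intro iffI conjI)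
    assume X: "submodule X R (M\<lparr>carrier := H\<rparr>)"
    show XH: "X \<subseteq> H" using H.submoduleE(1)[OF X] by simp
    show "submodule X R M"
    proof (rule M.submoduleI)
      show "X \<subseteq> carrier M" using XH M.submoduleE(1)[OF assms(2)] by simp
      show "\<zero>\<^bsub>M\<^esub> \<in> X" using submodule_zero[OF X] by simp
      show add: "a \<oplus>\<^bsub>M\<^esub> b \<in> X" if "a \<in> X" "b \<in> X" for a b
        using H.submoduleE(5)[OF X that] by simp
      show sm: "a \<odot>\<^bsub>M\<^esub> b \<in> X" if "a \<in> carrier R" "b \<in> X" for a b
        using H.submoduleE(4)[OF X that] by simp
      show "\<ominus>\<^bsub>M\<^esub> a \<in> X" if "a \<in> X" for a
      proof -
        have "a \<in> carrier M" using that XH M.submoduleE(1)[OF assms(2)] by auto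
        then have "\<ominus>\<^bsub>M\<^esub> a = (\<ominus>\<^bsub>R\<^esub> \<one>\<^bsub>R\<^esub>) \<odot>\<^bsub>M\<^esub> a" by (simp add: M.smult_l_minus)
        then show ?thesis using sm[OF _ that] by simp
      qed
    qed
  next
    assume X: "submodule X R M \<and> X \<subseteq> H"
    then have X1: "submodule X R M" and XH: "X \<subseteq> H" by auto
    show "submodule X R (M\<lparr>carrier := H\<rparr>)"
    proof (rule H.submoduleI)
      show sm: "a \<odot>\<^bsub>M\<lparr>carrier := H\<rparr>\<^esub> b \<in> X" if "a \<in> carrier R" "b \<in> X" for a b
        using M.submoduleE(4)[OF X1 that] by simp
      show "\<ominus>\<^bsub>M\<lparr>carrier := H\<rparr>\<^esub> a \<in> X" if "a \<in> X" for a
      proof -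
        have "a \<in> H" using that XH by auto
        then have "\<ominus>\<^bsub>M\<lparr>carrier := H\<rparr>\<^esub> a = (\<ominus>\<^bsub>R\<^esub> \<one>\<^bsub>R\<^esub>) \<odot>\<^bsub>M\<lparr>carrier := H\<rparr>\<^esub> a"
          using H.smult_l_minus[of "\<one>\<^bsub>R\<^esub>" a] H.smult_one by simp
        then show ?thesis using sm[OF _ that] by simp
      qed
    qed (use XH M.submoduleE[OF X1] submodule_zero[OF X1] in auto)
  qed
qed

lemma submoduleI':
  assumes "module R M" "H \<subseteq> carrier M" "\<zero>\<^bsub>M\<^esub> \<in> H"
    and "\<And>a b. a \<in> H \<Longrightarrow> b \<in> H \<Longrightarrow> a \<oplus>\<^bsub>M\<^esub> b \<in> H"
    and sm: "\<And>a x. a \<in> carrier R \<Longrightarrow> x \<in> H \<Longrightarrow> a \<odot>\<^bsub>M\<^esub> x \<in> H"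
  shows "submodule H R M"
proof -
  interpret M: module R M by fact
  show ?thesis
  proof (rule M.submoduleI)
    show "\<ominus>\<^bsub>M\<^esub> a \<in> H" if "a \<in> H" for a
    proof -
      have "a \<in> carrier M" using that assms(2) by auto
      then have "\<ominus>\<^bsub>M\<^esub> a = (\<ominus>\<^bsub>R\<^esub> \<one>\<^bsub>R\<^esub>) \<odot>\<^bsub>M\<^esub> a" by (simp add: M.smult_l_minus)
      then show ?thesis using sm[OF _ that] by simp
    qed
  qed (use assms in auto)
qed

lemma module_restrict: "module R M \<Longrightarrow> submodule H R M \<Longrightarrow> module R (M\<lparr>carrier := H\<rparr>)"
  by (rule submodule.submodule_is_module)

lemma mod_hom_restrict:
  "f \<in> mod_hom R M N \<Longrightarrow> H \<subseteq> carrier M \<Longrightarrow> f \<in> mod_hom R (M\<lparr>carrier := H\<rparr>) N"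
  by (fastforce simp: mod_hom_def)

lemma mod_hom_corestrict:
  "f \<in> mod_hom R M N \<Longrightarrow> f ` carrier M \<subseteq> H \<Longrightarrow> f \<in> mod_hom R M (N\<lparr>carrier := H\<rparr>)"
  by (auto simp: mod_hom_def)

lemma mod_hom_expand:
  "f \<in> mod_hom R M (N\<lparr>carrier := H\<rparr>) \<Longrightarrow> H \<subseteq> carrier N \<Longrightarrow> f \<in> mod_hom R M N"
  by (auto simp: mod_hom_def)

lemma submodule_vimage:
  assumes "f \<in> mod_hom R M N" "module R M" "module R N" "submodule H R N"
  shows "submodule {x \<in> carrier M. f x \<in> H} R M"
proof -
  interpret M: module R M by fact
  interpret N: module R N by fact
  show ?thesis
    using assms(1) mod_hom_zero[OF assms(1-3)] submodule_zero[OF assms(4)] N.submoduleE[OF assms(4)]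
    by (intro submoduleI') (auto simp: mod_hom_add mod_hom_smult assms(2))
qed

lemma submodule_image:
  assumes f: "f \<in> mod_hom R M N" and M: "module R M" and N: "module R N" and H: "submodule H R M"
  shows "submodule (f ` H) R N"
proof -
  interpret M: module R M by fact
  interpret N: module R N by fact
  have sub: "H \<subseteq> carrier M" by (rule M.submoduleE(1)[OF H])
  show ?thesis
  proof (rule submoduleI'[OF N])
    show "f ` H \<subseteq> carrier N" using sub f by (auto simp: mod_hom_def)
    show "\<zero>\<^bsub>N\<^esub> \<in> f ` H" using mod_hom_zero[OF f M N] submodule_zero[OF H] by (metis imageI)
    show "a \<oplus>\<^bsub>N\<^esub> b \<in> f ` H" if "a \<in> f ` H" "b \<in> f ` H" for a b
    proof -
      from that obtain x y where xy: "x \<in> H" "y \<in> H" "a = f x" "b = f y" by blast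
      then have "a \<oplus>\<^bsub>N\<^esub> b = f (x \<oplus>\<^bsub>M\<^esub> y)" using mod_hom_add[OF f, of x y] sub by (simp add: subset_iff)
      then show ?thesis using M.submoduleE(5)[OF H xy(1,2)] by blast
    qed
    show "a \<odot>\<^bsub>N\<^esub> b \<in> f ` H" if "a \<in> carrier R" "b \<in> f ` H" for a b
    proof -
      from that obtain y where xy: "y \<in> H" "b = f y" by blast
      then have "a \<odot>\<^bsub>N\<^esub> b = f (a \<odot>\<^bsub>M\<^esub> y)" using mod_hom_smult[OF f that(1), of y] sub by (simp add: subset_iff)
      then show ?thesis using M.submoduleE(4)[OF H that(1) xy(1)] by blast
    qed
  qed
qed

lemma submodule_zero_set: "module R M \<Longrightarrow> submodule {\<zero>\<^bsub>M\<^esub>} R M"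
proof -
  assume "module R M"
  then interpret M: module R M .
  show ?thesis by (rule submoduleI') (auto intro: M.module_axioms)
qed

lemma mod_ker_submodule:
  assumes "f \<in> mod_hom R M N" "module R M" "module R N"
  shows "submodule (mod_ker M N f) R M"
  using submodule_vimage[OF assms submodule_zero_set[OF assms(3)]] by (simp add: mod_ker_def)

lemma inj_on_mod_hom_iff:
  assumes f: "f \<in> mod_hom R M N" and M: "module R M" and N: "module R N"
  shows "inj_on f (carrier M) \<longleftrightarrow> (\<forall>x\<in>carrier M. f x = \<zero>\<^bsub>N\<^esub> \<longrightarrow> x = \<zero>\<^bsub>M\<^esub>)"
proof -
  interpret M: module R M by fact
  interpret N: module R N by fact
  show ?thesis
  proof (intro iffI ballI impI inj_onI)
    fix x assume "inj_on f (carrier M)" "x \<in> carrier M" "f x = \<zero>\<^bsub>N\<^esub>"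
    then show "x = \<zero>\<^bsub>M\<^esub>" using mod_hom_zero[OF f M N] by (metis inj_onD M.zero_closed)
  next
    fix x y assume *: "\<forall>x\<in>carrier M. f x = \<zero>\<^bsub>N\<^esub> \<longrightarrow> x = \<zero>\<^bsub>M\<^esub>" "x \<in> carrier M" "y \<in> carrier M" "f x = f y"
    have "f (x \<ominus>\<^bsub>M\<^esub> y) = \<zero>\<^bsub>N\<^esub>"
      using mod_hom_minus[OF f M N *(2,3)] *(4) mod_hom_closed[OF f *(3)] by (simp add: N.minus_eq N.r_neg)
    then have "x \<ominus>\<^bsub>M\<^esub> y = \<zero>\<^bsub>M\<^esub>" using *(1,2,3) by simp
    then show "x = y" using module_minus_eq_zero_iff[OF M] *(2,3) by simp
  qed
qed

definition short_exact ::
  "('a, 'r) ring_scheme \<Rightarrow> ('a, 'l) module \<Rightarrow> ('a, 'm) module \<Rightarrow> ('a, 'n) module \<Rightarrow>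
   ('l \<Rightarrow> 'm) \<Rightarrow> ('m \<Rightarrow> 'n) \<Rightarrow> bool"
  where "short_exact R L M N f g \<longleftrightarrow> module R L \<and> module R M \<and> module R N \<and>
    f \<in> mod_hom R L M \<and> g \<in> mod_hom R M N \<and> inj_on f (carrier L) \<and>
    g ` carrier M = carrier N \<and> f ` carrier L = mod_ker M N g"

lemma short_exact_kernel:
  assumes "g \<in> mod_hom R M N" "module R M" "module R N" "g ` carrier M = carrier N"
  shows "short_exact R (M\<lparr>carrier := mod_ker M N g\<rparr>) M N (\<lambda>x. x) g"
  using assms mod_ker_submodule[OF assms(1-3)]
  by (auto simp: short_exact_def module_restrict mod_ker_def mod_hom_def)

lemma mod_hom_inv_into:
  assumes "f \<in> mod_hom R M N" "bij_betw f (carrier M) (carrier N)" "module R M"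
  shows "inv_into (carrier M) f \<in> mod_hom R N M"
proof (rule mod_homI)
  interpret M: module R M by fact
  have inj: "inj_on f (carrier M)" and img: "f ` carrier M = carrier N"
    using assms(2) by (auto simp: bij_betw_def)
  let ?g = "inv_into (carrier M) f"
  show c: "?g x \<in> carrier M" if "x \<in> carrier N" for x
    using that img by (metis inv_into_into)
  have r: "f (?g x) = x" if "x \<in> carrier N" for x
    using that img by (simp add: f_inv_into_f)
  show "?g (x \<oplus>\<^bsub>N\<^esub> y) = ?g x \<oplus>\<^bsub>M\<^esub> ?g y" if "x \<in> carrier N" "y \<in> carrier N" for x y
  proof -
    have "x \<oplus>\<^bsub>N\<^esub> y = f (?g x \<oplus>\<^bsub>M\<^esub> ?g y)" using that c r by (simp add: mod_hom_add[OF assms(1)])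
    then show ?thesis using c that by (simp add: inv_into_f_f[OF inj])
  qed
  show "?g (a \<odot>\<^bsub>N\<^esub> x) = a \<odot>\<^bsub>M\<^esub> ?g x" if "a \<in> carrier R" "x \<in> carrier N" for a x
  proof -
    have "a \<odot>\<^bsub>N\<^esub> x = f (a \<odot>\<^bsub>M\<^esub> ?g x)" using that c r by (simp add: mod_hom_smult[OF assms(1)])
    then show ?thesis using c that by (simp add: inv_into_f_f[OF inj])
  qed
qed

lemma mod_iso_sym:
  assumes "mod_iso R M N" "module R M" shows "mod_iso R N M"
proof -
  obtain f where "f \<in> mod_hom R M N" "bij_betw f (carrier M) (carrier N)"
    using assms(1) unfolding mod_iso_def ..
  then show ?thesis
    unfolding mod_iso_def using mod_hom_inv_into[OF _ _ assms(2)] bij_betw_inv_into by (metis (no_types))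
qed

lemma mod_iso_trans:
  assumes "mod_iso R L M" "mod_iso R M N" shows "mod_iso R L N"
proof -
  obtain f where f: "f \<in> mod_hom R L M" "bij_betw f (carrier L) (carrier M)"
    using assms(1) unfolding mod_iso_def ..
  obtain g where g: "g \<in> mod_hom R M N" "bij_betw g (carrier M) (carrier N)"
    using assms(2) unfolding mod_iso_def ..
  show ?thesis unfolding mod_iso_def
    using bij_betw_trans[OF f(2) g(2)] mod_hom_comp[OF f(1) g(1)]
    by (intro bexI[of _ "\<lambda>x. g (f x)"]) (simp_all add: comp_def)
qed

lemma mod_iso_refl: "mod_iso R M M"
  unfolding mod_iso_def by (rule bexI[of _ "\<lambda>x. x"]) (auto simp: mod_hom_id bij_betw_def)

text \<open>A homomorphism whose values lie in the image of an injective one factors through it.\<close>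

lemma factor_through_inj:
  assumes f: "f \<in> mod_hom R L M" "inj_on f (carrier L)" "module R L"
    and c: "c \<in> mod_hom R G M" and sub: "\<And>y. y \<in> carrier G \<Longrightarrow> c y \<in> f ` carrier L"
  obtains c' where "c' \<in> mod_hom R G L" "\<And>y. y \<in> carrier G \<Longrightarrow> f (c' y) = c y"
proof
  interpret L: module R L by fact
  let ?c = "\<lambda>y. inv_into (carrier L) f (c y)"
  show r: "f (?c y) = c y" if "y \<in> carrier G" for y
    using sub[OF that] by (rule f_inv_into_f)
  have cl: "?c y \<in> carrier L" if "y \<in> carrier G" for y using sub[OF that] by (rule inv_into_into)
  show "?c \<in> mod_hom R G L"
  proof (rule mod_homI)
    show "?c y \<in> carrier L" if "y \<in> carrier G" for y by (rule cl[OF that])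
    show "?c (x \<oplus>\<^bsub>G\<^esub> y) = ?c x \<oplus>\<^bsub>L\<^esub> ?c y" if "x \<in> carrier G" "y \<in> carrier G" for x y
    proof -
      have "c (x \<oplus>\<^bsub>G\<^esub> y) = f (?c x \<oplus>\<^bsub>L\<^esub> ?c y)"
        using that cl r by (simp add: mod_hom_add[OF f(1)] mod_hom_add[OF c])
      then show ?thesis using cl that by (simp add: inv_into_f_f[OF f(2)])
    qed
    show "?c (a \<odot>\<^bsub>G\<^esub> x) = a \<odot>\<^bsub>L\<^esub> ?c x" if "a \<in> carrier R" "x \<in> carrier G" for a x
    proof -
      have "c (a \<odot>\<^bsub>G\<^esub> x) = f (a \<odot>\<^bsub>L\<^esub> ?c x)"
        using that cl r by (simp add: mod_hom_smult[OF f(1)] mod_hom_smult[OF c])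
      then show ?thesis using cl that by (simp add: inv_into_f_f[OF f(2)])
    qed
  qed
qed

text \<open>A homomorphism that vanishes on the kernel of a surjective one factors through it.\<close>

lemma factor_through_surj:
  assumes g: "g \<in> mod_hom R M N" "g ` carrier M = carrier N" and M: "module R M" and N: "module R N"
    and P: "module R P"
    and c: "c \<in> mod_hom R M P" and ker: "\<And>y. y \<in> carrier M \<Longrightarrow> g y = \<zero>\<^bsub>N\<^esub> \<Longrightarrow> c y = \<zero>\<^bsub>P\<^esub>"
  obtains c' where "c' \<in> mod_hom R N P" "\<And>y. y \<in> carrier M \<Longrightarrow> c' (g y) = c y"
proof
  interpret M: module R M by fact
  interpret N: module R N by fact
  interpret P: module R P by fact
  have eq: "c x = c y" if "x \<in> carrier M" "y \<in> carrier M" "g x = g y" for x y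
  proof -
    have "g (x \<ominus>\<^bsub>M\<^esub> y) = \<zero>\<^bsub>N\<^esub>" using mod_hom_minus[OF g(1) M N that(1,2)] that mod_hom_closed[OF g(1)]
      by (simp add: N.minus_eq N.r_neg)
    then have "c x \<ominus>\<^bsub>P\<^esub> c y = \<zero>\<^bsub>P\<^esub>" using ker[of "x \<ominus>\<^bsub>M\<^esub> y"] mod_hom_minus[OF c M P that(1,2)] that by simp
    then show ?thesis using mod_hom_closed[OF c] that module_minus_eq_zero_iff[OF P] by simp
  qed
  let ?i = "inv_into (carrier M) g"
  let ?c = "\<lambda>z. c (?i z)"
  have i: "?i z \<in> carrier M" "g (?i z) = z" if "z \<in> carrier N" for z
    using that g(2) by (metis inv_into_into, metis f_inv_into_f)
  show r: "?c (g y) = c y" if "y \<in> carrier M" for y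
    using eq[of "?i (g y)" y] i[of "g y"] that mod_hom_closed[OF g(1)] by simp
  show "?c \<in> mod_hom R N P"
  proof (rule mod_homI)
    show "?c y \<in> carrier P" if "y \<in> carrier N" for y using i[OF that] mod_hom_closed[OF c] by simp
    show "?c (x \<oplus>\<^bsub>N\<^esub> y) = ?c x \<oplus>\<^bsub>P\<^esub> ?c y" if "x \<in> carrier N" "y \<in> carrier N" for x y
      using r[of "?i x \<oplus>\<^bsub>M\<^esub> ?i y"] i that by (simp add: mod_hom_add[OF g(1)] mod_hom_add[OF c])
    show "?c (a \<odot>\<^bsub>N\<^esub> x) = a \<odot>\<^bsub>P\<^esub> ?c x" if "a \<in> carrier R" "x \<in> carrier N" for a x
      using r[of "a \<odot>\<^bsub>M\<^esub> ?i x"] i that by (simp add: mod_hom_smult[OF g(1)] mod_hom_smult[OF c])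
  qed
qed

lemma mod_iso_of_same_kernel:
  assumes g: "g \<in> mod_hom R M N" "g ` carrier M = carrier N" and M: "module R M" and N: "module R N"
    and P: "module R P" and c: "c \<in> mod_hom R M P" "c ` carrier M = carrier P"
    and ker: "\<And>y. y \<in> carrier M \<Longrightarrow> g y = \<zero>\<^bsub>N\<^esub> \<longleftrightarrow> c y = \<zero>\<^bsub>P\<^esub>"
  shows "mod_iso R N P"
proof -
  obtain c' where c': "c' \<in> mod_hom R N P" "\<And>y. y \<in> carrier M \<Longrightarrow> c' (g y) = c y"
    using factor_through_surj[OF g M N P c(1)] ker by metis
  have "inj_on c' (carrier N)"
    unfolding inj_on_mod_hom_iff[OF c'(1) N P] using c'(2) ker g(2) by (metis imageE)
  moreover have "c' ` carrier N = carrier P"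
    using c'(2) c(2) g(2) by (metis image_image image_cong)
  ultimately show ?thesis using c'(1) by (auto simp: mod_iso_def bij_betw_def)
qed


section \<open>Quotient modules\<close>

lemma a_coset_eq_iff:
  assumes "module R M" "submodule H R M" "x \<in> carrier M" "y \<in> carrier M"
  shows "H +>\<^bsub>M\<^esub> x = H +>\<^bsub>M\<^esub> y \<longleftrightarrow> x \<ominus>\<^bsub>M\<^esub> y \<in> H"
proof -
  interpret M: module R M by fact
  interpret H: abelian_subgroup H M
    using submodule.axioms(1)[OF assms(2)] by (intro abelian_subgroupI3 additive_subgroup.intro) (auto intro: M.abelian_group_axioms)
  have "x \<ominus>\<^bsub>M\<^esub> y \<in> H \<longleftrightarrow> x \<in> H +>\<^bsub>M\<^esub> y" using H.a_rcos_module_minus[of y x] assms M.abelian_group_axioms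
    by (metis H.a_rcos_module M.minus_eq)
  also have "\<dots> \<longleftrightarrow> H +>\<^bsub>M\<^esub> x = H +>\<^bsub>M\<^esub> y"
    using H.a_rcos_self[of x] assms M.a_repr_independence[of x H y] submodule.axioms(1)[OF assms(2)]
    by metis
  finally show ?thesis by simp
qed

lemma carrier_quotient_module:
  "carrier (quotient_module M H) = (\<lambda>x. H +>\<^bsub>M\<^esub> x) ` carrier M"
  by (auto simp: quotient_module_def A_RCOSETS_def' a_r_coset_def')

lemma quotient_moduleE:
  assumes "X \<in> carrier (quotient_module M H)"
  obtains x where "x \<in> carrier M" "X = H +>\<^bsub>M\<^esub> x"
  using assms unfolding carrier_quotient_module by (elim imageE) (rule that)

lemma quotient_module_add:
  assumes "module R M" "submodule H R M" "x \<in> carrier M" "y \<in> carrier M"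
  shows "(H +>\<^bsub>M\<^esub> x) \<oplus>\<^bsub>quotient_module M H\<^esub> (H +>\<^bsub>M\<^esub> y) = H +>\<^bsub>M\<^esub> (x \<oplus>\<^bsub>M\<^esub> y)"
proof -
  interpret M: module R M by fact
  interpret H: abelian_subgroup H M
    using submodule.axioms(1)[OF assms(2)] by (intro abelian_subgroupI3 additive_subgroup.intro) (auto intro: M.abelian_group_axioms)
  show ?thesis using assms by (simp add: quotient_module_def H.a_rcos_sum)
qed

lemma quotient_module_smult:
  assumes "module R M" "submodule H R M" "x \<in> carrier M" "a \<in> carrier R"
  shows "a \<odot>\<^bsub>quotient_module M H\<^esub> (H +>\<^bsub>M\<^esub> x) = H +>\<^bsub>M\<^esub> (a \<odot>\<^bsub>M\<^esub> x)"
proof -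
  interpret M: module R M by fact
  have sub: "H \<subseteq> carrier M" by (rule M.submoduleE(1)[OF assms(2)])
  have self: "x \<in> H +>\<^bsub>M\<^esub> x" using assms(3) submodule_zero[OF assms(2)] by (force simp: a_r_coset_def')
  have "H +>\<^bsub>M\<^esub> (a \<odot>\<^bsub>M\<^esub> y) = H +>\<^bsub>M\<^esub> (a \<odot>\<^bsub>M\<^esub> x)" if y: "y \<in> H +>\<^bsub>M\<^esub> x" for y
  proof -
    obtain h where h: "h \<in> H" "y = h \<oplus>\<^bsub>M\<^esub> x" using y by (auto simp: a_r_coset_def')
    then have hc: "h \<in> carrier M" using sub by auto
    have "a \<odot>\<^bsub>M\<^esub> y \<ominus>\<^bsub>M\<^esub> a \<odot>\<^bsub>M\<^esub> x = a \<odot>\<^bsub>M\<^esub> h"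
      using h hc assms by (simp add: M.smult_r_distr M.minus_eq M.a_assoc M.r_neg)
    then show ?thesis
      using a_coset_eq_iff[OF assms(1,2), of "a \<odot>\<^bsub>M\<^esub> y" "a \<odot>\<^bsub>M\<^esub> x"] h hc assms M.submoduleE(4)[OF assms(2)]
      by simp
  qed
  then have "(\<Union>y\<in>H +>\<^bsub>M\<^esub> x. H +>\<^bsub>M\<^esub> (a \<odot>\<^bsub>M\<^esub> y)) = H +>\<^bsub>M\<^esub> (a \<odot>\<^bsub>M\<^esub> x)"
    using self by blast
  then show ?thesis by (simp add: quotient_module_def)
qed

lemma quotient_module_module:
  assumes "module R M" "submodule H R M"
  shows "module R (quotient_module M H)"
proof -
  interpret M: module R M by fact
  interpret H: abelian_subgroup H M
    using submodule.axioms(1)[OF assms(2)] by (intro abelian_subgroupI3 additive_subgroup.intro) (auto intro: M.abelian_group_axioms)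
  let ?Q = "quotient_module M H"
  note add = quotient_module_add[OF assms] and sm = quotient_module_smult[OF assms]
  have z: "\<zero>\<^bsub>?Q\<^esub> = H +>\<^bsub>M\<^esub> \<zero>\<^bsub>M\<^esub>" by (simp add: quotient_module_def H.a_subset)
  show ?thesis
  proof (rule moduleI)
    show "cring R" by (rule M.is_cring)
    show "abelian_group ?Q"
    proof (rule abelian_groupI)
      show "x \<oplus>\<^bsub>?Q\<^esub> y \<in> carrier ?Q" if "x \<in> carrier ?Q" "y \<in> carrier ?Q" for x y
        using that add by (auto simp: carrier_quotient_module)
      show "\<zero>\<^bsub>?Q\<^esub> \<in> carrier ?Q" unfolding z carrier_quotient_module by simp
      show "(x \<oplus>\<^bsub>?Q\<^esub> y) \<oplus>\<^bsub>?Q\<^esub> w = x \<oplus>\<^bsub>?Q\<^esub> (y \<oplus>\<^bsub>?Q\<^esub> w)"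
        if "x \<in> carrier ?Q" "y \<in> carrier ?Q" "w \<in> carrier ?Q" for x y w
        using that add by (auto simp: carrier_quotient_module M.a_assoc)
      show "x \<oplus>\<^bsub>?Q\<^esub> y = y \<oplus>\<^bsub>?Q\<^esub> x" if "x \<in> carrier ?Q" "y \<in> carrier ?Q" for x y
        using that add by (auto simp: carrier_quotient_module M.a_comm)
      show "\<zero>\<^bsub>?Q\<^esub> \<oplus>\<^bsub>?Q\<^esub> x = x" if "x \<in> carrier ?Q" for x
        using that add by (auto simp: carrier_quotient_module z)
      show "\<exists>y\<in>carrier ?Q. y \<oplus>\<^bsub>?Q\<^esub> x = \<zero>\<^bsub>?Q\<^esub>" if x: "x \<in> carrier ?Q" for x
      proof -
        obtain w where w: "w \<in> carrier M" "x = H +>\<^bsub>M\<^esub> w" using x by (rule quotient_moduleE)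
        then have "(H +>\<^bsub>M\<^esub> (\<ominus>\<^bsub>M\<^esub> w)) \<oplus>\<^bsub>?Q\<^esub> x = \<zero>\<^bsub>?Q\<^esub>"
          using add[of "\<ominus>\<^bsub>M\<^esub> w" w] by (simp only: M.a_inv_closed M.l_neg z)
        then show ?thesis using w(1) M.a_inv_closed[OF w(1)] unfolding carrier_quotient_module by blast
      qed
    qed
    show "a \<odot>\<^bsub>?Q\<^esub> x \<in> carrier ?Q" if "a \<in> carrier R" "x \<in> carrier ?Q" for a x
      using that sm by (auto simp: carrier_quotient_module)
    show "(a \<oplus>\<^bsub>R\<^esub> b) \<odot>\<^bsub>?Q\<^esub> x = a \<odot>\<^bsub>?Q\<^esub> x \<oplus>\<^bsub>?Q\<^esub> b \<odot>\<^bsub>?Q\<^esub> x"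
      if "a \<in> carrier R" "b \<in> carrier R" "x \<in> carrier ?Q" for a b x
      using that by (auto simp: carrier_quotient_module sm add M.smult_l_distr)
    show "a \<odot>\<^bsub>?Q\<^esub> (x \<oplus>\<^bsub>?Q\<^esub> y) = a \<odot>\<^bsub>?Q\<^esub> x \<oplus>\<^bsub>?Q\<^esub> a \<odot>\<^bsub>?Q\<^esub> y"
      if "a \<in> carrier R" "x \<in> carrier ?Q" "y \<in> carrier ?Q" for a x y
      using that by (auto simp: carrier_quotient_module sm add M.smult_r_distr)
    show "(a \<otimes>\<^bsub>R\<^esub> b) \<odot>\<^bsub>?Q\<^esub> x = a \<odot>\<^bsub>?Q\<^esub> (b \<odot>\<^bsub>?Q\<^esub> x)"
      if "a \<in> carrier R" "b \<in> carrier R" "x \<in> carrier ?Q" for a b x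
      using that by (auto simp: carrier_quotient_module sm M.smult_assoc1)
    show "\<one>\<^bsub>R\<^esub> \<odot>\<^bsub>?Q\<^esub> x = x" if "x \<in> carrier ?Q" for x
      using that by (auto simp: carrier_quotient_module sm)
  qed
qed

lemma quotient_module_proj:
  assumes "module R M" "submodule H R M"
  shows "(\<lambda>x. H +>\<^bsub>M\<^esub> x) \<in> mod_hom R M (quotient_module M H)"
  by (rule mod_homI)
    (auto simp: carrier_quotient_module quotient_module_add[OF assms] quotient_module_smult[OF assms])

lemma quotient_module_eq_zero_iff:
  assumes "module R M" "submodule H R M" "x \<in> carrier M"
  shows "H +>\<^bsub>M\<^esub> x = \<zero>\<^bsub>quotient_module M H\<^esub> \<longleftrightarrow> x \<in> H"
proof -
  interpret M: module R M by fact
  have "H +>\<^bsub>M\<^esub> \<zero>\<^bsub>M\<^esub> = H" using M.submoduleE(1)[OF assms(2)] by simp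
  then show ?thesis using a_coset_eq_iff[OF assms, of "\<zero>\<^bsub>M\<^esub>"] assms(3)
    using M.add.inv_one by (simp add: quotient_module_def a_minus_def a_inv_def)
qed

lemma short_exact_quotient:
  assumes "module R M" "submodule H R M"
  shows "short_exact R (M\<lparr>carrier := H\<rparr>) M (quotient_module M H) (\<lambda>x. x) (\<lambda>x. H +>\<^bsub>M\<^esub> x)"
proof -
  have ker: "mod_ker M (quotient_module M H) (\<lambda>x. H +>\<^bsub>M\<^esub> x) = H"
    using quotient_module_eq_zero_iff[OF assms] submodule_subset[OF assms] unfolding mod_ker_def by blast
  show ?thesis
    using short_exact_kernel[OF quotient_module_proj[OF assms] assms(1) quotient_module_module[OF assms]
        carrier_quotient_module[symmetric]]
    unfolding ker .
qed


section \<open>Free modules and finite generation\<close>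

text \<open>
  The elements vanish outside the index set, so that the operations do not depend on it and
  free modules on subsets are submodules.
\<close>

definition free_module :: "('a, 'r) ring_scheme \<Rightarrow> 'i set \<Rightarrow> ('a, 'i \<Rightarrow> 'a) module"
  where "free_module R X =
    \<lparr>carrier = {f. (\<forall>i\<in>X. f i \<in> carrier R) \<and> (\<forall>i. i \<notin> X \<longrightarrow> f i = \<zero>\<^bsub>R\<^esub>)},
     monoid.mult = undefined, one = undefined,
     zero = (\<lambda>i. \<zero>\<^bsub>R\<^esub>), add = (\<lambda>f g i. f i \<oplus>\<^bsub>R\<^esub> g i), smult = (\<lambda>a f i. a \<otimes>\<^bsub>R\<^esub> f i)\<rparr>"

definition unit_vec :: "('a, 'r) ring_scheme \<Rightarrow> 'i \<Rightarrow> 'i \<Rightarrow> 'a"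
  where "unit_vec R i = (\<lambda>j. if j = i then \<one>\<^bsub>R\<^esub> else \<zero>\<^bsub>R\<^esub>)"

lemma free_module_simps [simp]:
  "\<zero>\<^bsub>free_module R X\<^esub> = (\<lambda>i. \<zero>\<^bsub>R\<^esub>)"
  "f \<oplus>\<^bsub>free_module R X\<^esub> g = (\<lambda>i. f i \<oplus>\<^bsub>R\<^esub> g i)"
  "a \<odot>\<^bsub>free_module R X\<^esub> f = (\<lambda>i. a \<otimes>\<^bsub>R\<^esub> f i)"
  by (simp_all add: free_module_def)

lemma carrier_free_module:
  "f \<in> carrier (free_module R X) \<longleftrightarrow> (\<forall>i\<in>X. f i \<in> carrier R) \<and> (\<forall>i. i \<notin> X \<longrightarrow> f i = \<zero>\<^bsub>R\<^esub>)"
  by (simp add: free_module_def)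

lemma free_module_value:
  assumes "cring R" "f \<in> carrier (free_module R X)" shows "f i \<in> carrier R"
proof -
  interpret cring R by fact
  show ?thesis using assms(2) by (cases "i \<in> X") (auto simp: carrier_free_module)
qed

lemma carrier_free_module':
  "cring R \<Longrightarrow> f \<in> carrier (free_module R X) \<longleftrightarrow>
    (\<forall>i. f i \<in> carrier R) \<and> (\<forall>i. i \<notin> X \<longrightarrow> f i = \<zero>\<^bsub>R\<^esub>)"
  by (meson carrier_free_module free_module_value)

lemma free_module_module:
  assumes "cring R" shows "module R (free_module R X)"
proof -
  interpret R: cring R by fact
  let ?F = "free_module R X"
  note v = carrier_free_module'[OF assms]
  show ?thesis
  proof (rule moduleI)
    show "abelian_group ?F"
    proof (rule abelian_groupI)
      show "\<exists>y\<in>carrier ?F. y \<oplus>\<^bsub>?F\<^esub> x = \<zero>\<^bsub>?F\<^esub>" if "x \<in> carrier ?F" for x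
        using that by (intro bexI[of _ "\<lambda>i. \<ominus>\<^bsub>R\<^esub> x i"]) (auto simp: v R.l_neg)
    qed (auto simp: v R.a_ac fun_eq_iff)
  qed (auto simp: v R.l_distr R.r_distr R.m_assoc assms fun_eq_iff)
qed

lemma unit_vec_carrier: "cring R \<Longrightarrow> i \<in> X \<Longrightarrow> unit_vec R i \<in> carrier (free_module R X)"
proof -
  assume "cring R" "i \<in> X"
  then interpret cring R by simp
  show ?thesis using \<open>i \<in> X\<close> by (auto simp: carrier_free_module unit_vec_def)
qed

lemma self_module_simps [simp]:
  "carrier (self_module R) = carrier R" "\<zero>\<^bsub>self_module R\<^esub> = \<zero>\<^bsub>R\<^esub>"
  "x \<oplus>\<^bsub>self_module R\<^esub> y = x \<oplus>\<^bsub>R\<^esub> y" "a \<odot>\<^bsub>self_module R\<^esub> x = a \<otimes>\<^bsub>R\<^esub> x"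
  by (simp_all add: self_module_def)

lemma self_module_module:
  assumes "cring R" shows "module R (self_module R)"
proof -
  interpret R: cring R by fact
  show ?thesis
  proof (rule moduleI)
    show "abelian_group (self_module R)"
      by (rule abelian_groupI) (auto simp: R.a_ac intro: bexI[of _ "\<ominus>\<^bsub>R\<^esub> x" for x] R.l_neg)
  qed (auto simp: R.l_distr R.r_distr R.m_assoc assms)
qed

lemma self_module_uminus:
  assumes "cring R" "x \<in> carrier R" shows "\<ominus>\<^bsub>self_module R\<^esub> x = \<ominus>\<^bsub>R\<^esub> x"
proof -
  interpret R: cring R by fact
  interpret S: module R "self_module R" by (rule self_module_module) fact
  have "\<ominus>\<^bsub>R\<^esub> x \<oplus>\<^bsub>self_module R\<^esub> x = \<zero>\<^bsub>self_module R\<^esub>" using assms by (simp add: R.l_neg)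
  then show ?thesis using S.minus_equality[of "\<ominus>\<^bsub>R\<^esub> x" x] assms by simp
qed

lemma submodule_self_iff_ideal:
  assumes "cring R" shows "submodule I R (self_module R) \<longleftrightarrow> ideal I R"
proof
  interpret R: cring R by fact
  interpret S: module R "self_module R" by (rule self_module_module) fact
  show "ideal I R" if I: "submodule I R (self_module R)"
  proof (rule idealI)
    have sub: "I \<subseteq> carrier R" using S.submoduleE(1)[OF I] by simp
    show "subgroup I (add_monoid R)"
      using sub S.submoduleE(2,3,5)[OF I]
      by (intro group.subgroupI R.add.is_group) (auto simp: self_module_uminus[OF assms] subset_iff a_inv_def[symmetric])
    show "x \<otimes>\<^bsub>R\<^esub> a \<in> I" if "a \<in> I" "x \<in> carrier R" for a x using S.submoduleE(4)[OF I that(2,1)] by simp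
    then show "a \<otimes>\<^bsub>R\<^esub> x \<in> I" if "a \<in> I" "x \<in> carrier R" for a x
      using that sub R.m_comm by (metis subsetD)
  qed (rule R.ring_axioms)
  show "submodule I R (self_module R)" if I: "ideal I R"
  proof -
    interpret I: ideal I R by fact
    show ?thesis
      by (rule submoduleI'[OF self_module_module[OF assms]]) (auto intro: I.I_l_closed I.Icarr)
  qed
qed

text \<open>This sequence reduces statements about free modules of finite rank to statements about \<open>R\<close>.\<close>

lemma free_module_insert_exact:
  assumes "cring R" "x \<notin> X"
  shows "short_exact R (free_module R X) (free_module R (insert x X)) (self_module R) (\<lambda>f. f) (\<lambda>f. f x)"
proof -
  interpret R: cring R by fact
  note v = free_module_value[OF assms(1)]
  have "a \<in> (\<lambda>f. f x) ` carrier (free_module R (insert x X))" if "a \<in> carrier R" for a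
    by (rule image_eqI[of _ _ "\<lambda>i. if i = x then a else \<zero>\<^bsub>R\<^esub>"]) (use that in \<open>auto simp: carrier_free_module\<close>)
  then have "(\<lambda>f. f x) ` carrier (free_module R (insert x X)) = carrier R"
    by (intro equalityI subsetI) (elim imageE, simp only: v)
  moreover have "carrier (free_module R X) = mod_ker (free_module R (insert x X)) (self_module R) (\<lambda>f. f x)"
    using assms(2) by (auto simp: mod_ker_def carrier_free_module'[OF assms(1)])
  moreover have "(\<lambda>f. f) \<in> mod_hom R (free_module R X) (free_module R (insert x X))"
    by (auto simp: mod_hom_def carrier_free_module'[OF assms(1)])
  moreover have "(\<lambda>f. f x) \<in> mod_hom R (free_module R (insert x X)) (self_module R)"
    by (simp add: mod_hom_def Pi_def v)
  ultimately show ?thesis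
    by (simp add: short_exact_def free_module_module self_module_module assms(1))
qed

lemma mod_hom_free_ext:
  assumes N: "module R N" and "finite X" and "\<And>i. i \<in> X \<Longrightarrow> v i \<in> carrier N"
  shows "\<exists>c \<in> mod_hom R (free_module R X) N. \<forall>i\<in>X. c (unit_vec R i) = v i"
  using assms(2,3)
proof (induction X)
  case empty
  then show ?case using mod_hom_zero_map[OF N] by auto
next
  case (insert x X)
  interpret N: module R N by fact
  have R: "cring R" by (rule N.is_cring)
  let ?F = "free_module R (insert x X)" and ?G = "free_module R X"
  note va = free_module_value[OF R]
  obtain c where c: "c \<in> mod_hom R ?G N" "\<forall>i\<in>X. c (unit_vec R i) = v i"
    using insert by auto
  let ?r = "\<lambda>f. f(x := \<zero>\<^bsub>R\<^esub>)"
  have r: "?r \<in> mod_hom R ?F ?G"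
    using insert(2) by (auto simp: mod_hom_def carrier_free_module fun_eq_iff)
  have e: "(\<lambda>f. f x \<odot>\<^bsub>N\<^esub> v x) \<in> mod_hom R ?F N"
    using insert(4)[of x] by (auto simp: mod_hom_def carrier_free_module'[OF R] N.smult_l_distr N.smult_assoc1)
  let ?c = "\<lambda>f. c (?r f) \<oplus>\<^bsub>N\<^esub> f x \<odot>\<^bsub>N\<^esub> v x"
  have "?c \<in> mod_hom R ?F N"
    by (rule mod_hom_sum[OF mod_hom_comp[OF r c(1)] e free_module_module[OF R] N])
  moreover have "?c (unit_vec R i) = v i" if "i \<in> insert x X" for i
  proof (cases "i = x")
    case True
    have "?r (unit_vec R x) = \<zero>\<^bsub>?G\<^esub>" by (auto simp: unit_vec_def)
    then have "c (?r (unit_vec R x)) = \<zero>\<^bsub>N\<^esub>" using mod_hom_zero[OF c(1) free_module_module[OF R] N] by simp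
    then show ?thesis using True insert(4)[of x] by (simp add: unit_vec_def)
  next
    case False
    have "?r (unit_vec R i) = unit_vec R i" using False by (auto simp: unit_vec_def)
    then show ?thesis using False that c(2) insert(4)[of x] insert(4)[of i] by (simp add: unit_vec_def)
  qed
  ultimately show ?case by (intro bexI[of _ ?c] ballI)
qed

lemma free_module_generated:
  assumes R: "cring R" and "finite X" and H: "submodule H R (free_module R X)"
    and e: "\<And>i. i \<in> X \<Longrightarrow> unit_vec R i \<in> H"
  shows "H = carrier (free_module R X)"
proof
  interpret R: cring R by fact
  interpret F: module R "free_module R X" by (rule free_module_module[OF R])
  show "H \<subseteq> carrier (free_module R X)" by (rule F.submoduleE(1)[OF H])
  have "f \<in> H" if "f \<in> carrier (free_module R Y)" "Y \<subseteq> X" for f Y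
    using finite_subset[OF that(2) \<open>finite X\<close>] that
  proof (induction Y arbitrary: f)
    case empty
    then have "f = \<zero>\<^bsub>free_module R X\<^esub>" by (auto simp: carrier_free_module)
    then show ?case using submodule_zero[OF H] by simp
  next
    case (insert y Y)
    note v = free_module_value[OF R insert(4)]
    have "f(y := \<zero>\<^bsub>R\<^esub>) \<in> carrier (free_module R Y)" using insert by (auto simp: carrier_free_module)
    then have "f(y := \<zero>\<^bsub>R\<^esub>) \<in> H" using insert by auto
    moreover have "f y \<odot>\<^bsub>free_module R X\<^esub> unit_vec R y \<in> H"
      using F.submoduleE(4)[OF H v[of y] e[of y]] insert by auto
    ultimately have "f(y := \<zero>\<^bsub>R\<^esub>) \<oplus>\<^bsub>free_module R X\<^esub> (f y \<odot>\<^bsub>free_module R X\<^esub> unit_vec R y) \<in> H"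
      by (rule F.submoduleE(5)[OF H])
    moreover have "f(y := \<zero>\<^bsub>R\<^esub>) \<oplus>\<^bsub>free_module R X\<^esub> (f y \<odot>\<^bsub>free_module R X\<^esub> unit_vec R y) = f"
      using v by (auto simp: unit_vec_def)
    ultimately show ?case by simp
  qed
  then show "carrier (free_module R X) \<subseteq> H" by blast
qed

text \<open>
  Free modules of finite rank are projective, with respect to modules of any type: choose preimages
  of the values on the basis.
\<close>

lemma lift_through_surj:
  assumes g: "g \<in> mod_hom R M N" "g ` carrier M = carrier N" and M: "module R M" and N: "module R N"
    and X: "finite X" and c: "c \<in> mod_hom R (free_module R X) N"
  obtains c' where "c' \<in> mod_hom R (free_module R X) M"
    "\<And>y. y \<in> carrier (free_module R X) \<Longrightarrow> g (c' y) = c y"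
proof -
  interpret N: module R N by fact
  have R: "cring R" by (rule N.is_cring)
  note F = free_module_module[OF R, of X]
  define v where "v = (\<lambda>i. inv_into (carrier M) g (c (unit_vec R i)))"
  have v: "v i \<in> carrier M" "g (v i) = c (unit_vec R i)" if "i \<in> X" for i
  proof -
    have "c (unit_vec R i) \<in> g ` carrier M"
      using mod_hom_closed[OF c unit_vec_carrier[OF R that]] g(2) by simp
    then show "v i \<in> carrier M" "g (v i) = c (unit_vec R i)"
      unfolding v_def by (rule inv_into_into, rule f_inv_into_f)
  qed
  have "\<exists>c' \<in> mod_hom R (free_module R X) M. \<forall>i\<in>X. c' (unit_vec R i) = v i"
    by (rule mod_hom_free_ext[OF M X v(1)])
  then obtain c' where c': "c' \<in> mod_hom R (free_module R X) M" "\<forall>i\<in>X. c' (unit_vec R i) = v i"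
    by (elim bexE)
  let ?h = "\<lambda>y. g (c' y) \<ominus>\<^bsub>N\<^esub> c y"
  have h: "?h \<in> mod_hom R (free_module R X) N"
    by (rule mod_hom_diff[OF mod_hom_comp[OF c'(1) g(1)] c F N])
  have "mod_ker (free_module R X) N ?h = carrier (free_module R X)"
  proof (rule free_module_generated[OF R X mod_ker_submodule[OF h F N]])
    fix i assume i: "i \<in> X"
    then show "unit_vec R i \<in> mod_ker (free_module R X) N ?h"
      using c'(2) v[OF i] unit_vec_carrier[OF R i] module_minus_eq_zero_iff[OF N] mod_hom_closed[OF c]
      by (simp add: mod_ker_def)
  qed
  then have z: "?h y = \<zero>\<^bsub>N\<^esub>" if "y \<in> carrier (free_module R X)" for y
    using that by (auto simp: mod_ker_def)
  have "g (c' y) = c y" if y: "y \<in> carrier (free_module R X)" for y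
    using z[OF y] module_minus_eq_zero_iff[OF N mod_hom_closed[OF g(1) mod_hom_closed[OF c'(1) y]] mod_hom_closed[OF c y]]
    by simp
  with c'(1) show ?thesis by (rule that)
qed

lemma mod_span_submodule:
  assumes M: "module R M" and S: "S \<subseteq> carrier M" shows "submodule (mod_span R M S) R M"
proof -
  interpret M: module R M by fact
  show ?thesis unfolding mod_span_def
  proof (rule submoduleI'[OF M])
    show "\<Inter>{H. submodule H R M \<and> S \<subseteq> H} \<subseteq> carrier M" using M.carrier_is_submodule S by blast
  qed (auto simp: submodule_zero intro: M.submoduleE(4,5))
qed

lemma mod_span_superset: "S \<subseteq> mod_span R M S"
  by (auto simp: mod_span_def)

lemma mod_span_least: "submodule H R M \<Longrightarrow> S \<subseteq> H \<Longrightarrow> mod_span R M S \<subseteq> H"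
  by (auto simp: mod_span_def)

lemma mod_span_restrict:
  assumes M: "module R M" and H: "submodule H R M" and S: "S \<subseteq> H"
  shows "mod_span R (M\<lparr>carrier := H\<rparr>) S = mod_span R M S"
proof
  interpret M: module R M by fact
  have SM: "S \<subseteq> carrier M" using S M.submoduleE(1)[OF H] by auto
  note MH = module_restrict[OF M H]
  have sub: "submodule (mod_span R M S) R M" by (rule mod_span_submodule[OF M SM])
  show "mod_span R (M\<lparr>carrier := H\<rparr>) S \<subseteq> mod_span R M S"
    using sub mod_span_least[OF H S]
    by (intro mod_span_least mod_span_superset) (simp add: submodule_restrict_iff[OF M H])
  have "submodule (mod_span R (M\<lparr>carrier := H\<rparr>) S) R (M\<lparr>carrier := H\<rparr>)"
    by (rule mod_span_submodule[OF MH]) (use S in simp)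
  then show "mod_span R M S \<subseteq> mod_span R (M\<lparr>carrier := H\<rparr>) S"
    by (intro mod_span_least mod_span_superset) (simp add: submodule_restrict_iff[OF M H])
qed

lemma fin_gen_image:
  assumes f: "f \<in> mod_hom R M N" "f ` carrier M = carrier N" and M: "module R M" and N: "module R N"
    and fg: "fin_gen R M"
  shows "fin_gen R N"
proof -
  obtain S where S: "finite S" "S \<subseteq> carrier M" "mod_span R M S = carrier M" using fg by (auto simp: fin_gen_def)
  have sub: "f ` S \<subseteq> carrier N" using S(2) f(2) by blast
  let ?H = "mod_span R N (f ` S)"
  have H: "submodule ?H R N" by (rule mod_span_submodule[OF N sub])
  have "S \<subseteq> {x \<in> carrier M. f x \<in> ?H}" using mod_span_superset[of "f ` S" R N] S(2) by auto
  then have "carrier M \<subseteq> {x \<in> carrier M. f x \<in> ?H}"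
    using mod_span_least[OF submodule_vimage[OF f(1) M N H], of S] S(3) by simp
  then have "f ` carrier M \<subseteq> ?H" by (intro image_subsetI) (simp add: subset_iff)
  then have "?H = carrier N" using submodule_subset[OF N H] f(2) by simp
  then show ?thesis unfolding fin_gen_def using S(1) sub by (intro exI[of _ "f ` S"]) simp
qed

lemma free_module_fin_gen:
  assumes R: "cring R" and X: "finite X" shows "fin_gen R (free_module R X)"
proof -
  have sub: "unit_vec R ` X \<subseteq> carrier (free_module R X)"
    by (intro image_subsetI unit_vec_carrier[OF R])
  have "mod_span R (free_module R X) (unit_vec R ` X) = carrier (free_module R X)"
    by (intro free_module_generated[OF R X mod_span_submodule[OF free_module_module[OF R] sub]]
        subsetD[OF mod_span_superset] imageI)
  then show ?thesis unfolding fin_gen_def using X sub by (intro exI[of _ "unit_vec R ` X"]) simp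
qed

lemma fin_gen_cover:
  assumes M: "module R M" and fg: "fin_gen R M"
  obtains m :: nat and c where "c \<in> mod_hom R (free_module R {..<m}) M"
    "c ` carrier (free_module R {..<m}) = carrier M"
proof -
  interpret M: module R M by fact
  note R = M.is_cring
  obtain S where S: "finite S" "S \<subseteq> carrier M" "mod_span R M S = carrier M" using fg by (auto simp: fin_gen_def)
  obtain v where v: "bij_betw v {..<card S} S" using ex_bij_betw_nat_finite[OF S(1)] atLeast0LessThan by metis
  let ?F = "free_module R {..<card S}"
  have vc: "v i \<in> carrier M" if "i \<in> {..<card S}" for i using that v S(2) by (auto simp: bij_betw_def)
  have "\<exists>c \<in> mod_hom R ?F M. \<forall>i\<in>{..<card S}. c (unit_vec R i) = v i"
    by (rule mod_hom_free_ext[OF M finite_lessThan vc])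
  then obtain c where c: "c \<in> mod_hom R ?F M" "\<forall>i\<in>{..<card S}. c (unit_vec R i) = v i"
    by (elim bexE)
  have F: "module R ?F" by (rule free_module_module[OF R])
  interpret F: module R ?F by fact
  have im: "submodule (c ` carrier ?F) R M" by (rule submodule_image[OF c(1) F M F.carrier_is_submodule])
  have "S \<subseteq> c ` carrier ?F"
  proof
    fix s assume "s \<in> S"
    then obtain i where "i \<in> {..<card S}" "s = v i" using v by (auto simp: bij_betw_def)
    then show "s \<in> c ` carrier ?F" using c(2) unit_vec_carrier[OF R, of i "{..<card S}"]
      by (intro image_eqI[of _ _ "unit_vec R i"]) simp_all
  qed
  then have "c ` carrier ?F = carrier M" using mod_span_least[OF im] S(3) M.submoduleE(1)[OF im] by blast
  with c(1) show ?thesis by (rule that)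
qed

definition noetherian_module :: "('a, 'r) ring_scheme \<Rightarrow> ('a, 'm) module \<Rightarrow> bool"
  where "noetherian_module R M \<longleftrightarrow> module R M \<and> (\<forall>H. submodule H R M \<longrightarrow> fin_gen R (M\<lparr>carrier := H\<rparr>))"

lemma noetherian_module_extension:
  assumes ex: "short_exact R L M N f g" and L: "noetherian_module R L" and N: "noetherian_module R N"
  shows "noetherian_module R M"
  unfolding noetherian_module_def
proof (intro conjI allI impI)
  note ex' = ex[unfolded short_exact_def]
  show M: "module R M" using ex' by auto
  have mL: "module R L" and mN: "module R N" and f: "f \<in> mod_hom R L M" and g: "g \<in> mod_hom R M N"
    and ker: "f ` carrier L = mod_ker M N g" using ex' by auto
  interpret M: module R M by fact
  interpret L: module R L by fact
  interpret N: module R N by fact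
  fix H assume H: "submodule H R M"
  have Hs: "H \<subseteq> carrier M" by (rule M.submoduleE(1)[OF H])
  let ?A = "{x \<in> carrier L. f x \<in> H}" and ?B = "g ` H"
  have A: "submodule ?A R L" by (rule submodule_vimage[OF f mL M H])
  have B: "submodule ?B R N" by (rule submodule_image[OF g M mN H])
  obtain S where S: "finite S" "S \<subseteq> ?A" "mod_span R L S = ?A"
  proof -
    have "fin_gen R (L\<lparr>carrier := ?A\<rparr>)" using L A by (auto simp: noetherian_module_def)
    then obtain S where S: "finite S" "S \<subseteq> ?A" "mod_span R (L\<lparr>carrier := ?A\<rparr>) S = ?A"
      unfolding fin_gen_def by auto
    with mod_span_restrict[OF mL A S(2)] show ?thesis by (intro that) simp_all
  qed
  obtain T where T: "finite T" "T \<subseteq> ?B" "mod_span R N T = ?B"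
  proof -
    have "fin_gen R (N\<lparr>carrier := ?B\<rparr>)" using N B by (auto simp: noetherian_module_def)
    then obtain T where T: "finite T" "T \<subseteq> ?B" "mod_span R (N\<lparr>carrier := ?B\<rparr>) T = ?B"
      unfolding fin_gen_def by auto
    with mod_span_restrict[OF mN B T(2)] show ?thesis by (intro that) simp_all
  qed
  obtain U where U: "finite U" "U \<subseteq> H" "T = g ` U" using finite_subset_image[OF T(1,2)] by auto
  let ?V = "f ` S \<union> U" and ?X = "mod_span R M (f ` S \<union> U)"
  have V: "?V \<subseteq> H" using S(2) U(2) by auto
  have X: "submodule ?X R M" by (rule mod_span_submodule[OF M]) (use V Hs in blast)
  have XH: "?X \<subseteq> H" by (rule mod_span_least[OF H V])
  have VX: "?V \<subseteq> ?X" by (rule mod_span_superset)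
  have "?A \<subseteq> {x \<in> carrier L. f x \<in> ?X}"
    using mod_span_least[OF submodule_vimage[OF f mL M X], of S] S VX by auto
  then have AX: "f x \<in> ?X" if "x \<in> carrier L" "f x \<in> H" for x using that by blast
  have "?B \<subseteq> g ` ?X"
    using mod_span_least[OF submodule_image[OF g M mN X], of T] T(3) U(3) image_mono[of U ?X g] VX by simp
  have "H \<subseteq> ?X"
  proof
    fix h assume h: "h \<in> H"
    then obtain x where x: "x \<in> ?X" "g h = g x" using \<open>?B \<subseteq> g ` ?X\<close> by blast
    have c: "h \<in> carrier M" "x \<in> carrier M" using h x XH Hs by auto
    have "g (h \<ominus>\<^bsub>M\<^esub> x) = \<zero>\<^bsub>N\<^esub>"
      using mod_hom_minus[OF g M mN c] x(2) module_minus_eq_zero_iff[OF mN] mod_hom_closed[OF g] c by simp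
    then have "h \<ominus>\<^bsub>M\<^esub> x \<in> f ` carrier L" using ker c by (simp add: mod_ker_def)
    then obtain l where l: "l \<in> carrier L" "h \<ominus>\<^bsub>M\<^esub> x = f l" by blast
    have "f l \<in> H" using l(2) submodule_minus[OF M H h, of x] subsetD[OF XH x(1)] by simp
    then have "h \<ominus>\<^bsub>M\<^esub> x \<in> ?X" using AX l by simp
    then have "(h \<ominus>\<^bsub>M\<^esub> x) \<oplus>\<^bsub>M\<^esub> x \<in> ?X" using M.submoduleE(5)[OF X _ x(1)] by simp
    moreover have "(h \<ominus>\<^bsub>M\<^esub> x) \<oplus>\<^bsub>M\<^esub> x = h" using c by (simp add: M.minus_eq M.a_assoc M.l_neg)
    ultimately show "h \<in> ?X" by simp
  qed
  then have "mod_span R (M\<lparr>carrier := H\<rparr>) ?V = H" using mod_span_restrict[OF M H V] XH by auto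
  then show "fin_gen R (M\<lparr>carrier := H\<rparr>)"
    unfolding fin_gen_def using S(1) U(1) V by (intro exI[of _ ?V]) simp
qed

lemma self_module_noetherian:
  assumes R: "cring R" and "noetherian_ring R" shows "noetherian_module R (self_module R)"
  unfolding noetherian_module_def
proof (intro conjI allI impI)
  interpret N: noetherian_ring R by fact
  show SM: "module R (self_module R)" by (rule self_module_module[OF R])
  fix I assume I: "submodule I R (self_module R)"
  then have "ideal I R" by (simp add: submodule_self_iff_ideal[OF R])
  then obtain A where A: "A \<subseteq> carrier R" "finite A" "I = Idl\<^bsub>R\<^esub> A" using N.finetely_gen by blast
  have AI: "A \<subseteq> I" using A(3) N.genideal_self[OF A(1)] by simp
  have "mod_span R (self_module R) A = I"
    unfolding A(3) genideal_def mod_span_def submodule_self_iff_ideal[OF R] ..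
  then have "mod_span R (self_module R\<lparr>carrier := I\<rparr>) A = I" using mod_span_restrict[OF SM I AI] by simp
  then show "fin_gen R (self_module R\<lparr>carrier := I\<rparr>)"
    unfolding fin_gen_def using A AI by (intro exI[of _ A]) simp
qed

lemma free_module_noetherian:
  fixes X :: "'i set"
  assumes R: "cring R" and N: "noetherian_ring R" and "finite X"
  shows "noetherian_module R (free_module R X)"
  using assms(3)
proof (induction X)
  case empty
  let ?F = "free_module R ({} :: 'i set)"
  have F: "module R ?F" by (rule free_module_module[OF R])
  interpret F: module R ?F by fact
  have c: "carrier ?F = {\<zero>\<^bsub>?F\<^esub>}" by (auto simp: carrier_free_module)
  have "fin_gen R (?F\<lparr>carrier := H\<rparr>)" if H: "submodule H R ?F" for H
  proof -
    have "H \<subseteq> {\<zero>\<^bsub>?F\<^esub>}" using F.submoduleE(1)[OF H] unfolding c .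
    then have "H = carrier ?F" using submodule_zero[OF H] unfolding c by (intro subset_antisym) simp_all
    then show ?thesis using free_module_fin_gen[OF R, of "{} :: 'i set"] by simp
  qed
  then show ?case using F by (simp add: noetherian_module_def)
next
  case (insert x X)
  show ?case
    by (rule noetherian_module_extension[OF free_module_insert_exact[OF R] insert(3) self_module_noetherian[OF R N]])
      (use insert in auto)
qed


section \<open>Torsion of Ext modules\<close>

text \<open>
  A resolution of \<open>R/J\<close> by free modules of finite rank, shifted by one degree: the zeroth
  module is zero and the first one is \<open>R\<close>. With this shift no case distinction is needed for
  the coboundaries in degree zero.
\<close>

locale quotient_resolution =
  fixes R :: "('a, 'r) ring_scheme" and J :: "'a set" and m :: "nat \<Rightarrow> nat"
    and d :: "nat \<Rightarrow> (nat \<Rightarrow> 'a) \<Rightarrow> nat \<Rightarrow> 'a"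
  assumes R: "cring R"
    and m0: "m 0 = 0" and m1: "m 1 = 1"
    and d_hom: "d i \<in> mod_hom R (free_module R {..<m (Suc i)}) (free_module R {..<m i})"
    and d_one: "d 1 ` carrier (free_module R {..<m 2}) = {x \<in> carrier (free_module R {..<m 1}). x 0 \<in> J}"
    and d_exact: "i \<ge> 1 \<Longrightarrow> d (Suc i) ` carrier (free_module R {..<m (Suc (Suc i))})
      = mod_ker (free_module R {..<m (Suc i)}) (free_module R {..<m i}) (d i)"
begin

abbreviation "G i \<equiv> free_module R {..<m i}"

lemma G_module: "module R (G i)"
  by (rule free_module_module[OF R])

lemma d_closed: "y \<in> carrier (G (Suc i)) \<Longrightarrow> d i y \<in> carrier (G i)"
  by (rule mod_hom_closed[OF d_hom])

lemma d_zero: "y \<in> carrier (G 1) \<Longrightarrow> d 0 y = \<zero>\<^bsub>G 0\<^esub>"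
  using d_closed[of y 0] by (auto simp: m0 carrier_free_module)

lemma d_d:
  assumes "y \<in> carrier (G (Suc (Suc i)))" shows "d i (d (Suc i) y) = \<zero>\<^bsub>G i\<^esub>"
proof (cases "i = 0")
  case True
  then show ?thesis using d_zero[of "d (Suc i) y"] d_closed[OF assms] by simp
next
  case False
  then have "d (Suc i) y \<in> mod_ker (G (Suc i)) (G i) (d i)" using d_exact[of i] assms by auto
  then show ?thesis by (simp add: mod_ker_def)
qed

text \<open>
  Every element of \<open>Ext\<^sup>i(R/J, N)\<close>, the cohomology of \<open>Hom(G, N)\<close> at \<open>Hom(G (i + 1), N)\<close>, is killed by a
  power of \<open>s\<close>. For \<open>s = \<one>\<close> this says that this Ext module is zero.
\<close>

definition ext_torsion :: "'a \<Rightarrow> ('a, 'n) module \<Rightarrow> nat \<Rightarrow> bool"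
  where "ext_torsion s N i \<longleftrightarrow>
    (\<forall>c \<in> mod_hom R (G (Suc i)) N.
       (\<forall>y\<in>carrier (G (Suc (Suc i))). c (d (Suc i) y) = \<zero>\<^bsub>N\<^esub>) \<longrightarrow>
       (\<exists>(k::nat). \<exists>b \<in> mod_hom R (G i) N. \<forall>y\<in>carrier (G (Suc i)). (s [^]\<^bsub>R\<^esub> k) \<odot>\<^bsub>N\<^esub> c y = b (d i y)))"

lemma ext_torsionE:
  assumes "ext_torsion s N i" "c \<in> mod_hom R (G (Suc i)) N"
    and "\<And>y. y \<in> carrier (G (Suc (Suc i))) \<Longrightarrow> c (d (Suc i) y) = \<zero>\<^bsub>N\<^esub>"
  obtains k :: nat and b where "b \<in> mod_hom R (G i) N"
    "\<And>y. y \<in> carrier (G (Suc i)) \<Longrightarrow> (s [^]\<^bsub>R\<^esub> k) \<odot>\<^bsub>N\<^esub> c y = b (d i y)"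
proof -
  from assms have "\<exists>(k::nat). \<exists>b \<in> mod_hom R (G i) N. \<forall>y\<in>carrier (G (Suc i)). (s [^]\<^bsub>R\<^esub> k) \<odot>\<^bsub>N\<^esub> c y = b (d i y)"
    by (simp add: ext_torsion_def)
  then obtain k b where "b \<in> mod_hom R (G i) N"
    "\<forall>y\<in>carrier (G (Suc i)). (s [^]\<^bsub>R\<^esub> (k::nat)) \<odot>\<^bsub>N\<^esub> c y = b (d i y)" by (elim exE bexE)
  then show ?thesis by (intro that[of b k]) simp_all
qed

lemma ext_torsionI:
  assumes "\<And>c. c \<in> mod_hom R (G (Suc i)) N \<Longrightarrow>
      (\<And>y. y \<in> carrier (G (Suc (Suc i))) \<Longrightarrow> c (d (Suc i) y) = \<zero>\<^bsub>N\<^esub>) \<Longrightarrow>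
      \<exists>(k::nat). \<exists>b \<in> mod_hom R (G i) N. \<forall>y\<in>carrier (G (Suc i)). (s [^]\<^bsub>R\<^esub> k) \<odot>\<^bsub>N\<^esub> c y = b (d i y)"
  shows "ext_torsion s N i"
  using assms by (simp add: ext_torsion_def)

text \<open>
  The next three lemmas are the three parts of the long exact sequence of Ext modules that come
  from a short exact sequence; modules all of whose elements are killed by powers of \<open>s\<close> form a
  Serre class.
\<close>

lemma ext_torsion_middle:
  assumes ex: "short_exact R L M N f g" and s: "s \<in> carrier R"
    and tL: "ext_torsion s L i" and tN: "ext_torsion s N i"
  shows "ext_torsion s M i"
proof (rule ext_torsionI)
  note ex' = ex[unfolded short_exact_def]
  have L: "module R L" and M: "module R M" and N: "module R N"
    and f: "f \<in> mod_hom R L M" and inj: "inj_on f (carrier L)"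
    and g: "g \<in> mod_hom R M N" and surj: "g ` carrier M = carrier N"
    and ker: "f ` carrier L = mod_ker M N g" using ex' by auto
  interpret L: module R L by fact
  interpret M: module R M by fact
  interpret N: module R N by fact
  fix c assume c: "c \<in> mod_hom R (G (Suc i)) M"
    and cd: "\<And>y. y \<in> carrier (G (Suc (Suc i))) \<Longrightarrow> c (d (Suc i) y) = \<zero>\<^bsub>M\<^esub>"
  obtain k b where b: "b \<in> mod_hom R (G i) N"
    "\<And>y. y \<in> carrier (G (Suc i)) \<Longrightarrow> (s [^]\<^bsub>R\<^esub> (k::nat)) \<odot>\<^bsub>N\<^esub> g (c y) = b (d i y)"
    by (rule ext_torsionE[OF tN mod_hom_comp[OF c g]]) (simp add: cd mod_hom_zero[OF g M N], blast)
  obtain b' where b': "b' \<in> mod_hom R (G i) M" "\<And>y. y \<in> carrier (G i) \<Longrightarrow> g (b' y) = b y"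
    by (rule lift_through_surj[OF g surj M N finite_lessThan b(1)]) blast+
  have sk: "s [^]\<^bsub>R\<^esub> k \<in> carrier R" for k :: nat using s by simp
  let ?e = "\<lambda>y. (s [^]\<^bsub>R\<^esub> k) \<odot>\<^bsub>M\<^esub> c y \<ominus>\<^bsub>M\<^esub> b' (d i y)"
  have e: "?e \<in> mod_hom R (G (Suc i)) M"
    by (rule mod_hom_diff[OF mod_hom_scale[OF c G_module M sk] mod_hom_comp[OF d_hom b'(1)] G_module M])
  have cc: "c y \<in> carrier M" if "y \<in> carrier (G (Suc i))" for y by (rule mod_hom_closed[OF c that])
  have bc: "b' (d i y) \<in> carrier M" if "y \<in> carrier (G (Suc i))" for y
    by (rule mod_hom_closed[OF b'(1) d_closed[OF that]])
  have "?e y \<in> f ` carrier L" if y: "y \<in> carrier (G (Suc i))" for y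
  proof -
    have "g (?e y) = (s [^]\<^bsub>R\<^esub> k) \<odot>\<^bsub>N\<^esub> g (c y) \<ominus>\<^bsub>N\<^esub> g (b' (d i y))"
      using mod_hom_minus[OF g M N _ bc[OF y]] mod_hom_smult[OF g sk cc[OF y]] cc[OF y] sk by simp
    also have "\<dots> = \<zero>\<^bsub>N\<^esub>"
      using b(2)[OF y] b'(2)[OF d_closed[OF y]] module_minus_eq_zero_iff[OF N] mod_hom_closed[OF b(1) d_closed[OF y]] by simp
    finally show ?thesis using ker mod_hom_closed[OF e y] by (simp add: mod_ker_def)
  qed
  then obtain c' where c': "c' \<in> mod_hom R (G (Suc i)) L" "\<And>y. y \<in> carrier (G (Suc i)) \<Longrightarrow> f (c' y) = ?e y"
    by (rule factor_through_inj[OF f inj L e]) blast+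
  have c'd: "c' (d (Suc i) y) = \<zero>\<^bsub>L\<^esub>" if y: "y \<in> carrier (G (Suc (Suc i)))" for y
  proof -
    have "f (c' (d (Suc i) y)) = \<zero>\<^bsub>M\<^esub>"
      using c'(2)[OF d_closed[OF y]] cd[OF y] d_d[OF y] mod_hom_zero[OF b'(1) G_module M] sk
      by (simp add: M.minus_eq M.r_neg)
    then show ?thesis using inj mod_hom_closed[OF c'(1) d_closed[OF y]] inj_on_mod_hom_iff[OF f L M] by simp
  qed
  obtain l b2 where b2: "b2 \<in> mod_hom R (G i) L"
    "\<And>y. y \<in> carrier (G (Suc i)) \<Longrightarrow> (s [^]\<^bsub>R\<^esub> (l::nat)) \<odot>\<^bsub>L\<^esub> c' y = b2 (d i y)"
    by (rule ext_torsionE[OF tL c'(1) c'd]) blast+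
  let ?b = "\<lambda>z. (s [^]\<^bsub>R\<^esub> l) \<odot>\<^bsub>M\<^esub> b' z \<oplus>\<^bsub>M\<^esub> f (b2 z)"
  have "?b \<in> mod_hom R (G i) M"
    by (rule mod_hom_sum[OF mod_hom_scale[OF b'(1) G_module M sk] mod_hom_comp[OF b2(1) f] G_module M])
  moreover have "(s [^]\<^bsub>R\<^esub> (l + k)) \<odot>\<^bsub>M\<^esub> c y = ?b (d i y)" if y: "y \<in> carrier (G (Suc i))" for y
  proof -
    have "f (b2 (d i y)) = (s [^]\<^bsub>R\<^esub> l) \<odot>\<^bsub>M\<^esub> ?e y"
      using b2(2)[OF y, symmetric] mod_hom_smult[OF f sk mod_hom_closed[OF c'(1) y]] c'(2)[OF y] by simp
    then have "?b (d i y) = (s [^]\<^bsub>R\<^esub> l) \<odot>\<^bsub>M\<^esub> (b' (d i y) \<oplus>\<^bsub>M\<^esub> ?e y)"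
      using bc[OF y] mod_hom_closed[OF e y] sk by (simp add: M.smult_r_distr)
    also have "b' (d i y) \<oplus>\<^bsub>M\<^esub> ?e y = (s [^]\<^bsub>R\<^esub> k) \<odot>\<^bsub>M\<^esub> c y"
      using bc[OF y] cc[OF y] sk M.a_comm[of "(s [^]\<^bsub>R\<^esub> k) \<odot>\<^bsub>M\<^esub> c y" "\<ominus>\<^bsub>M\<^esub> b' (d i y)"]
      by (simp add: M.minus_eq M.r_neg2)
    also have "(s [^]\<^bsub>R\<^esub> l) \<odot>\<^bsub>M\<^esub> \<dots> = (s [^]\<^bsub>R\<^esub> (l + k)) \<odot>\<^bsub>M\<^esub> c y"
      using M.smult_assoc1[OF sk sk cc[OF y]] s by (simp add: L.R.nat_pow_mult)
    finally show ?thesis by simp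
  qed
  ultimately show "\<exists>(k::nat). \<exists>b \<in> mod_hom R (G i) M. \<forall>y\<in>carrier (G (Suc i)). (s [^]\<^bsub>R\<^esub> k) \<odot>\<^bsub>M\<^esub> c y = b (d i y)"
    by (intro exI[of _ "l + k"] bexI[of _ ?b] ballI)
qed

lemma ext_torsion_left:
  assumes ex: "short_exact R L M N f g" and s: "s \<in> carrier R"
    and tM: "ext_torsion s M i" and tN: "\<And>j. i = Suc j \<Longrightarrow> ext_torsion s N j"
  shows "ext_torsion s L i"
proof (rule ext_torsionI)
  note ex' = ex[unfolded short_exact_def]
  have L: "module R L" and M: "module R M" and N: "module R N"
    and f: "f \<in> mod_hom R L M" and inj: "inj_on f (carrier L)"
    and g: "g \<in> mod_hom R M N" and surj: "g ` carrier M = carrier N"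
    and ker: "f ` carrier L = mod_ker M N g" using ex' by auto
  interpret L: module R L by fact
  interpret M: module R M by fact
  interpret N: module R N by fact
  have sk: "s [^]\<^bsub>R\<^esub> k \<in> carrier R" for k :: nat using s by simp
  fix c assume c: "c \<in> mod_hom R (G (Suc i)) L"
    and cd: "\<And>y. y \<in> carrier (G (Suc (Suc i))) \<Longrightarrow> c (d (Suc i) y) = \<zero>\<^bsub>L\<^esub>"
  obtain k b where b: "b \<in> mod_hom R (G i) M"
    "\<And>y. y \<in> carrier (G (Suc i)) \<Longrightarrow> (s [^]\<^bsub>R\<^esub> (k::nat)) \<odot>\<^bsub>M\<^esub> f (c y) = b (d i y)"
    by (rule ext_torsionE[OF tM mod_hom_comp[OF c f]]) (simp add: cd mod_hom_zero[OF f L M], blast)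
  have cc: "c y \<in> carrier L" if "y \<in> carrier (G (Suc i))" for y by (rule mod_hom_closed[OF c that])
  have fc: "f (c y) \<in> carrier M" if "y \<in> carrier (G (Suc i))" for y by (rule mod_hom_closed[OF f cc[OF that]])
  have gf: "g (f x) = \<zero>\<^bsub>N\<^esub>" if "x \<in> carrier L" for x
    using that ker by (auto simp: mod_ker_def)
  show "\<exists>(k::nat). \<exists>b \<in> mod_hom R (G i) L. \<forall>y\<in>carrier (G (Suc i)). (s [^]\<^bsub>R\<^esub> k) \<odot>\<^bsub>L\<^esub> c y = b (d i y)"
  proof (cases i)
    case 0
    have "(s [^]\<^bsub>R\<^esub> k) \<odot>\<^bsub>L\<^esub> c y = \<zero>\<^bsub>L\<^esub>" if y: "y \<in> carrier (G (Suc i))" for y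
    proof -
      have "d i y = \<zero>\<^bsub>G i\<^esub>" using y d_zero[of y] 0 by simp
      then have "f ((s [^]\<^bsub>R\<^esub> k) \<odot>\<^bsub>L\<^esub> c y) = \<zero>\<^bsub>M\<^esub>"
        using b(2)[OF y] mod_hom_zero[OF b(1) G_module M] mod_hom_smult[OF f sk cc[OF y]] by simp
      then show ?thesis using inj_on_mod_hom_iff[OF f L M] inj cc[OF y] sk by simp
    qed
    then show ?thesis
      by (intro exI[of _ k] bexI[of _ "\<lambda>z. \<zero>\<^bsub>L\<^esub>"] mod_hom_zero_map[OF L] ballI)
  next
    case (Suc j)
    have gb: "g (b (d (Suc j) y)) = \<zero>\<^bsub>N\<^esub>" if y: "y \<in> carrier (G (Suc (Suc j)))" for y
    proof -
      have "g (b (d i y)) = (s [^]\<^bsub>R\<^esub> k) \<odot>\<^bsub>N\<^esub> g (f (c y))"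
        using b(2)[of y, symmetric] mod_hom_smult[OF g sk fc[of y]] y Suc by simp
      then show ?thesis using gf[OF cc[of y]] y Suc sk by simp
    qed
    have b1: "b \<in> mod_hom R (G (Suc j)) M" using b(1) Suc by simp
    obtain l e where e: "e \<in> mod_hom R (G j) N"
      "\<And>y. y \<in> carrier (G (Suc j)) \<Longrightarrow> (s [^]\<^bsub>R\<^esub> (l::nat)) \<odot>\<^bsub>N\<^esub> g (b y) = e (d j y)"
      by (rule ext_torsionE[OF tN[OF Suc] mod_hom_comp[OF b1 g] gb]) blast+
    obtain e' where e': "e' \<in> mod_hom R (G j) M" "\<And>y. y \<in> carrier (G j) \<Longrightarrow> g (e' y) = e y"
      by (rule lift_through_surj[OF g surj M N finite_lessThan e(1)]) blast+
    let ?h = "\<lambda>y. (s [^]\<^bsub>R\<^esub> l) \<odot>\<^bsub>M\<^esub> b y \<ominus>\<^bsub>M\<^esub> e' (d j y)"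
    have h: "?h \<in> mod_hom R (G (Suc j)) M"
      by (rule mod_hom_diff[OF mod_hom_scale[OF b1 G_module M sk] mod_hom_comp[OF d_hom e'(1)] G_module M])
    have bc: "b y \<in> carrier M" if "y \<in> carrier (G (Suc j))" for y by (rule mod_hom_closed[OF b1 that])
    have ec: "e' (d j y) \<in> carrier M" if "y \<in> carrier (G (Suc j))" for y
      by (rule mod_hom_closed[OF e'(1) d_closed[OF that]])
    have "?h y \<in> f ` carrier L" if y: "y \<in> carrier (G (Suc j))" for y
    proof -
      have "g (?h y) = (s [^]\<^bsub>R\<^esub> l) \<odot>\<^bsub>N\<^esub> g (b y) \<ominus>\<^bsub>N\<^esub> g (e' (d j y))"
        using mod_hom_minus[OF g M N _ ec[OF y]] mod_hom_smult[OF g sk bc[OF y]] bc[OF y] sk by simp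
      also have "\<dots> = \<zero>\<^bsub>N\<^esub>"
        using e(2)[OF y] e'(2)[OF d_closed[OF y]] module_minus_eq_zero_iff[OF N] mod_hom_closed[OF e(1) d_closed[OF y]] by simp
      finally show ?thesis using ker mod_hom_closed[OF h y] by (simp add: mod_ker_def)
    qed
    then obtain b' where b': "b' \<in> mod_hom R (G (Suc j)) L" "\<And>y. y \<in> carrier (G (Suc j)) \<Longrightarrow> f (b' y) = ?h y"
      by (rule factor_through_inj[OF f inj L h]) blast+
    have "(s [^]\<^bsub>R\<^esub> (l + k)) \<odot>\<^bsub>L\<^esub> c y = b' (d i y)" if y: "y \<in> carrier (G (Suc i))" for y
    proof -
      have y': "y \<in> carrier (G (Suc (Suc j)))" using y Suc by simp
      have dy: "d (Suc j) y \<in> carrier (G (Suc j))" by (rule d_closed[OF y'])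
      have "f (b' (d i y)) = (s [^]\<^bsub>R\<^esub> l) \<odot>\<^bsub>M\<^esub> b (d i y)"
        using b'(2)[OF dy] d_d[OF y'] mod_hom_zero[OF e'(1) G_module M] bc[OF dy] sk Suc M.add.inv_one
        by (simp add: M.minus_eq a_inv_def)
      also have "\<dots> = (s [^]\<^bsub>R\<^esub> l) \<odot>\<^bsub>M\<^esub> ((s [^]\<^bsub>R\<^esub> k) \<odot>\<^bsub>M\<^esub> f (c y))" using b(2)[OF y] by simp
      also have "\<dots> = (s [^]\<^bsub>R\<^esub> (l + k)) \<odot>\<^bsub>M\<^esub> f (c y)"
        using M.smult_assoc1[OF sk sk fc[OF y]] s by (simp add: L.R.nat_pow_mult)
      also have "\<dots> = f ((s [^]\<^bsub>R\<^esub> (l + k)) \<odot>\<^bsub>L\<^esub> c y)" using mod_hom_smult[OF f sk cc[OF y]] by simp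
      finally have "b' (d i y) = (s [^]\<^bsub>R\<^esub> (l + k)) \<odot>\<^bsub>L\<^esub> c y"
        using inj cc[OF y] sk mod_hom_closed[OF b'(1) dy] Suc by (simp add: inj_on_eq_iff)
      then show ?thesis by simp
    qed
    then show ?thesis using b'(1) Suc by (intro exI[of _ "l + k"] bexI[of _ b'] ballI) simp_all
  qed
qed

lemma ext_torsion_right:
  assumes ex: "short_exact R L M N f g" and s: "s \<in> carrier R"
    and tM: "ext_torsion s M i" and tL: "ext_torsion s L (Suc i)"
  shows "ext_torsion s N i"
proof (rule ext_torsionI)
  note ex' = ex[unfolded short_exact_def]
  have L: "module R L" and M: "module R M" and N: "module R N"
    and f: "f \<in> mod_hom R L M" and inj: "inj_on f (carrier L)"
    and g: "g \<in> mod_hom R M N" and surj: "g ` carrier M = carrier N"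
    and ker: "f ` carrier L = mod_ker M N g" using ex' by auto
  interpret L: module R L by fact
  interpret M: module R M by fact
  interpret N: module R N by fact
  have sk: "s [^]\<^bsub>R\<^esub> k \<in> carrier R" for k :: nat using s by simp
  have gf: "g (f x) = \<zero>\<^bsub>N\<^esub>" if "x \<in> carrier L" for x
    using that ker by (auto simp: mod_ker_def)
  fix c assume c: "c \<in> mod_hom R (G (Suc i)) N"
    and cd: "\<And>y. y \<in> carrier (G (Suc (Suc i))) \<Longrightarrow> c (d (Suc i) y) = \<zero>\<^bsub>N\<^esub>"
  obtain c' where c': "c' \<in> mod_hom R (G (Suc i)) M" "\<And>y. y \<in> carrier (G (Suc i)) \<Longrightarrow> g (c' y) = c y"
    by (rule lift_through_surj[OF g surj M N finite_lessThan c]) blast+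
  have cdh: "(\<lambda>y. c' (d (Suc i) y)) \<in> mod_hom R (G (Suc (Suc i))) M" by (rule mod_hom_comp[OF d_hom c'(1)])
  have "c' (d (Suc i) y) \<in> f ` carrier L" if y: "y \<in> carrier (G (Suc (Suc i)))" for y
    using c'(2)[OF d_closed[OF y]] cd[OF y] ker mod_hom_closed[OF cdh y] by (simp add: mod_ker_def)
  then obtain e where e: "e \<in> mod_hom R (G (Suc (Suc i))) L"
    "\<And>y. y \<in> carrier (G (Suc (Suc i))) \<Longrightarrow> f (e y) = c' (d (Suc i) y)"
    by (rule factor_through_inj[OF f inj L cdh]) blast+
  have ed: "e (d (Suc (Suc i)) y) = \<zero>\<^bsub>L\<^esub>" if y: "y \<in> carrier (G (Suc (Suc (Suc i))))" for y
  proof -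
    have "f (e (d (Suc (Suc i)) y)) = \<zero>\<^bsub>M\<^esub>"
      using e(2)[OF d_closed[OF y]] d_d[OF y] mod_hom_zero[OF c'(1) G_module M] by simp
    then show ?thesis using inj mod_hom_closed[OF e(1) d_closed[OF y]] inj_on_mod_hom_iff[OF f L M] by simp
  qed
  obtain k b where b: "b \<in> mod_hom R (G (Suc i)) L"
    "\<And>y. y \<in> carrier (G (Suc (Suc i))) \<Longrightarrow> (s [^]\<^bsub>R\<^esub> (k::nat)) \<odot>\<^bsub>L\<^esub> e y = b (d (Suc i) y)"
    by (rule ext_torsionE[OF tL e(1) ed]) blast+
  let ?h = "\<lambda>y. (s [^]\<^bsub>R\<^esub> k) \<odot>\<^bsub>M\<^esub> c' y \<ominus>\<^bsub>M\<^esub> f (b y)"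
  have h: "?h \<in> mod_hom R (G (Suc i)) M"
    by (rule mod_hom_diff[OF mod_hom_scale[OF c'(1) G_module M sk] mod_hom_comp[OF b(1) f] G_module M])
  have hd: "?h (d (Suc i) y) = \<zero>\<^bsub>M\<^esub>" if y: "y \<in> carrier (G (Suc (Suc i)))" for y
  proof -
    have "f (b (d (Suc i) y)) = (s [^]\<^bsub>R\<^esub> k) \<odot>\<^bsub>M\<^esub> c' (d (Suc i) y)"
      using b(2)[OF y, symmetric] mod_hom_smult[OF f sk mod_hom_closed[OF e(1) y]] e(2)[OF y] by simp
    then show ?thesis
      using module_minus_eq_zero_iff[OF M] mod_hom_closed[OF cdh y] sk by simp
  qed
  obtain l p where p: "p \<in> mod_hom R (G i) M"
    "\<And>y. y \<in> carrier (G (Suc i)) \<Longrightarrow> (s [^]\<^bsub>R\<^esub> (l::nat)) \<odot>\<^bsub>M\<^esub> ?h y = p (d i y)"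
    by (rule ext_torsionE[OF tM h hd]) blast+
  have "(s [^]\<^bsub>R\<^esub> (l + k)) \<odot>\<^bsub>N\<^esub> c y = g (p (d i y))" if y: "y \<in> carrier (G (Suc i))" for y
  proof -
    have cy: "c' y \<in> carrier M" "c y \<in> carrier N" "f (b y) \<in> carrier M"
      using mod_hom_closed[OF c'(1) y] mod_hom_closed[OF c y] mod_hom_closed[OF f mod_hom_closed[OF b(1) y]] by auto
    have "g (?h y) = (s [^]\<^bsub>R\<^esub> k) \<odot>\<^bsub>N\<^esub> c y"
      using mod_hom_minus[OF g M N _ cy(3)] mod_hom_smult[OF g sk cy(1)] gf[OF mod_hom_closed[OF b(1) y]]
        c'(2)[OF y] cy sk N.add.inv_one by (simp add: N.minus_eq a_inv_def)
    then have "(s [^]\<^bsub>R\<^esub> l) \<odot>\<^bsub>N\<^esub> ((s [^]\<^bsub>R\<^esub> k) \<odot>\<^bsub>N\<^esub> c y) = g (p (d i y))"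
      using p(2)[OF y, symmetric] mod_hom_smult[OF g sk mod_hom_closed[OF h y]] by simp
    then show ?thesis using N.smult_assoc1[OF sk sk cy(2)] s by (simp add: L.R.nat_pow_mult)
  qed
  then show "\<exists>(k::nat). \<exists>b \<in> mod_hom R (G i) N. \<forall>y\<in>carrier (G (Suc i)). (s [^]\<^bsub>R\<^esub> k) \<odot>\<^bsub>N\<^esub> c y = b (d i y)"
    by (intro exI[of _ "l + k"] bexI[of _ "\<lambda>z. g (p z)"] ballI mod_hom_comp[OF p(1) g])
qed

text \<open>
  The remaining closure properties follow from the exact sequences, because a module killed by \<open>s\<close>
  has \<open>s\<close>-torsion Ext modules in all degrees.
\<close>

lemma ext_torsion_killed:
  assumes N: "module R N" and s: "s \<in> carrier R" and k: "\<And>x. x \<in> carrier N \<Longrightarrow> s \<odot>\<^bsub>N\<^esub> x = \<zero>\<^bsub>N\<^esub>"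
  shows "ext_torsion s N i"
proof (rule ext_torsionI)
  interpret N: module R N by fact
  fix c assume c: "c \<in> mod_hom R (G (Suc i)) N"
  show "\<exists>(k::nat). \<exists>b \<in> mod_hom R (G i) N. \<forall>y\<in>carrier (G (Suc i)). (s [^]\<^bsub>R\<^esub> k) \<odot>\<^bsub>N\<^esub> c y = b (d i y)"
    using k mod_hom_closed[OF c] s
    by (intro exI[of _ 1] bexI[of _ "\<lambda>z. \<zero>\<^bsub>N\<^esub>"] mod_hom_zero_map[OF N] ballI) simp
qed

lemma ext_torsion_iso:
  assumes iso: "mod_iso R M N" and M: "module R M" and N: "module R N" and s: "s \<in> carrier R"
    and t: "ext_torsion s M i"
  shows "ext_torsion s N i"
proof -
  interpret N: module R N by fact
  obtain f where f: "f \<in> mod_hom R M N" "bij_betw f (carrier M) (carrier N)"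
    using iso unfolding mod_iso_def ..
  let ?Z = "N\<lparr>carrier := {\<zero>\<^bsub>N\<^esub>}\<rparr>"
  have Z: "module R ?Z" by (rule module_restrict[OF N submodule_zero_set[OF N]])
  interpret Z: module R ?Z by fact
  have "short_exact R M N ?Z f (\<lambda>x. \<zero>\<^bsub>N\<^esub>)"
    using f M N Z mod_hom_zero_map[OF Z, of N] by (auto simp: short_exact_def bij_betw_def mod_ker_def)
  then show ?thesis
    by (rule ext_torsion_middle[OF _ s t ext_torsion_killed[OF Z s]]) (use s N.smult_r_null in simp)
qed

lemma ext_torsion_mult:
  assumes N: "module R N" and s: "s \<in> carrier R" and t: "t \<in> carrier R" and e: "ext_torsion s N i"
  shows "ext_torsion (s \<otimes>\<^bsub>R\<^esub> t) N i"
proof (rule ext_torsionI)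
  interpret N: module R N by fact
  fix c assume c: "c \<in> mod_hom R (G (Suc i)) N"
    and cd: "\<And>y. y \<in> carrier (G (Suc (Suc i))) \<Longrightarrow> c (d (Suc i) y) = \<zero>\<^bsub>N\<^esub>"
  obtain k b where b: "b \<in> mod_hom R (G i) N"
    "\<And>y. y \<in> carrier (G (Suc i)) \<Longrightarrow> (s [^]\<^bsub>R\<^esub> (k::nat)) \<odot>\<^bsub>N\<^esub> c y = b (d i y)"
    by (rule ext_torsionE[OF e c cd]) blast+
  have tk: "t [^]\<^bsub>R\<^esub> k \<in> carrier R" "s [^]\<^bsub>R\<^esub> k \<in> carrier R" using s t by auto
  have "((s \<otimes>\<^bsub>R\<^esub> t) [^]\<^bsub>R\<^esub> k) \<odot>\<^bsub>N\<^esub> c y = (t [^]\<^bsub>R\<^esub> k) \<odot>\<^bsub>N\<^esub> b (d i y)" if y: "y \<in> carrier (G (Suc i))" for y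
    using b(2)[OF y, symmetric] N.smult_assoc1[OF tk mod_hom_closed[OF c y]] s t
    by (simp add: N.R.nat_pow_distrib N.R.m_comm)
  then show "\<exists>(k::nat). \<exists>b \<in> mod_hom R (G i) N. \<forall>y\<in>carrier (G (Suc i)). ((s \<otimes>\<^bsub>R\<^esub> t) [^]\<^bsub>R\<^esub> k) \<odot>\<^bsub>N\<^esub> c y = b (d i y)"
    by (intro exI[of _ k] bexI[of _ "\<lambda>z. (t [^]\<^bsub>R\<^esub> k) \<odot>\<^bsub>N\<^esub> b z"] ballI mod_hom_scale[OF b(1) G_module N tk(1)])
qed

lemma ext_torsion_one:
  assumes N: "module R N" and s: "s \<in> carrier R" and e: "ext_torsion \<one>\<^bsub>R\<^esub> N i"
  shows "ext_torsion s N i"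
proof -
  interpret N: module R N by fact
  show ?thesis using ext_torsion_mult[OF N _ s e] s by simp
qed

lemma ext_torsion_free:
  assumes s: "s \<in> carrier R" and X: "finite X" and t: "ext_torsion s (self_module R) i"
  shows "ext_torsion s (free_module R X) i"
  using X
proof (induction X)
  case empty
  interpret R: cring R by (rule R)
  show ?case
    by (rule ext_torsion_killed[OF free_module_module[OF R] s]) (use s in \<open>auto simp: carrier_free_module\<close>)
next
  case (insert x X)
  show ?case by (rule ext_torsion_middle[OF free_module_insert_exact[OF R insert(2)] s insert(3) t])
qed

text \<open>
  If \<open>s\<close> is regular on \<open>A\<close> then \<open>Ext\<^sup>i(R/J, A)\<close> has no \<open>s\<close>-torsion as soon as \<open>Ext\<^sup>i\<^sup>-\<^sup>1(R/J, A/sA) = 0\<close>;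
  if it is \<open>s\<close>-torsion as well, it is zero.
\<close>

lemma ext_vanishing_of_torsion:
  assumes ex: "short_exact R A A N (\<lambda>x. s \<odot>\<^bsub>A\<^esub> x) g" and s: "s \<in> carrier R"
    and tN: "\<And>j. i = Suc j \<Longrightarrow> ext_torsion \<one>\<^bsub>R\<^esub> N j" and tA: "ext_torsion s A i"
  shows "ext_torsion \<one>\<^bsub>R\<^esub> A i"
proof (rule ext_torsionI)
  note ex' = ex[unfolded short_exact_def]
  have A: "module R A" and N: "module R N" and inj: "inj_on (\<lambda>x. s \<odot>\<^bsub>A\<^esub> x) (carrier A)"
    and g: "g \<in> mod_hom R A N" and surj: "g ` carrier A = carrier N"
    and f: "(\<lambda>x. s \<odot>\<^bsub>A\<^esub> x) \<in> mod_hom R A A"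
    and ker: "(\<lambda>x. s \<odot>\<^bsub>A\<^esub> x) ` carrier A = mod_ker A N g" using ex' by auto
  interpret A: module R A by fact
  interpret N: module R N by fact
  have gs: "g (s \<odot>\<^bsub>A\<^esub> x) = \<zero>\<^bsub>N\<^esub>" if "x \<in> carrier A" for x
    using that ker by (auto simp: mod_ker_def)
  \<comment> \<open>Injectivity of \<open>s\<close> on the Ext module: \<open>s\<close> times a cocycle \<open>c\<close> bounds only if \<open>c\<close> does.\<close>
  have step: "\<exists>b' \<in> mod_hom R (G i) A. \<forall>y\<in>carrier (G (Suc i)). c y = b' (d i y)"
    if c: "c \<in> mod_hom R (G (Suc i)) A"
      and b: "b \<in> mod_hom R (G i) A" "\<And>y. y \<in> carrier (G (Suc i)) \<Longrightarrow> s \<odot>\<^bsub>A\<^esub> c y = b (d i y)" for c b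
  proof (cases i)
    case 0
    have "c y = \<zero>\<^bsub>A\<^esub>" if y: "y \<in> carrier (G (Suc i))" for y
    proof -
      have "d i y = \<zero>\<^bsub>G i\<^esub>" using y d_zero[of y] 0 by simp
      then have "s \<odot>\<^bsub>A\<^esub> c y = \<zero>\<^bsub>A\<^esub>" using b(2)[OF y] mod_hom_zero[OF b(1) G_module A] by simp
      then show ?thesis using inj_on_mod_hom_iff[OF f A A] inj mod_hom_closed[OF c y] by simp
    qed
    then show ?thesis by (intro bexI[of _ "\<lambda>z. \<zero>\<^bsub>A\<^esub>"] mod_hom_zero_map[OF A] ballI)
  next
    case (Suc j)
    have b1: "b \<in> mod_hom R (G (Suc j)) A" using b(1) Suc by simp
    have gb: "g (b (d (Suc j) y)) = \<zero>\<^bsub>N\<^esub>" if y: "y \<in> carrier (G (Suc (Suc j)))" for y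
      using b(2)[of y, symmetric] gs[OF mod_hom_closed[OF c, of y]] y Suc by simp
    obtain l e where e: "e \<in> mod_hom R (G j) N"
      "\<And>y. y \<in> carrier (G (Suc j)) \<Longrightarrow> (\<one>\<^bsub>R\<^esub> [^]\<^bsub>R\<^esub> (l::nat)) \<odot>\<^bsub>N\<^esub> g (b y) = e (d j y)"
      by (rule ext_torsionE[OF tN[OF Suc] mod_hom_comp[OF b1 g] gb]) blast+
    have e2: "g (b y) = e (d j y)" if y: "y \<in> carrier (G (Suc j))" for y
      using e(2)[OF y] mod_hom_closed[OF g mod_hom_closed[OF b1 y]] by simp
    obtain e' where e': "e' \<in> mod_hom R (G j) A" "\<And>y. y \<in> carrier (G j) \<Longrightarrow> g (e' y) = e y"
      by (rule lift_through_surj[OF g surj A N finite_lessThan e(1)]) blast+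
    let ?h = "\<lambda>y. b y \<ominus>\<^bsub>A\<^esub> e' (d j y)"
    have h: "?h \<in> mod_hom R (G (Suc j)) A"
      by (rule mod_hom_diff[OF b1 mod_hom_comp[OF d_hom e'(1)] G_module A])
    have bc: "b y \<in> carrier A" if "y \<in> carrier (G (Suc j))" for y by (rule mod_hom_closed[OF b1 that])
    have ec: "e' (d j y) \<in> carrier A" if "y \<in> carrier (G (Suc j))" for y
      by (rule mod_hom_closed[OF e'(1) d_closed[OF that]])
    have "?h y \<in> (\<lambda>x. s \<odot>\<^bsub>A\<^esub> x) ` carrier A" if y: "y \<in> carrier (G (Suc j))" for y
    proof -
      have "g (?h y) = \<zero>\<^bsub>N\<^esub>"
        using mod_hom_minus[OF g A N bc[OF y] ec[OF y]] e2[OF y] e'(2)[OF d_closed[OF y]]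
          module_minus_eq_zero_iff[OF N] mod_hom_closed[OF e(1) d_closed[OF y]] by simp
      then show ?thesis using ker mod_hom_closed[OF h y] by (simp add: mod_ker_def)
    qed
    then obtain b' where b': "b' \<in> mod_hom R (G (Suc j)) A" "\<And>y. y \<in> carrier (G (Suc j)) \<Longrightarrow> s \<odot>\<^bsub>A\<^esub> (b' y) = ?h y"
      by (rule factor_through_inj[OF f inj A h]) blast+
    have "c y = b' (d i y)" if y: "y \<in> carrier (G (Suc i))" for y
    proof -
      have y': "y \<in> carrier (G (Suc (Suc j)))" using y Suc by simp
      have dy: "d (Suc j) y \<in> carrier (G (Suc j))" by (rule d_closed[OF y'])
      have "s \<odot>\<^bsub>A\<^esub> b' (d i y) = b (d i y)"
        using b'(2)[OF dy] d_d[OF y'] mod_hom_zero[OF e'(1) G_module A] bc[OF dy] Suc A.add.inv_one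
        by (simp add: A.minus_eq a_inv_def)
      then have "s \<odot>\<^bsub>A\<^esub> b' (d i y) = s \<odot>\<^bsub>A\<^esub> c y" using b(2)[OF y] by simp
      then show ?thesis using inj mod_hom_closed[OF c y] mod_hom_closed[OF b'(1) dy] Suc
        by (simp add: inj_on_eq_iff)
    qed
    then show ?thesis using b'(1) Suc by (intro bexI[of _ b'] ballI) simp_all
  qed
  have iter: "\<exists>b \<in> mod_hom R (G i) A. \<forall>y\<in>carrier (G (Suc i)). c y = b (d i y)"
    if c: "c \<in> mod_hom R (G (Suc i)) A"
      and "\<exists>b \<in> mod_hom R (G i) A. \<forall>y\<in>carrier (G (Suc i)). (s [^]\<^bsub>R\<^esub> (k::nat)) \<odot>\<^bsub>A\<^esub> c y = b (d i y)" for c k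
    using that
  proof (induction k arbitrary: c)
    case 0
    obtain b where b: "b \<in> mod_hom R (G i) A"
      "\<forall>y\<in>carrier (G (Suc i)). (s [^]\<^bsub>R\<^esub> (0::nat)) \<odot>\<^bsub>A\<^esub> c y = b (d i y)" using 0(2) ..
    then show ?case using mod_hom_closed[OF 0(1)] by (intro bexI[of _ b]) simp_all
  next
    case (Suc k)
    have sk: "s [^]\<^bsub>R\<^esub> k \<in> carrier R" using s by simp
    let ?c = "\<lambda>y. (s [^]\<^bsub>R\<^esub> k) \<odot>\<^bsub>A\<^esub> c y"
    have c: "?c \<in> mod_hom R (G (Suc i)) A" by (rule mod_hom_scale[OF Suc(2) G_module A sk])
    obtain b where b: "b \<in> mod_hom R (G i) A"
      "\<forall>y\<in>carrier (G (Suc i)). (s [^]\<^bsub>R\<^esub> (Suc k)) \<odot>\<^bsub>A\<^esub> c y = b (d i y)" using Suc(3) ..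
    have "s \<odot>\<^bsub>A\<^esub> ?c y = b (d i y)" if y: "y \<in> carrier (G (Suc i))" for y
    proof -
      have "s \<odot>\<^bsub>A\<^esub> ?c y = (s \<otimes>\<^bsub>R\<^esub> s [^]\<^bsub>R\<^esub> k) \<odot>\<^bsub>A\<^esub> c y"
        using A.smult_assoc1[OF s sk mod_hom_closed[OF Suc(2) y]] by simp
      also have "s \<otimes>\<^bsub>R\<^esub> s [^]\<^bsub>R\<^esub> k = s [^]\<^bsub>R\<^esub> Suc k" using A.R.m_comm[OF s sk] by simp
      finally show ?thesis using b(2) y by simp
    qed
    then show ?case by (intro Suc(1)[OF Suc(2)] step[OF c b(1)])
  qed
  fix c assume c: "c \<in> mod_hom R (G (Suc i)) A"
    and cd: "\<And>y. y \<in> carrier (G (Suc (Suc i))) \<Longrightarrow> c (d (Suc i) y) = \<zero>\<^bsub>A\<^esub>"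
  obtain k b where b: "b \<in> mod_hom R (G i) A"
    "\<And>y. y \<in> carrier (G (Suc i)) \<Longrightarrow> (s [^]\<^bsub>R\<^esub> (k::nat)) \<odot>\<^bsub>A\<^esub> c y = b (d i y)"
    by (rule ext_torsionE[OF tA c cd]) blast+
  have "\<exists>b \<in> mod_hom R (G i) A. \<forall>y\<in>carrier (G (Suc i)). c y = b (d i y)"
    by (rule iter[OF c, of k]) (use b in blast)
  then obtain b' where b': "b' \<in> mod_hom R (G i) A" "\<forall>y\<in>carrier (G (Suc i)). c y = b' (d i y)" ..
  then show "\<exists>(k::nat). \<exists>b \<in> mod_hom R (G i) A. \<forall>y\<in>carrier (G (Suc i)). (\<one>\<^bsub>R\<^esub> [^]\<^bsub>R\<^esub> k) \<odot>\<^bsub>A\<^esub> c y = b (d i y)"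
    using mod_hom_closed[OF c] by (intro exI[of _ 0] bexI[of _ b'] ballI) simp_all
qed

end


lemma free_module_cover:
  assumes R: "cring R" and noeth: "noetherian_ring R" and H: "submodule H R (free_module R {..<b :: nat})"
  obtains k :: nat and f where "f \<in> mod_hom R (free_module R {..<k}) (free_module R {..<b})"
    "f ` carrier (free_module R {..<k}) = H"
proof -
  let ?F = "free_module R {..<b}"
  have F: "module R ?F" by (rule free_module_module[OF R])
  have fg: "fin_gen R (?F\<lparr>carrier := H\<rparr>)"
    using free_module_noetherian[OF R noeth, of "{..<b}"] H by (simp add: noetherian_module_def)
  obtain k f where f: "f \<in> mod_hom R (free_module R {..<k :: nat}) (?F\<lparr>carrier := H\<rparr>)"
    "f ` carrier (free_module R {..<k}) = carrier (?F\<lparr>carrier := H\<rparr>)"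
    by (rule fin_gen_cover[OF module_restrict[OF F H] fg])
  have "f \<in> mod_hom R (free_module R {..<k}) ?F" by (rule mod_hom_expand[OF f(1) submodule_subset[OF F H]])
  with f(2) show ?thesis by (intro that[of f k]) simp_all
qed

lemma exists_quotient_resolution:
  assumes R: "cring R" and noeth: "noetherian_ring R" and J: "ideal J R"
  shows "\<exists>m d. quotient_resolution R J m d"
proof -
  interpret R: cring R by fact
  let ?F = "\<lambda>n :: nat. free_module R {..<n}"
  let ?J1 = "{x \<in> carrier (?F 1). x 0 \<in> J}"
  have F: "module R (?F n)" for n by (rule free_module_module[OF R])
  have "(\<lambda>x. x 0) \<in> mod_hom R (?F 1) (self_module R)"
    by (simp add: mod_hom_def Pi_def free_module_value[OF R])
  then have J1: "submodule ?J1 R (?F 1)"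
    using submodule_vimage[OF _ F self_module_module[OF R]] J submodule_self_iff_ideal[OF R] by blast
  define P where "P = (\<lambda>(n :: nat) (a :: nat, f, b :: nat). f \<in> mod_hom R (?F b) (?F a) \<and> (n = 0 \<longrightarrow> a = 0 \<and> b = 1))"
  define Q where "Q = (\<lambda>(n :: nat) (a :: nat, f, b) (a' :: nat, f', b' :: nat). a' = b \<and>
    f' ` carrier (?F b') = (if n = 0 then ?J1 else mod_ker (?F b) (?F a) f))"
  have "\<exists>s. \<forall>n. P n (s n) \<and> Q n (s n) (s (Suc n))"
  proof (rule dependent_nat_choice)
    show "\<exists>x. P 0 x"
      by (rule exI[of _ "(0, \<lambda>x. \<zero>\<^bsub>?F 0\<^esub>, 1)"]) (simp add: P_def mod_hom_zero_map[OF F, of 0, simplified])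
  next
    fix x n assume Px: "P n x"
    obtain a f b where x: "x = (a, f, b)" by (cases x)
    have f: "f \<in> mod_hom R (?F b) (?F a)" using Px by (simp add: P_def x)
    let ?H = "if n = 0 then ?J1 else mod_ker (?F b) (?F a) f"
    have "submodule ?H R (?F b)"
      using J1 mod_ker_submodule[OF f F F] Px by (simp add: P_def x)
    then obtain k f' where "f' \<in> mod_hom R (?F k) (?F b)" "f' ` carrier (?F k) = ?H"
      by (rule free_module_cover[OF R noeth])
    then show "\<exists>y. P (Suc n) y \<and> Q n x y"
      by (intro exI[of _ "(b, f', k)"]) (simp add: P_def Q_def x)
  qed
  then obtain s where s: "\<And>n. P n (s n)" "\<And>n. Q n (s n) (s (Suc n))" by blast
  define m where "m n = fst (s n)" for n
  define d where "d n = fst (snd (s n))" for n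
  have sn: "s n = (m n, d n, m (Suc n))" for n
    using s(2)[of n] by (auto simp: Q_def m_def d_def split: prod.splits)
  have "quotient_resolution R J m d"
  proof (rule quotient_resolution.intro)
    show "cring R" by fact
    show "m 0 = 0" "m 1 = 1" using s(1)[of 0] sn[of 0] by (auto simp: P_def)
    show "d i \<in> mod_hom R (?F (m (Suc i))) (?F (m i))" for i
      using s(1)[of i] sn[of i] by (auto simp: P_def)
    show "d 1 ` carrier (?F (m 2)) = {x \<in> carrier (?F (m 1)). x 0 \<in> J}"
      using s(2)[of 0] sn[of 0] sn[of 1] \<open>m 1 = 1\<close> by (simp add: Q_def numeral_2_eq_2)
    show "d (Suc i) ` carrier (?F (m (Suc (Suc i)))) = mod_ker (?F (m (Suc i))) (?F (m i)) (d i)" if "i \<ge> 1" for i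
      using s(2)[of i] sn[of i] sn[of "Suc i"] that by (simp add: Q_def)
  qed
  then show ?thesis by blast
qed

context quotient_resolution
begin

text \<open>
  Multiplication by an element of \<open>J\<close> is zero on \<open>R/J\<close>, hence homotopic to zero on its resolution;
  so \<open>J\<close> annihilates all \<open>Ext\<^sup>i(R/J, N)\<close>.
\<close>

lemma null_homotopy:
  assumes J: "ideal J R" and y: "y \<in> J"
  shows "\<exists>h \<in> mod_hom R (G i) (G (Suc i)). \<exists>h' \<in> mod_hom R (G (Suc i)) (G (Suc (Suc i))).
    \<forall>z\<in>carrier (G (Suc i)). y \<odot>\<^bsub>G (Suc i)\<^esub> z = d (Suc i) (h' z) \<oplus>\<^bsub>G (Suc i)\<^esub> h (d i z)"
proof (induction i)
  interpret R: cring R by (rule R)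
  interpret J: ideal J R by fact
  have yR: "y \<in> carrier R" using y J.Icarr by simp
  case 0
  let ?H = "{x \<in> carrier (G 1). x 0 \<in> J}"
  have im: "d (Suc 0) ` carrier (G (Suc (Suc 0))) = ?H" using d_one by (simp add: numeral_2_eq_2)
  interpret G1: module R "G (Suc 0)" by (rule G_module)
  interpret G2: module R "G (Suc (Suc 0))" by (rule G_module)
  have H: "submodule ?H R (G (Suc 0))"
    using submodule_image[OF d_hom[of "Suc 0"] G_module G_module G2.carrier_is_submodule] im by simp
  let ?N = "G (Suc 0)\<lparr>carrier := ?H\<rparr>"
  have N: "module R ?N" by (rule module_restrict[OF G_module H])
  have d1: "d (Suc 0) \<in> mod_hom R (G (Suc (Suc 0))) ?N" by (rule mod_hom_corestrict[OF d_hom]) (rule equalityD1[OF im])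
  have c: "(\<lambda>z. y \<odot>\<^bsub>G (Suc 0)\<^esub> z) \<in> mod_hom R (G (Suc 0)) ?N"
  proof (rule mod_hom_corestrict[OF mod_hom_scale[OF mod_hom_id G_module G_module yR]], rule image_subsetI)
    fix z assume z: "z \<in> carrier (G (Suc 0))"
    have "y \<otimes>\<^bsub>R\<^esub> z 0 \<in> J" using J.I_r_closed[OF y free_module_value[OF R z]] by simp
    then show "y \<odot>\<^bsub>G (Suc 0)\<^esub> z \<in> ?H" using G1.smult_closed[OF yR z] by simp
  qed
  obtain h' where h': "h' \<in> mod_hom R (G (Suc 0)) (G (Suc (Suc 0)))"
    "\<And>z. z \<in> carrier (G (Suc 0)) \<Longrightarrow> d (Suc 0) (h' z) = y \<odot>\<^bsub>G (Suc 0)\<^esub> z"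
    by (rule lift_through_surj[OF d1 _ G_module N finite_lessThan c]) (simp add: im, blast)
  have "\<forall>z\<in>carrier (G (Suc 0)). y \<odot>\<^bsub>G (Suc 0)\<^esub> z = d (Suc 0) (h' z) \<oplus>\<^bsub>G (Suc 0)\<^esub> \<zero>\<^bsub>G (Suc 0)\<^esub>"
    using h'(2) G1.smult_closed[OF yR] by (auto simp del: free_module_simps)
  then show ?case
    by (intro bexI[of _ "\<lambda>x. \<zero>\<^bsub>G (Suc 0)\<^esub>"] bexI[OF _ h'(1)] mod_hom_zero_map[OF G_module])
next
  interpret R: cring R by (rule R)
  interpret J: ideal J R by fact
  have yR: "y \<in> carrier R" using y J.Icarr by simp
  case (Suc i)
  let ?A = "G (Suc i)" and ?B = "G (Suc (Suc i))" and ?C = "G (Suc (Suc (Suc i)))"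
  from Suc.IH obtain h h' where h: "h \<in> mod_hom R (G i) ?A" and h': "h' \<in> mod_hom R ?A ?B"
    and e: "\<And>z. z \<in> carrier ?A \<Longrightarrow> y \<odot>\<^bsub>?A\<^esub> z = d (Suc i) (h' z) \<oplus>\<^bsub>?A\<^esub> h (d i z)" by blast
  interpret A: module R ?A by (rule G_module)
  interpret B: module R ?B by (rule G_module)
  let ?K = "mod_ker ?B ?A (d (Suc i))"
  have im: "d (Suc (Suc i)) ` carrier ?C = ?K" by (rule d_exact) simp
  have K: "submodule ?K R ?B" by (rule mod_ker_submodule[OF d_hom G_module G_module])
  let ?N = "?B\<lparr>carrier := ?K\<rparr>"
  have N: "module R ?N" by (rule module_restrict[OF G_module K])
  let ?p = "\<lambda>z. y \<odot>\<^bsub>?B\<^esub> z \<ominus>\<^bsub>?B\<^esub> h' (d (Suc i) z)"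
  have p: "?p \<in> mod_hom R ?B ?B"
    by (rule mod_hom_diff[OF mod_hom_scale[OF mod_hom_id G_module G_module yR] mod_hom_comp[OF d_hom h'] G_module G_module])
  have pK: "?p z \<in> ?K" if z: "z \<in> carrier ?B" for z
  proof -
    have dz: "d (Suc i) z \<in> carrier ?A" by (rule d_closed[OF z])
    have hz: "h' (d (Suc i) z) \<in> carrier ?B" by (rule mod_hom_closed[OF h' dz])
    have "y \<odot>\<^bsub>?A\<^esub> d (Suc i) z = d (Suc i) (h' (d (Suc i) z)) \<oplus>\<^bsub>?A\<^esub> \<zero>\<^bsub>?A\<^esub>"
      using e[OF dz] d_d[OF z] mod_hom_zero[OF h G_module G_module] by simp
    then have eq: "y \<odot>\<^bsub>?A\<^esub> d (Suc i) z = d (Suc i) (h' (d (Suc i) z))"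
      using A.r_zero[OF d_closed[OF hz]] by simp
    have "d (Suc i) (?p z) = y \<odot>\<^bsub>?A\<^esub> d (Suc i) z \<ominus>\<^bsub>?A\<^esub> d (Suc i) (h' (d (Suc i) z))"
      using mod_hom_minus[OF d_hom G_module G_module B.smult_closed[OF yR z] hz] mod_hom_smult[OF d_hom yR z]
      by (simp del: free_module_simps)
    also have "\<dots> = \<zero>\<^bsub>?A\<^esub>"
      using eq module_minus_eq_zero_iff[OF G_module A.smult_closed[OF yR dz] d_closed[OF hz]]
      by (simp del: free_module_simps)
    finally show ?thesis using mod_hom_closed[OF p z] by (simp add: mod_ker_def del: free_module_simps)
  qed
  have c: "?p \<in> mod_hom R ?B ?N" by (rule mod_hom_corestrict[OF p]) (intro image_subsetI pK)
  have dd: "d (Suc (Suc i)) \<in> mod_hom R ?C ?N" by (rule mod_hom_corestrict[OF d_hom]) (rule equalityD1[OF im])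
  obtain k where k: "k \<in> mod_hom R ?B ?C" "\<And>z. z \<in> carrier ?B \<Longrightarrow> d (Suc (Suc i)) (k z) = ?p z"
    by (rule lift_through_surj[OF dd _ G_module N finite_lessThan c]) (simp add: im, blast)
  have "y \<odot>\<^bsub>?B\<^esub> z = d (Suc (Suc i)) (k z) \<oplus>\<^bsub>?B\<^esub> h' (d (Suc i) z)" if z: "z \<in> carrier ?B" for z
    using k(2)[OF z] B.smult_closed[OF yR z] mod_hom_closed[OF h' d_closed[OF z]]
    by (simp add: B.minus_eq B.a_assoc B.l_neg del: free_module_simps)
  then show ?case by (intro bexI[OF _ h'] bexI[OF _ k(1)] ballI)
qed

lemma ext_torsion_of_mem:
  assumes J: "ideal J R" and y: "y \<in> J" and N: "module R N"
  shows "ext_torsion y N i"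
proof (rule ext_torsionI)
  interpret J: ideal J R by fact
  interpret N: module R N by fact
  have yR: "y \<in> carrier R" using y J.Icarr by simp
  fix c assume c: "c \<in> mod_hom R (G (Suc i)) N"
    and cd: "\<And>z. z \<in> carrier (G (Suc (Suc i))) \<Longrightarrow> c (d (Suc i) z) = \<zero>\<^bsub>N\<^esub>"
  from null_homotopy[OF J y, of i] obtain h h' where h: "h \<in> mod_hom R (G i) (G (Suc i))"
    and h': "h' \<in> mod_hom R (G (Suc i)) (G (Suc (Suc i)))"
    and e: "\<And>z. z \<in> carrier (G (Suc i)) \<Longrightarrow> y \<odot>\<^bsub>G (Suc i)\<^esub> z = d (Suc i) (h' z) \<oplus>\<^bsub>G (Suc i)\<^esub> h (d i z)" by blast
  have "(y [^]\<^bsub>R\<^esub> (1::nat)) \<odot>\<^bsub>N\<^esub> c z = c (h (d i z))" if z: "z \<in> carrier (G (Suc i))" for z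
  proof -
    have c1: "d (Suc i) (h' z) \<in> carrier (G (Suc i))" by (rule d_closed[OF mod_hom_closed[OF h' z]])
    have c2: "h (d i z) \<in> carrier (G (Suc i))" by (rule mod_hom_closed[OF h d_closed[OF z]])
    have "y \<odot>\<^bsub>N\<^esub> c z = c (d (Suc i) (h' z)) \<oplus>\<^bsub>N\<^esub> c (h (d i z))"
      using mod_hom_smult[OF c yR z] e[OF z] mod_hom_add[OF c c1 c2] by simp
    also have "c (d (Suc i) (h' z)) = \<zero>\<^bsub>N\<^esub>" by (rule cd[OF mod_hom_closed[OF h' z]])
    finally show ?thesis using mod_hom_closed[OF c c2] yR by simp
  qed
  then show "\<exists>(k::nat). \<exists>b \<in> mod_hom R (G i) N. \<forall>z\<in>carrier (G (Suc i)). (y [^]\<^bsub>R\<^esub> k) \<odot>\<^bsub>N\<^esub> c z = b (d i z)"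
    by (intro exI[of _ 1] bexI[OF _ mod_hom_comp[OF h c]] ballI)
qed

lemma ext_torsion_of_power:
  assumes J: "ideal J R" and x: "x \<in> carrier R" "x [^]\<^bsub>R\<^esub> (n::nat) \<in> J" and N: "module R N"
  shows "ext_torsion x N i"
proof (rule ext_torsionI)
  interpret R: cring R by (rule R)
  fix c assume c: "c \<in> mod_hom R (G (Suc i)) N"
    and cd: "\<And>z. z \<in> carrier (G (Suc (Suc i))) \<Longrightarrow> c (d (Suc i) z) = \<zero>\<^bsub>N\<^esub>"
  obtain k b where b: "b \<in> mod_hom R (G i) N"
    "\<And>z. z \<in> carrier (G (Suc i)) \<Longrightarrow> ((x [^]\<^bsub>R\<^esub> n) [^]\<^bsub>R\<^esub> (k::nat)) \<odot>\<^bsub>N\<^esub> c z = b (d i z)"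
    by (rule ext_torsionE[OF ext_torsion_of_mem[OF J x(2) N] c cd]) blast+
  then show "\<exists>(k::nat). \<exists>b \<in> mod_hom R (G i) N. \<forall>z\<in>carrier (G (Suc i)). (x [^]\<^bsub>R\<^esub> k) \<odot>\<^bsub>N\<^esub> c z = b (d i z)"
    using x(1) by (intro exI[of _ "n * k"] bexI[of _ b] ballI) (simp_all add: R.nat_pow_pow)
qed

end


section \<open>Cyclic modules and regular sequences\<close>

abbreviation cyclic :: "('a, 'r) ring_scheme \<Rightarrow> 'a set \<Rightarrow> ('a, 'a set) module"
  where "cyclic R A \<equiv> quotient_module (self_module R) A"

definition colon :: "('a, 'r) ring_scheme \<Rightarrow> 'a set \<Rightarrow> 'a \<Rightarrow> 'a set"
  where "colon R A x = {a \<in> carrier R. a \<otimes>\<^bsub>R\<^esub> x \<in> A}"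

definition adjoin :: "('a, 'r) ring_scheme \<Rightarrow> 'a set \<Rightarrow> 'a \<Rightarrow> 'a set"
  where "adjoin R A x = {a \<oplus>\<^bsub>R\<^esub> r \<otimes>\<^bsub>R\<^esub> x | a r. a \<in> A \<and> r \<in> carrier R}"

lemma adjoinI: "a \<in> A \<Longrightarrow> r \<in> carrier R \<Longrightarrow> a \<oplus>\<^bsub>R\<^esub> r \<otimes>\<^bsub>R\<^esub> x \<in> adjoin R A x"
  by (auto simp: adjoin_def)

lemma adjoinE:
  assumes "b \<in> adjoin R A x"
  obtains a r where "a \<in> A" "r \<in> carrier R" "b = a \<oplus>\<^bsub>R\<^esub> r \<otimes>\<^bsub>R\<^esub> x"
  using assms by (auto simp: adjoin_def)

lemma cyclic_module: "cring R \<Longrightarrow> ideal A R \<Longrightarrow> module R (cyclic R A)"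
  by (rule quotient_module_module[OF self_module_module]) (simp_all add: submodule_self_iff_ideal)

lemma cyclic_proj:
  "cring R \<Longrightarrow> ideal A R \<Longrightarrow> (\<lambda>x. A +>\<^bsub>self_module R\<^esub> x) \<in> mod_hom R (self_module R) (cyclic R A)"
  by (rule quotient_module_proj[OF self_module_module]) (simp_all add: submodule_self_iff_ideal)

lemma cyclic_eq_zero_iff:
  "cring R \<Longrightarrow> ideal A R \<Longrightarrow> x \<in> carrier R \<Longrightarrow> A +>\<^bsub>self_module R\<^esub> x = \<zero>\<^bsub>cyclic R A\<^esub> \<longleftrightarrow> x \<in> A"
  using quotient_module_eq_zero_iff[OF self_module_module, of R A x] by (simp add: submodule_self_iff_ideal)

lemma carrier_cyclic: "carrier (cyclic R A) = (\<lambda>x. A +>\<^bsub>self_module R\<^esub> x) ` carrier R"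
  by (simp add: carrier_quotient_module)

lemma cyclic_smult:
  "cring R \<Longrightarrow> ideal A R \<Longrightarrow> x \<in> carrier R \<Longrightarrow> a \<in> carrier R \<Longrightarrow>
    a \<odot>\<^bsub>cyclic R A\<^esub> (A +>\<^bsub>self_module R\<^esub> x) = A +>\<^bsub>self_module R\<^esub> (a \<otimes>\<^bsub>R\<^esub> x)"
  using quotient_module_smult[OF self_module_module, of R A x a] by (simp add: submodule_self_iff_ideal)

lemma colon_ideal:
  assumes R: "cring R" and A: "ideal A R" and x: "x \<in> carrier R" shows "ideal (colon R A x) R"
proof -
  interpret R: cring R by fact
  have "(\<lambda>a. a \<otimes>\<^bsub>R\<^esub> x) \<in> mod_hom R (self_module R) (self_module R)"
    using x by (intro mod_homI) (simp_all add: R.l_distr R.m_assoc)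
  from submodule_vimage[OF this self_module_module[OF R] self_module_module[OF R], of A]
  show ?thesis using A by (simp add: colon_def submodule_self_iff_ideal[OF R])
qed

lemma adjoin_ideal:
  assumes R: "cring R" and A: "ideal A R" and x: "x \<in> carrier R"
  shows "ideal (adjoin R A x) R" "A \<subseteq> adjoin R A x" "x \<in> adjoin R A x"
proof -
  interpret R: cring R by fact
  interpret A: ideal A R by fact
  have "submodule (adjoin R A x) R (self_module R)"
  proof (rule submoduleI'[OF self_module_module[OF R]])
    show "adjoin R A x \<subseteq> carrier (self_module R)" using x A.Icarr by (auto simp: adjoin_def)
    show "\<zero>\<^bsub>self_module R\<^esub> \<in> adjoin R A x"
      using adjoinI[of "\<zero>\<^bsub>R\<^esub>" A "\<zero>\<^bsub>R\<^esub>" R x] x by simp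
    show "a \<oplus>\<^bsub>self_module R\<^esub> b \<in> adjoin R A x" if ab: "a \<in> adjoin R A x" "b \<in> adjoin R A x" for a b
    proof -
      obtain a1 r1 a2 r2 where *: "a = a1 \<oplus>\<^bsub>R\<^esub> r1 \<otimes>\<^bsub>R\<^esub> x" "b = a2 \<oplus>\<^bsub>R\<^esub> r2 \<otimes>\<^bsub>R\<^esub> x"
        "a1 \<in> A" "a2 \<in> A" "r1 \<in> carrier R" "r2 \<in> carrier R" using ab by (elim adjoinE)
      then have "a \<oplus>\<^bsub>R\<^esub> b = (a1 \<oplus>\<^bsub>R\<^esub> a2) \<oplus>\<^bsub>R\<^esub> (r1 \<oplus>\<^bsub>R\<^esub> r2) \<otimes>\<^bsub>R\<^esub> x"
        using x A.Icarr by (simp add: R.l_distr R.a_ac)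
      then show ?thesis using * adjoinI[of "a1 \<oplus>\<^bsub>R\<^esub> a2" A "r1 \<oplus>\<^bsub>R\<^esub> r2" R x] by simp
    qed
    show "a \<odot>\<^bsub>self_module R\<^esub> b \<in> adjoin R A x" if ab: "a \<in> carrier R" "b \<in> adjoin R A x" for a b
    proof -
      obtain a2 r2 where *: "b = a2 \<oplus>\<^bsub>R\<^esub> r2 \<otimes>\<^bsub>R\<^esub> x"
        "a2 \<in> A" "r2 \<in> carrier R" using ab by (elim adjoinE)
      then have "a \<otimes>\<^bsub>R\<^esub> b = (a \<otimes>\<^bsub>R\<^esub> a2) \<oplus>\<^bsub>R\<^esub> (a \<otimes>\<^bsub>R\<^esub> r2) \<otimes>\<^bsub>R\<^esub> x"
        using x A.Icarr ab by (simp add: R.r_distr R.m_assoc)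
      then show ?thesis using * ab A.I_l_closed adjoinI[of "a \<otimes>\<^bsub>R\<^esub> a2" A "a \<otimes>\<^bsub>R\<^esub> r2" R x] by simp
    qed
  qed
  then show "ideal (adjoin R A x) R" by (simp add: submodule_self_iff_ideal[OF R])
  show "A \<subseteq> adjoin R A x"
  proof
    fix a assume "a \<in> A"
    then show "a \<in> adjoin R A x" using adjoinI[of a A "\<zero>\<^bsub>R\<^esub>" R x] x A.Icarr by simp
  qed
  show "x \<in> adjoin R A x" using adjoinI[of "\<zero>\<^bsub>R\<^esub>" A "\<one>\<^bsub>R\<^esub>" R x] x by simp
qed

lemma adjoin_least:
  assumes "ideal B R" "A \<subseteq> B" "x \<in> B" shows "adjoin R A x \<subseteq> B"
proof -
  interpret B: ideal B R by fact
  show ?thesis using assms(2,3) B.I_l_closed B.a_closed by (auto simp: adjoin_def)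
qed

text \<open>
  This sequence serves twice: for \<open>x\<close> regular on \<open>R/A\<close>, and in the noetherian induction for an ideal
  \<open>A\<close> that is not prime.
\<close>

lemma short_exact_cyclic:
  assumes R: "cring R" and A: "ideal A R" and x: "x \<in> carrier R"
  obtains f g where "short_exact R (cyclic R (colon R A x)) (cyclic R A) (cyclic R (adjoin R A x)) f g"
    "\<And>a. a \<in> carrier R \<Longrightarrow> f (colon R A x +>\<^bsub>self_module R\<^esub> a) = A +>\<^bsub>self_module R\<^esub> (a \<otimes>\<^bsub>R\<^esub> x)"
proof -
  interpret R: cring R by fact
  interpret A: ideal A R by fact
  let ?S = "self_module R" and ?C = "colon R A x" and ?B = "adjoin R A x"
  note C = colon_ideal[OF R A x] and B = adjoin_ideal[OF R A x]
  note S = self_module_module[OF R]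
  note MA = cyclic_module[OF R A] and MC = cyclic_module[OF R C] and MB = cyclic_module[OF R B(1)]
  interpret MA: module R "cyclic R A" by fact
  have "(\<lambda>a. a \<otimes>\<^bsub>R\<^esub> x) \<in> mod_hom R ?S ?S"
    using x by (intro mod_homI) (simp_all add: R.l_distr R.m_assoc)
  note c = mod_hom_comp[OF this cyclic_proj[OF R A]]
  have surj: "(\<lambda>a. I +>\<^bsub>?S\<^esub> a) ` carrier ?S = carrier (cyclic R I)" for I by (simp add: carrier_cyclic)
  have zA: "A +>\<^bsub>?S\<^esub> (a \<otimes>\<^bsub>R\<^esub> x) = \<zero>\<^bsub>cyclic R A\<^esub> \<longleftrightarrow> a \<in> ?C" if "a \<in> carrier R" for a
    using cyclic_eq_zero_iff[OF R A, of "a \<otimes>\<^bsub>R\<^esub> x"] that x by (simp add: colon_def)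
  have cker: "A +>\<^bsub>?S\<^esub> (a \<otimes>\<^bsub>R\<^esub> x) = \<zero>\<^bsub>cyclic R A\<^esub>" if "a \<in> carrier ?S" "?C +>\<^bsub>?S\<^esub> a = \<zero>\<^bsub>cyclic R ?C\<^esub>" for a
    using zA[of a] cyclic_eq_zero_iff[OF R C, of a] that by simp
  obtain f where f: "f \<in> mod_hom R (cyclic R ?C) (cyclic R A)"
    "\<And>a. a \<in> carrier ?S \<Longrightarrow> f (?C +>\<^bsub>?S\<^esub> a) = A +>\<^bsub>?S\<^esub> (a \<otimes>\<^bsub>R\<^esub> x)"
    by (rule factor_through_surj[OF cyclic_proj[OF R C] surj S MC MA c cker]) blast+
  have gker: "?B +>\<^bsub>?S\<^esub> a = \<zero>\<^bsub>cyclic R ?B\<^esub>" if "a \<in> carrier ?S" "A +>\<^bsub>?S\<^esub> a = \<zero>\<^bsub>cyclic R A\<^esub>" for a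
    using cyclic_eq_zero_iff[OF R A, of a] cyclic_eq_zero_iff[OF R B(1), of a] that B(2) by auto
  obtain g where g: "g \<in> mod_hom R (cyclic R A) (cyclic R ?B)"
    "\<And>a. a \<in> carrier ?S \<Longrightarrow> g (A +>\<^bsub>?S\<^esub> a) = ?B +>\<^bsub>?S\<^esub> a"
    by (rule factor_through_surj[OF cyclic_proj[OF R A] surj S MA MB cyclic_proj[OF R B(1)] gker]) blast+
  have inj: "inj_on f (carrier (cyclic R ?C))"
    unfolding inj_on_mod_hom_iff[OF f(1) MC MA]
  proof (intro ballI impI)
    fix X assume X: "X \<in> carrier (cyclic R ?C)" "f X = \<zero>\<^bsub>cyclic R A\<^esub>"
    obtain a where a: "a \<in> carrier ?S" "X = ?C +>\<^bsub>?S\<^esub> a" using X(1) by (rule quotient_moduleE)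
    then show "X = \<zero>\<^bsub>cyclic R ?C\<^esub>" using X(2) f(2)[OF a(1)] zA[of a] cyclic_eq_zero_iff[OF R C, of a] by simp
  qed
  have gsurj: "g ` carrier (cyclic R A) = carrier (cyclic R ?B)"
    unfolding carrier_cyclic image_image using g(2) by (intro image_cong) simp_all
  have ker: "f ` carrier (cyclic R ?C) = mod_ker (cyclic R A) (cyclic R ?B) g"
  proof (intro equalityI subsetI)
    fix Y assume "Y \<in> f ` carrier (cyclic R ?C)"
    then obtain X where X: "X \<in> carrier (cyclic R ?C)" "Y = f X" by (elim imageE)
    obtain a where a: "a \<in> carrier ?S" "X = ?C +>\<^bsub>?S\<^esub> a" using X(1) by (rule quotient_moduleE)
    have ax: "a \<otimes>\<^bsub>R\<^esub> x \<in> carrier R" using a x by simp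
    have "a \<otimes>\<^bsub>R\<^esub> x \<in> ?B" using ideal.I_l_closed[OF B(1) B(3), of a] a by simp
    then have "g (f X) = \<zero>\<^bsub>cyclic R ?B\<^esub>"
      using f(2)[OF a(1)] a(2) g(2)[of "a \<otimes>\<^bsub>R\<^esub> x"] ax cyclic_eq_zero_iff[OF R B(1) ax] by simp
    then show "Y \<in> mod_ker (cyclic R A) (cyclic R ?B) g"
      using X mod_hom_closed[OF f(1)] by (simp add: mod_ker_def)
  next
    fix Y assume Y: "Y \<in> mod_ker (cyclic R A) (cyclic R ?B) g"
    then have "Y \<in> carrier (cyclic R A)" by (simp add: mod_ker_def)
    then obtain a where a: "a \<in> carrier ?S" "Y = A +>\<^bsub>?S\<^esub> a" by (rule quotient_moduleE)
    have "a \<in> ?B" using Y a g(2)[OF a(1)] cyclic_eq_zero_iff[OF R B(1), of a] by (simp add: mod_ker_def)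
    then obtain u r where u: "a = u \<oplus>\<^bsub>R\<^esub> r \<otimes>\<^bsub>R\<^esub> x" "u \<in> A" "r \<in> carrier R" by (rule adjoinE)
    have uR: "u \<in> carrier R" using u A.Icarr by simp
    have "A +>\<^bsub>?S\<^esub> a = (A +>\<^bsub>?S\<^esub> u) \<oplus>\<^bsub>cyclic R A\<^esub> (A +>\<^bsub>?S\<^esub> (r \<otimes>\<^bsub>R\<^esub> x))"
      using mod_hom_add[OF cyclic_proj[OF R A], of u "r \<otimes>\<^bsub>R\<^esub> x"] u uR x by simp
    also have "A +>\<^bsub>?S\<^esub> u = \<zero>\<^bsub>cyclic R A\<^esub>" using cyclic_eq_zero_iff[OF R A uR] u by simp
    finally have "Y = f (?C +>\<^bsub>?S\<^esub> r)"
      using a f(2)[of r] u x mod_hom_closed[OF cyclic_proj[OF R A], of "r \<otimes>\<^bsub>R\<^esub> x"] by simp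
    then show "Y \<in> f ` carrier (cyclic R ?C)" using u(3) by (auto simp: carrier_cyclic)
  qed
  show ?thesis
  proof (rule that[of f g])
    show "short_exact R (cyclic R ?C) (cyclic R A) (cyclic R ?B) f g"
      unfolding short_exact_def using MA MB MC f(1) g(1) inj gsurj ker by blast
  qed (use f(2) in simp)
qed

lemma short_exact_cyclic_regular:
  assumes R: "cring R" and A: "ideal A R" and x: "x \<in> carrier R"
    and reg: "\<And>a. a \<in> carrier R \<Longrightarrow> x \<otimes>\<^bsub>R\<^esub> a \<in> A \<Longrightarrow> a \<in> A"
  obtains g where "short_exact R (cyclic R A) (cyclic R A) (cyclic R (adjoin R A x)) (\<lambda>X. x \<odot>\<^bsub>cyclic R A\<^esub> X) g"
proof -
  interpret R: cring R by fact
  interpret A: ideal A R by fact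
  have C: "colon R A x = A"
  proof (intro equalityI subsetI)
    show "a \<in> A" if "a \<in> colon R A x" for a
      using that reg[of a] R.m_comm[of a x] x by (simp add: colon_def)
    show "a \<in> colon R A x" if "a \<in> A" for a
      using that A.I_r_closed[OF that x] A.Icarr[OF that] by (simp add: colon_def)
  qed
  obtain f g where fg: "short_exact R (cyclic R A) (cyclic R A) (cyclic R (adjoin R A x)) f g"
    "\<And>a. a \<in> carrier R \<Longrightarrow> f (A +>\<^bsub>self_module R\<^esub> a) = A +>\<^bsub>self_module R\<^esub> (a \<otimes>\<^bsub>R\<^esub> x)"
    by (rule short_exact_cyclic[OF R A x, unfolded C]) blast
  have eq: "f X = x \<odot>\<^bsub>cyclic R A\<^esub> X" if X: "X \<in> carrier (cyclic R A)" for X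
  proof -
    obtain a where a: "a \<in> carrier (self_module R)" "X = A +>\<^bsub>self_module R\<^esub> a" using X by (rule quotient_moduleE)
    then show ?thesis using fg(2)[of a] cyclic_smult[OF R A _ x, of a] x R.m_comm[of a x] by simp
  qed
  note fg' = fg(1)[unfolded short_exact_def]
  have M: "module R (cyclic R A)" using fg' by simp
  have "(\<lambda>X. x \<odot>\<^bsub>cyclic R A\<^esub> X) \<in> mod_hom R (cyclic R A) (cyclic R A)"
    by (rule mod_hom_scale[OF mod_hom_id M M x])
  moreover have "inj_on (\<lambda>X. x \<odot>\<^bsub>cyclic R A\<^esub> X) (carrier (cyclic R A))"
    using fg' inj_on_cong[of "carrier (cyclic R A)" f "\<lambda>X. x \<odot>\<^bsub>cyclic R A\<^esub> X"] eq by simp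
  moreover have "(\<lambda>X. x \<odot>\<^bsub>cyclic R A\<^esub> X) ` carrier (cyclic R A) = f ` carrier (cyclic R A)"
    using eq by (intro image_cong) simp_all
  ultimately show ?thesis using fg' by (intro that[of g]) (simp add: short_exact_def)
qed

lemma ideal_set_smult:
  assumes R: "cring R" and X: "X \<subseteq> carrier R" shows "ideal (set_smult R X (self_module R)) R"
proof -
  interpret R: cring R by fact
  have "{a \<odot>\<^bsub>self_module R\<^esub> m | a m. a \<in> X \<and> m \<in> carrier (self_module R)} \<subseteq> carrier (self_module R)"
    using X by auto
  from mod_span_submodule[OF self_module_module[OF R] this] show ?thesis
    by (simp add: set_smult_def submodule_self_iff_ideal[OF R])
qed

lemma set_smult_self_subset_iff:
  assumes R: "cring R" and X: "X \<subseteq> carrier R" and B: "ideal B R"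
  shows "set_smult R X (self_module R) \<subseteq> B \<longleftrightarrow> X \<subseteq> B"
proof
  interpret R: cring R by fact
  interpret B: ideal B R by fact
  let ?T = "{a \<odot>\<^bsub>self_module R\<^esub> m | a m. a \<in> X \<and> m \<in> carrier (self_module R)}"
  have "X \<subseteq> ?T"
  proof
    fix a assume a: "a \<in> X"
    then have "a = a \<odot>\<^bsub>self_module R\<^esub> \<one>\<^bsub>R\<^esub>" using X by auto
    then show "a \<in> ?T" using a by force
  qed
  then show "X \<subseteq> B" if "set_smult R X (self_module R) \<subseteq> B"
    using that mod_span_superset[of ?T R "self_module R"] unfolding set_smult_def by blast
  show "set_smult R X (self_module R) \<subseteq> B" if "X \<subseteq> B"
    unfolding set_smult_def
    using that B B.I_r_closed by (intro mod_span_least) (auto simp: submodule_self_iff_ideal[OF R])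
qed

lemma set_smult_insert:
  assumes R: "cring R" and X: "X \<subseteq> carrier R" and x: "x \<in> carrier R"
  shows "set_smult R (insert x X) (self_module R) = adjoin R (set_smult R X (self_module R)) x"
proof
  let ?A = "set_smult R X (self_module R)" and ?B = "set_smult R (insert x X) (self_module R)"
  have X': "insert x X \<subseteq> carrier R" using X x by simp
  note A = ideal_set_smult[OF R X] and B = ideal_set_smult[OF R X']
  note ad = adjoin_ideal[OF R A x]
  have "X \<subseteq> ?A" using set_smult_self_subset_iff[OF R X A] by simp
  then show "?B \<subseteq> adjoin R ?A x" using set_smult_self_subset_iff[OF R X' ad(1)] ad(2,3) by auto
  have "insert x X \<subseteq> ?B" using set_smult_self_subset_iff[OF R X' B] by simp
  then show "adjoin R ?A x \<subseteq> ?B" using set_smult_self_subset_iff[OF R X B] by (intro adjoin_least[OF B]) auto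
qed

lemma cyclic_zero_iso:
  assumes R: "cring R" shows "mod_iso R (self_module R) (cyclic R {\<zero>\<^bsub>R\<^esub>})"
proof -
  interpret R: cring R by fact
  interpret S: module R "self_module R" by (rule self_module_module[OF R])
  have Z: "ideal {\<zero>\<^bsub>R\<^esub>} R" by (rule R.zeroideal)
  have "inj_on (\<lambda>a. {\<zero>\<^bsub>R\<^esub>} +>\<^bsub>self_module R\<^esub> a) (carrier (self_module R))"
    unfolding inj_on_mod_hom_iff[OF cyclic_proj[OF R Z] S.module_axioms cyclic_module[OF R Z]]
    by (simp add: cyclic_eq_zero_iff[OF R Z])
  then show ?thesis unfolding mod_iso_def
    by (intro bexI[OF _ cyclic_proj[OF R Z]]) (simp add: bij_betw_def carrier_cyclic)
qed

context quotient_resolution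
begin

text \<open>
  Depth sensitivity of Ext. Going down from the quotient by the whole sequence, each \<open>x\<^sub>j\<close> that is
  put back gains one degree of vanishing: a power of \<open>x\<^sub>j\<close> lies in \<open>J\<close> and kills the Ext modules, and
  \<open>x\<^sub>j\<close> is regular, so that \<open>ext_vanishing_of_torsion\<close> applies.
\<close>

lemma ext_vanishing_of_regular_sequence:
  assumes J: "ideal J R" and reg: "regular_sequence R (self_module R) xs"
    and rad: "\<And>x. x \<in> set xs \<Longrightarrow> \<exists>n::nat. x [^]\<^bsub>R\<^esub> n \<in> J"
    and i: "i < length xs"
  shows "ext_torsion \<one>\<^bsub>R\<^esub> (self_module R) i"
proof -
  interpret R: cring R by (rule R)
  let ?A = "\<lambda>j. set_smult R (set (take j xs)) (self_module R)"
  have xs: "set xs \<subseteq> carrier R" using reg by (simp add: regular_sequence_def)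
  have sub: "set (take j xs) \<subseteq> carrier R" for j by (rule subset_trans[OF set_take_subset xs])
  note A = ideal_set_smult[OF R sub]
  have "\<forall>i<k. ext_torsion \<one>\<^bsub>R\<^esub> (cyclic R (?A j)) i" if "j + k = length xs" for j k
    using that
  proof (induction k arbitrary: j)
    case (Suc k)
    then have j: "j < length xs" by simp
    let ?x = "xs ! j"
    have xin: "?x \<in> set xs" using j by simp
    then have x: "?x \<in> carrier R" using xs by (rule subsetD[rotated])
    have rx: "a \<in> ?A j" if "a \<in> carrier R" "?x \<otimes>\<^bsub>R\<^esub> a \<in> ?A j" for a
      using reg that j by (simp add: regular_sequence_def)
    have ad: "adjoin R (?A j) ?x = ?A (Suc j)"
      using set_smult_insert[OF R sub x, of j] j by (simp add: take_Suc_conv_app_nth)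
    obtain g where g: "short_exact R (cyclic R (?A j)) (cyclic R (?A j)) (cyclic R (?A (Suc j)))
        (\<lambda>X. ?x \<odot>\<^bsub>cyclic R (?A j)\<^esub> X) g"
      by (rule short_exact_cyclic_regular[OF R A x rx, unfolded ad]) blast+
    obtain n :: nat where n: "?x [^]\<^bsub>R\<^esub> n \<in> J" using rad[OF xin] ..
    have IH: "\<forall>i<k. ext_torsion \<one>\<^bsub>R\<^esub> (cyclic R (?A (Suc j))) i" using Suc by simp
    have "ext_torsion \<one>\<^bsub>R\<^esub> (cyclic R (?A j)) i" if i: "i < Suc k" for i
      by (rule ext_vanishing_of_torsion[OF g x _ ext_torsion_of_power[OF J x n cyclic_module[OF R A]]])
        (use IH i in simp)
    then show ?case by simp
  qed simp
  from this[of 0 "length xs"] i have t: "ext_torsion \<one>\<^bsub>R\<^esub> (cyclic R (?A 0)) i" by simp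
  have "?A 0 = {\<zero>\<^bsub>R\<^esub>}"
    using set_smult_self_subset_iff[OF R _ R.zeroideal, of "{}"] submodule_zero[of "?A 0" R "self_module R"]
      A[of 0] submodule_self_iff_ideal[OF R, of "?A 0"] by auto
  then have t: "ext_torsion \<one>\<^bsub>R\<^esub> (cyclic R {\<zero>\<^bsub>R\<^esub>}) i" using t by simp
  show ?thesis
    by (rule ext_torsion_iso[OF mod_iso_sym[OF cyclic_zero_iso[OF R] self_module_module[OF R]]
          cyclic_module[OF R R.zeroideal] self_module_module[OF R] R.one_closed t])
qed

end


section \<open>Modules over a domain \<open>R/\<qq>\<close>, generically\<close>

text \<open>
  The predicate holds for all multiples of some element outside \<open>\<qq>\<close>. Finitely many predicates with
  this property hold for a common element outside \<open>\<qq>\<close>.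
\<close>

definition generically :: "('a, 'r) ring_scheme \<Rightarrow> 'a set \<Rightarrow> ('a \<Rightarrow> bool) \<Rightarrow> bool"
  where "generically R \<qq> P \<longleftrightarrow> (\<exists>s \<in> carrier R - \<qq>. \<forall>t \<in> carrier R. P (s \<otimes>\<^bsub>R\<^esub> t))"

lemma primeideal_mult_notin:
  assumes "primeideal \<qq> R" "s \<in> carrier R - \<qq>" "t \<in> carrier R - \<qq>"
  shows "s \<otimes>\<^bsub>R\<^esub> t \<in> carrier R - \<qq>"
proof -
  interpret primeideal \<qq> R by fact
  show ?thesis using assms(2,3) I_prime by auto
qed

lemma primeideal_one_notin:
  assumes "primeideal \<qq> R" shows "\<one>\<^bsub>R\<^esub> \<in> carrier R - \<qq>"
proof -
  interpret primeideal \<qq> R by fact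
  show ?thesis using I_notcarr one_imp_carrier by auto
qed

lemma generically_conj:
  assumes q: "primeideal \<qq> R" and P: "generically R \<qq> P" and Q: "generically R \<qq> Q"
  shows "generically R \<qq> (\<lambda>s. P s \<and> Q s)"
proof -
  interpret q: primeideal \<qq> R by fact
  obtain s where s: "s \<in> carrier R - \<qq>" "\<forall>t\<in>carrier R. P (s \<otimes>\<^bsub>R\<^esub> t)" using P unfolding generically_def ..
  obtain r where r: "r \<in> carrier R - \<qq>" "\<forall>t\<in>carrier R. Q (r \<otimes>\<^bsub>R\<^esub> t)" using Q unfolding generically_def ..
  have sr: "s \<in> carrier R" "r \<in> carrier R" using s r by auto
  have "P (s \<otimes>\<^bsub>R\<^esub> r \<otimes>\<^bsub>R\<^esub> t) \<and> Q (s \<otimes>\<^bsub>R\<^esub> r \<otimes>\<^bsub>R\<^esub> t)" if t: "t \<in> carrier R" for t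
  proof -
    have "P (s \<otimes>\<^bsub>R\<^esub> (r \<otimes>\<^bsub>R\<^esub> t))" "Q (r \<otimes>\<^bsub>R\<^esub> (s \<otimes>\<^bsub>R\<^esub> t))" using s(2) r(2) sr t by auto
    then show ?thesis using sr t by (simp add: q.m_assoc q.m_lcomm)
  qed
  then show ?thesis
    unfolding generically_def using primeideal_mult_notin[OF q s(1) r(1)] by (intro bexI[of _ "s \<otimes>\<^bsub>R\<^esub> r"]) auto
qed

lemma generically_mono:
  assumes "generically R \<qq> P" and "\<And>s. s \<in> carrier R \<Longrightarrow> P s \<Longrightarrow> Q s" and "cring R"
  shows "generically R \<qq> Q"
proof -
  interpret cring R by fact
  obtain s where s: "s \<in> carrier R - \<qq>" "\<forall>t\<in>carrier R. P (s \<otimes>\<^bsub>R\<^esub> t)"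
    using assms(1) unfolding generically_def ..
  then show ?thesis unfolding generically_def using assms(2) by (intro bexI[of _ s]) auto
qed

lemma generically_ball_finite:
  assumes q: "primeideal \<qq> R" and "finite F" and "\<And>j. j \<in> F \<Longrightarrow> generically R \<qq> (P j)"
  shows "generically R \<qq> (\<lambda>s. \<forall>j\<in>F. P j s)"
  using assms(2,3)
proof (induction F)
  case empty
  show ?case unfolding generically_def using primeideal_one_notin[OF q] by auto
next
  case (insert j F)
  have "generically R \<qq> (\<lambda>s. P j s \<and> (\<forall>j\<in>F. P j s))"
    using insert by (intro generically_conj[OF q]) auto
  then show ?case by simp
qed

lemma generically_obtain:
  assumes q: "primeideal \<qq> R" and "generically R \<qq> P"
  obtains s where "s \<in> carrier R - \<qq>" "P s"
proof -
  interpret q: primeideal \<qq> R by fact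
  obtain s where s: "s \<in> carrier R - \<qq>" "\<forall>t\<in>carrier R. P (s \<otimes>\<^bsub>R\<^esub> t)"
    using assms(2) unfolding generically_def ..
  then have "P (s \<otimes>\<^bsub>R\<^esub> \<one>\<^bsub>R\<^esub>)" by blast
  with s(1) show ?thesis by (intro that[of s]) simp_all
qed

lemma cyclic_domain_dichotomy:
  assumes q: "primeideal \<qq> R" and Q: "module R Q" and x: "x \<in> carrier Q"
    and gen: "(\<lambda>a. a \<odot>\<^bsub>Q\<^esub> x) ` carrier R = carrier Q" and qx: "\<And>a. a \<in> \<qq> \<Longrightarrow> a \<odot>\<^bsub>Q\<^esub> x = \<zero>\<^bsub>Q\<^esub>"
  shows "(\<exists>s \<in> carrier R - \<qq>. \<forall>y \<in> carrier Q. s \<odot>\<^bsub>Q\<^esub> y = \<zero>\<^bsub>Q\<^esub>) \<or> mod_iso R (cyclic R \<qq>) Q"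
proof (cases "\<exists>s \<in> carrier R - \<qq>. s \<odot>\<^bsub>Q\<^esub> x = \<zero>\<^bsub>Q\<^esub>")
  interpret Q: module R Q by fact
  case True
  then obtain s where s: "s \<in> carrier R" "s \<notin> \<qq>" "s \<odot>\<^bsub>Q\<^esub> x = \<zero>\<^bsub>Q\<^esub>" by auto
  have "s \<odot>\<^bsub>Q\<^esub> y = \<zero>\<^bsub>Q\<^esub>" if "y \<in> carrier Q" for y
  proof -
    have "y \<in> (\<lambda>a. a \<odot>\<^bsub>Q\<^esub> x) ` carrier R" using that gen by simp
    then obtain a where a: "a \<in> carrier R" "y = a \<odot>\<^bsub>Q\<^esub> x" by (elim imageE)
    have "s \<odot>\<^bsub>Q\<^esub> y = a \<odot>\<^bsub>Q\<^esub> (s \<odot>\<^bsub>Q\<^esub> x)"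
      using a s x Q.smult_assoc1[of s a x] Q.smult_assoc1[of a s x] Q.R.m_comm[of a s] by simp
    then show ?thesis using a s by simp
  qed
  then show ?thesis using s by auto
next
  interpret Q: module R Q by fact
  interpret q: primeideal \<qq> R by fact
  case False
  note R = Q.is_cring and I = q.is_ideal
  have c: "(\<lambda>a. a \<odot>\<^bsub>Q\<^esub> x) \<in> mod_hom R (self_module R) Q"
    using x by (intro mod_homI) (simp_all add: Q.smult_l_distr Q.smult_assoc1)
  have "mod_iso R (cyclic R \<qq>) Q"
  proof (rule mod_iso_of_same_kernel[OF cyclic_proj[OF R I] _ self_module_module[OF R] cyclic_module[OF R I] Q c])
    show "\<qq> +>\<^bsub>self_module R\<^esub> a = \<zero>\<^bsub>cyclic R \<qq>\<^esub> \<longleftrightarrow> a \<odot>\<^bsub>Q\<^esub> x = \<zero>\<^bsub>Q\<^esub>" if "a \<in> carrier (self_module R)" for a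
      using that cyclic_eq_zero_iff[OF R I, of a] qx[of a] False by auto
  qed (simp_all add: gen carrier_cyclic)
  then show ?thesis by simp
qed

text \<open>Torsion of the Ext modules of \<open>R/\<qq>\<close> passes to \<open>M\<close>, uniformly in \<open>J\<close> and in the degree.\<close>

definition ext_torsion_dominated :: "('a, 'r) ring_scheme \<Rightarrow> 'a set \<Rightarrow> ('a, 'm) module \<Rightarrow> 'a \<Rightarrow> bool"
  where "ext_torsion_dominated R \<qq> M s \<longleftrightarrow> (\<forall>J m d i. quotient_resolution R J m d \<longrightarrow>
    quotient_resolution.ext_torsion R m d s (cyclic R \<qq>) i \<longrightarrow> quotient_resolution.ext_torsion R m d s M i)"

text \<open>
  A finitely generated module that is killed by \<open>\<qq>\<close> has a finite filtration by cyclic modules. Each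
  of them is \<open>R/\<qq>\<close> or is killed by an element outside \<open>\<qq>\<close>.
\<close>

lemma ext_torsion_of_domain:
  assumes q: "primeideal \<qq> R" and M: "module R M" and fg: "fin_gen R M"
    and kill: "\<And>a x. a \<in> \<qq> \<Longrightarrow> x \<in> carrier M \<Longrightarrow> a \<odot>\<^bsub>M\<^esub> x = \<zero>\<^bsub>M\<^esub>"
  shows "generically R \<qq> (ext_torsion_dominated R \<qq> M)"
proof -
  interpret M: module R M by fact
  interpret q: primeideal \<qq> R by fact
  note R = M.is_cring and I = q.is_ideal
  have "generically R \<qq> (ext_torsion_dominated R \<qq> (M\<lparr>carrier := mod_span R M S\<rparr>))" if "finite S" "S \<subseteq> carrier M" for S
    using that
  proof (induction S)
    case empty
    let ?Z = "M\<lparr>carrier := mod_span R M {}\<rparr>"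
    have Z: "module R ?Z" by (rule module_restrict[OF M mod_span_submodule[OF M]]) simp
    have "mod_span R M {} \<subseteq> {\<zero>\<^bsub>M\<^esub>}" by (rule mod_span_least[OF submodule_zero_set[OF M]]) simp
    then have kz: "s \<odot>\<^bsub>?Z\<^esub> x = \<zero>\<^bsub>?Z\<^esub>" if "s \<in> carrier R" "x \<in> carrier ?Z" for s x using that by auto
    then have "ext_torsion_dominated R \<qq> ?Z s" if "s \<in> carrier R" for s
      using quotient_resolution.ext_torsion_killed[OF _ Z that kz[OF that]] unfolding ext_torsion_dominated_def by blast
    then show ?case using primeideal_one_notin[OF q] unfolding generically_def by auto
  next
    case (insert x S)
    let ?X = "mod_span R M S" and ?Y = "mod_span R M (insert x S)"
    have x: "x \<in> carrier M" and SM: "S \<subseteq> carrier M" using insert by auto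
    have X: "submodule ?X R M" by (rule mod_span_submodule[OF M SM])
    have Y: "submodule ?Y R M" by (rule mod_span_submodule[OF M]) (use x SM in simp)
    have SY: "insert x S \<subseteq> ?Y" by (rule mod_span_superset)
    have XY: "?X \<subseteq> ?Y" by (rule mod_span_least[OF Y]) (use SY in simp)
    have YM: "?Y \<subseteq> carrier M" by (rule M.submoduleE(1)[OF Y])
    let ?N = "M\<lparr>carrier := ?Y\<rparr>"
    have N: "module R ?N" by (rule module_restrict[OF M Y])
    have XN: "submodule ?X R ?N" using X XY submodule_restrict_iff[OF M Y] by simp
    let ?Q = "quotient_module ?N ?X" and ?p = "\<lambda>y. ?X +>\<^bsub>?N\<^esub> y"
    have Q: "module R ?Q" by (rule quotient_module_module[OF N XN])
    interpret Q: module R ?Q by fact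
    have p: "?p \<in> mod_hom R ?N ?Q" by (rule quotient_module_proj[OF N XN])
    have xN: "x \<in> carrier ?N" using SY by simp
    have px: "?p x \<in> carrier ?Q" by (rule mod_hom_closed[OF p xN])
    have c: "(\<lambda>a. a \<odot>\<^bsub>?Q\<^esub> ?p x) \<in> mod_hom R (self_module R) ?Q"
      using px by (intro mod_homI) (simp_all add: Q.smult_l_distr Q.smult_assoc1)
    interpret S: module R "self_module R" by (rule self_module_module[OF R])
    let ?I = "(\<lambda>a. a \<odot>\<^bsub>?Q\<^esub> ?p x) ` carrier R"
    have I': "submodule ?I R ?Q"
      using submodule_image[OF c S.module_axioms Q S.carrier_is_submodule] by simp
    let ?V = "{y \<in> carrier ?N. ?p y \<in> ?I}"
    have V: "submodule ?V R M" using submodule_vimage[OF p N Q I'] submodule_restrict_iff[OF M Y] by blast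
    have "insert x S \<subseteq> ?V"
    proof
      fix y assume y: "y \<in> insert x S"
      show "y \<in> ?V"
      proof (cases "y = x")
        case True
        have "?p x = \<one>\<^bsub>R\<^esub> \<odot>\<^bsub>?Q\<^esub> ?p x" using px by simp
        then have "?p x \<in> ?I" by (rule image_eqI) simp
        then show ?thesis using True xN by simp
      next
        case False
        then have "y \<in> ?X" using y mod_span_superset[of S R M] by auto
        then have "?p y = \<zero>\<^bsub>?Q\<^esub>" using quotient_module_eq_zero_iff[OF N XN, of y] XY by auto
        then show ?thesis using submodule_zero[OF I'] y SY by auto
      qed
    qed
    then have YV: "?Y \<subseteq> ?V" by (rule mod_span_least[OF V])
    have gen: "?I = carrier ?Q"
    proof
      show "?I \<subseteq> carrier ?Q" by (rule Q.submoduleE(1)[OF I'])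
      show "carrier ?Q \<subseteq> ?I"
      proof
        fix w assume "w \<in> carrier ?Q"
        then obtain y where y: "y \<in> carrier ?N" "w = ?p y" by (rule quotient_moduleE)
        then show "w \<in> ?I" using YV by auto
      qed
    qed
    have qx: "a \<odot>\<^bsub>?Q\<^esub> ?p x = \<zero>\<^bsub>?Q\<^esub>" if a: "a \<in> \<qq>" for a
    proof -
      have aR: "a \<in> carrier R" using a q.Icarr by simp
      have "a \<odot>\<^bsub>?Q\<^esub> ?p x = ?p (\<zero>\<^bsub>?N\<^esub>)" using mod_hom_smult[OF p aR xN] kill[OF a x] by simp
      then show ?thesis using mod_hom_zero[OF p N Q] by simp
    qed
    have ex: "short_exact R (M\<lparr>carrier := ?X\<rparr>) ?N ?Q (\<lambda>x. x) ?p" using short_exact_quotient[OF N XN] by simp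
    have gQ: "generically R \<qq> (ext_torsion_dominated R \<qq> ?Q)"
      using cyclic_domain_dichotomy[OF q Q px gen qx]
    proof
      assume "\<exists>s \<in> carrier R - \<qq>. \<forall>y \<in> carrier ?Q. s \<odot>\<^bsub>?Q\<^esub> y = \<zero>\<^bsub>?Q\<^esub>"
      then obtain s where s: "s \<in> carrier R - \<qq>" "\<forall>y \<in> carrier ?Q. s \<odot>\<^bsub>?Q\<^esub> y = \<zero>\<^bsub>?Q\<^esub>" ..
      have "ext_torsion_dominated R \<qq> ?Q (s \<otimes>\<^bsub>R\<^esub> t)" if t: "t \<in> carrier R" for t
        unfolding ext_torsion_dominated_def
      proof (intro allI impI)
        fix J m d i assume qr: "quotient_resolution R J m d"
        have k: "(s \<otimes>\<^bsub>R\<^esub> t) \<odot>\<^bsub>?Q\<^esub> y = \<zero>\<^bsub>?Q\<^esub>" if "y \<in> carrier ?Q" for y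
          using s that t Q.smult_assoc1[of s t y] by simp
        show "quotient_resolution.ext_torsion R m d (s \<otimes>\<^bsub>R\<^esub> t) ?Q i"
          by (rule quotient_resolution.ext_torsion_killed[OF qr Q _ k]) (use s t in auto)
      qed
      then show ?thesis unfolding generically_def using s(1) by blast
    next
      assume iso: "mod_iso R (cyclic R \<qq>) ?Q"
      have "ext_torsion_dominated R \<qq> ?Q s" if "s \<in> carrier R" for s
        using quotient_resolution.ext_torsion_iso[OF _ iso cyclic_module[OF R I] Q that] unfolding ext_torsion_dominated_def by blast
      then show ?thesis using primeideal_one_notin[OF q] unfolding generically_def by auto
    qed
    have gX: "generically R \<qq> (ext_torsion_dominated R \<qq> (M\<lparr>carrier := ?X\<rparr>))" using insert by simp
    show ?case
    proof (rule generically_mono[OF generically_conj[OF q gX gQ] _ R])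
      fix s assume s: "s \<in> carrier R" and P: "ext_torsion_dominated R \<qq> (M\<lparr>carrier := ?X\<rparr>) s \<and> ext_torsion_dominated R \<qq> ?Q s"
      show "ext_torsion_dominated R \<qq> ?N s"
        unfolding ext_torsion_dominated_def
      proof (intro allI impI)
        fix J m d i assume qr: "quotient_resolution R J m d"
          and A: "quotient_resolution.ext_torsion R m d s (cyclic R \<qq>) i"
        show "quotient_resolution.ext_torsion R m d s ?N i"
          using quotient_resolution.ext_torsion_middle[OF qr ex s] P qr A unfolding ext_torsion_dominated_def by blast
      qed
    qed
  qed
  moreover obtain S where "finite S" "S \<subseteq> carrier M" "mod_span R M S = carrier M"
    using fg by (auto simp: fin_gen_def)
  ultimately have "generically R \<qq> (ext_torsion_dominated R \<qq> (M\<lparr>carrier := carrier M\<rparr>))" by metis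
  then show ?thesis by simp
qed

text \<open>
  Conversely, if no element outside \<open>\<qq>\<close> kills \<open>M\<close>, then \<open>M\<close> contains a copy of \<open>R/\<qq>\<close>, and the
  quotient is controlled by \<open>ext_torsion_of_domain\<close> in lower degrees.
\<close>

lemma domain_ext_torsion_of_module:
  assumes q: "primeideal \<qq> R" and M: "module R M" and fg: "fin_gen R M"
    and kill: "\<And>a x. a \<in> \<qq> \<Longrightarrow> x \<in> carrier M \<Longrightarrow> a \<odot>\<^bsub>M\<^esub> x = \<zero>\<^bsub>M\<^esub>"
    and non: "\<not> generically R \<qq> (\<lambda>s. \<forall>x \<in> carrier M. s \<odot>\<^bsub>M\<^esub> x = \<zero>\<^bsub>M\<^esub>)"
  shows "generically R \<qq> (\<lambda>s. \<forall>J m d i. quotient_resolution R J m d \<longrightarrow>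
    quotient_resolution.ext_torsion R m d s M i \<longrightarrow>
    (\<forall>j. i = Suc j \<longrightarrow> quotient_resolution.ext_torsion R m d s (cyclic R \<qq>) j) \<longrightarrow>
    quotient_resolution.ext_torsion R m d s (cyclic R \<qq>) i)" (is "generically R \<qq> ?P")
proof -
  interpret M: module R M by fact
  interpret q: primeideal \<qq> R by fact
  note R = M.is_cring and I = q.is_ideal
  obtain S where S: "finite S" "S \<subseteq> carrier M" "mod_span R M S = carrier M"
    using fg by (auto simp: fin_gen_def)
  have hom: "(\<lambda>x. s \<odot>\<^bsub>M\<^esub> x) \<in> mod_hom R M M" if "s \<in> carrier R" for s
    by (rule mod_hom_scale[OF mod_hom_id M M that])
  have "\<exists>x \<in> S. \<forall>s \<in> carrier R - \<qq>. s \<odot>\<^bsub>M\<^esub> x \<noteq> \<zero>\<^bsub>M\<^esub>"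
  proof (rule ccontr)
    assume *: "\<not> ?thesis"
    have "generically R \<qq> (\<lambda>s. s \<odot>\<^bsub>M\<^esub> x = \<zero>\<^bsub>M\<^esub>)" if x: "x \<in> S" for x
    proof -
      obtain s where s: "s \<in> carrier R - \<qq>" "s \<odot>\<^bsub>M\<^esub> x = \<zero>\<^bsub>M\<^esub>" using * x by auto
      have "(s \<otimes>\<^bsub>R\<^esub> t) \<odot>\<^bsub>M\<^esub> x = \<zero>\<^bsub>M\<^esub>" if t: "t \<in> carrier R" for t
      proof -
        have "(s \<otimes>\<^bsub>R\<^esub> t) \<odot>\<^bsub>M\<^esub> x = t \<odot>\<^bsub>M\<^esub> (s \<odot>\<^bsub>M\<^esub> x)"
          using M.smult_assoc1[of t s x] M.R.m_comm[of s t] s t x S(2) by auto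
        then show ?thesis using s t by simp
      qed
      then show ?thesis unfolding generically_def using s(1) by blast
    qed
    from generically_ball_finite[OF q S(1) this]
    have "generically R \<qq> (\<lambda>s. \<forall>x \<in> carrier M. s \<odot>\<^bsub>M\<^esub> x = \<zero>\<^bsub>M\<^esub>)"
    proof (rule generically_mono[OF _ _ R])
      fix s assume s: "s \<in> carrier R" "\<forall>x\<in>S. s \<odot>\<^bsub>M\<^esub> x = \<zero>\<^bsub>M\<^esub>"
      have "mod_span R M S \<subseteq> mod_ker M M (\<lambda>x. s \<odot>\<^bsub>M\<^esub> x)"
        using s S(2) by (intro mod_span_least mod_ker_submodule[OF hom M M]) (auto simp: mod_ker_def)
      then show "\<forall>x \<in> carrier M. s \<odot>\<^bsub>M\<^esub> x = \<zero>\<^bsub>M\<^esub>" unfolding S(3) by (auto simp: mod_ker_def)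
    qed
    then show False using non by simp
  qed
  then obtain x where x: "x \<in> carrier M" and xn: "\<And>s. s \<in> carrier R - \<qq> \<Longrightarrow> s \<odot>\<^bsub>M\<^esub> x \<noteq> \<zero>\<^bsub>M\<^esub>"
    using S(2) by blast
  have c: "(\<lambda>a. a \<odot>\<^bsub>M\<^esub> x) \<in> mod_hom R (self_module R) M"
    using x by (intro mod_homI) (simp_all add: M.smult_l_distr M.smult_assoc1)
  interpret S: module R "self_module R" by (rule self_module_module[OF R])
  let ?C = "(\<lambda>a. a \<odot>\<^bsub>M\<^esub> x) ` carrier R"
  have C: "submodule ?C R M"
    using submodule_image[OF c S.module_axioms M S.carrier_is_submodule] by simp
  let ?N = "M\<lparr>carrier := ?C\<rparr>" and ?Q = "quotient_module M ?C"
  have N: "module R ?N" by (rule module_restrict[OF M C])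
  have Q: "module R ?Q" by (rule quotient_module_module[OF M C])
  have ex: "short_exact R ?N M ?Q (\<lambda>x. x) (\<lambda>y. ?C +>\<^bsub>M\<^esub> y)" by (rule short_exact_quotient[OF M C])
  have xC: "x \<in> ?C" by (rule image_eqI[of _ _ "\<one>\<^bsub>R\<^esub>"]) (use x in simp_all)
  have iso: "mod_iso R (cyclic R \<qq>) ?N"
  proof -
    have "\<not> (\<exists>s \<in> carrier R - \<qq>. \<forall>y \<in> carrier ?N. s \<odot>\<^bsub>?N\<^esub> y = \<zero>\<^bsub>?N\<^esub>)"
    proof
      assume "\<exists>s \<in> carrier R - \<qq>. \<forall>y \<in> carrier ?N. s \<odot>\<^bsub>?N\<^esub> y = \<zero>\<^bsub>?N\<^esub>"
      then obtain s where s: "s \<in> carrier R - \<qq>" "\<forall>y \<in> carrier ?N. s \<odot>\<^bsub>?N\<^esub> y = \<zero>\<^bsub>?N\<^esub>" ..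
      have "s \<odot>\<^bsub>?N\<^esub> x = \<zero>\<^bsub>?N\<^esub>" using s(2) xC by (elim bspec) simp
      then show False using xn[OF s(1)] by simp
    qed
    then show ?thesis using cyclic_domain_dichotomy[OF q N, of x] xC kill[OF _ x] by auto
  qed
  have gQ: "generically R \<qq> (ext_torsion_dominated R \<qq> ?Q)"
  proof (rule ext_torsion_of_domain[OF q Q])
    show "fin_gen R ?Q"
      by (rule fin_gen_image[OF quotient_module_proj[OF M C] carrier_quotient_module[symmetric] M Q fg])
    fix a X assume a: "a \<in> \<qq>" and X: "X \<in> carrier ?Q"
    obtain y where y: "y \<in> carrier M" "X = ?C +>\<^bsub>M\<^esub> y" using X by (rule quotient_moduleE)
    have "a \<odot>\<^bsub>?Q\<^esub> X = ?C +>\<^bsub>M\<^esub> \<zero>\<^bsub>M\<^esub>"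
      using quotient_module_smult[OF M C y(1), of a] kill[OF a y(1)] y(2) q.Icarr[OF a] by simp
    then show "a \<odot>\<^bsub>?Q\<^esub> X = \<zero>\<^bsub>?Q\<^esub>" using mod_hom_zero[OF quotient_module_proj[OF M C] M Q] by simp
  qed
  show ?thesis
  proof (rule generically_mono[OF gQ _ R])
    fix s assume s: "s \<in> carrier R" and P: "ext_torsion_dominated R \<qq> ?Q s"
    show "?P s"
    proof (intro allI impI)
      fix J m d i assume qr: "quotient_resolution R J m d"
        and tM: "quotient_resolution.ext_torsion R m d s M i"
        and tA: "\<forall>j. i = Suc j \<longrightarrow> quotient_resolution.ext_torsion R m d s (cyclic R \<qq>) j"
      have "quotient_resolution.ext_torsion R m d s ?N i"
        by (rule quotient_resolution.ext_torsion_left[OF qr ex s tM]) (rule P[unfolded ext_torsion_dominated_def, rule_format, OF qr tA[rule_format]])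
      then show "quotient_resolution.ext_torsion R m d s (cyclic R \<qq>) i"
        by (rule quotient_resolution.ext_torsion_iso[OF qr mod_iso_sym[OF iso cyclic_module[OF R I]] N
              cyclic_module[OF R I] s])
    qed
  qed
qed


section \<open>Complexes whose homology is killed by \<open>\<qq>\<close>\<close>

locale killed_homology =
  fixes R :: "('a, 'r) ring_scheme" and \<qq> :: "'a set" and K :: "nat \<Rightarrow> ('a, 'k) module"
    and d :: "nat \<Rightarrow> 'k \<Rightarrow> 'k" and h :: nat
  assumes q: "primeideal \<qq> R"
    and noeth: "noetherian_module R (K j)"
    and d_hom: "d j \<in> mod_hom R (K (Suc j)) (K j)"
    and d_d: "y \<in> carrier (K (Suc (Suc j))) \<Longrightarrow> d j (d (Suc j) y) = \<zero>\<^bsub>K j\<^esub>"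
    and bounded: "h < j \<Longrightarrow> y \<in> carrier (K j) \<Longrightarrow> y = \<zero>\<^bsub>K j\<^esub>"
begin

text \<open>Cycles and boundaries; in degree zero everything is a cycle.\<close>

definition Z :: "nat \<Rightarrow> 'k set"
  where "Z j = (case j of 0 \<Rightarrow> carrier (K 0) | Suc i \<Rightarrow> mod_ker (K (Suc i)) (K i) (d i))"

definition B :: "nat \<Rightarrow> 'k set"
  where "B j = d j ` carrier (K (Suc j))"

abbreviation "ZM j \<equiv> K j\<lparr>carrier := Z j\<rparr>"
abbreviation "BM j \<equiv> K j\<lparr>carrier := B j\<rparr>"
abbreviation "H j \<equiv> quotient_module (ZM j) (B j)"

lemma K_module: "module R (K j)"
  using noeth by (simp add: noetherian_module_def)

lemma Z_submodule: "submodule (Z j) R (K j)"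
  using module.carrier_is_submodule[OF K_module] mod_ker_submodule[OF d_hom K_module K_module]
  by (cases j) (simp_all add: Z_def)

lemma B_submodule: "submodule (B j) R (K j)"
  unfolding B_def by (rule submodule_image[OF d_hom K_module K_module module.carrier_is_submodule[OF K_module]])

lemma B_subset_Z: "B j \<subseteq> Z j"
  using mod_hom_closed[OF d_hom] d_d by (cases j) (auto simp: Z_def B_def mod_ker_def)

lemma ZM_module: "module R (ZM j)" and BM_module: "module R (BM j)"
  by (rule module_restrict[OF K_module Z_submodule], rule module_restrict[OF K_module B_submodule])

lemma B_submodule_ZM: "submodule (B j) R (ZM j)"
  using B_submodule B_subset_Z submodule_restrict_iff[OF K_module Z_submodule] by blast

lemma H_module: "module R (H j)"
  by (rule quotient_module_module[OF ZM_module B_submodule_ZM])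

lemma exact_H: "short_exact R (BM j) (ZM j) (H j) (\<lambda>x. x) (\<lambda>x. B j +>\<^bsub>ZM j\<^esub> x)"
  using short_exact_quotient[OF ZM_module B_submodule_ZM] by simp

lemma exact_B: "short_exact R (ZM (Suc j)) (K (Suc j)) (BM j) (\<lambda>x. x) (d j)"
proof -
  have "short_exact R (K (Suc j)\<lparr>carrier := mod_ker (K (Suc j)) (BM j) (d j)\<rparr>) (K (Suc j)) (BM j) (\<lambda>x. x) (d j)"
    by (rule short_exact_kernel[OF mod_hom_corestrict[OF d_hom] K_module BM_module]) (auto simp: B_def)
  then show ?thesis by (simp add: Z_def mod_ker_def)
qed

lemma H_fin_gen: "fin_gen R (H j)"
proof (rule fin_gen_image[OF quotient_module_proj[OF ZM_module B_submodule_ZM] carrier_quotient_module[symmetric] ZM_module H_module])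
  show "fin_gen R (ZM j)" using noeth Z_submodule by (simp add: noetherian_module_def)
qed

lemma H_kill_iff:
  assumes "a \<in> carrier R"
  shows "(\<forall>X \<in> carrier (H j). a \<odot>\<^bsub>H j\<^esub> X = \<zero>\<^bsub>H j\<^esub>) \<longleftrightarrow> (\<forall>z \<in> Z j. a \<odot>\<^bsub>K j\<^esub> z \<in> B j)"
proof -
  have "a \<odot>\<^bsub>H j\<^esub> (B j +>\<^bsub>ZM j\<^esub> z) = \<zero>\<^bsub>H j\<^esub> \<longleftrightarrow> a \<odot>\<^bsub>K j\<^esub> z \<in> B j" if z: "z \<in> Z j" for z
  proof -
    have "a \<odot>\<^bsub>K j\<^esub> z \<in> Z j" by (rule module.submoduleE(4)[OF K_module Z_submodule assms z])
    then show ?thesis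
      using quotient_module_smult[OF ZM_module B_submodule_ZM, of z j a]
        quotient_module_eq_zero_iff[OF ZM_module B_submodule_ZM, of "a \<odot>\<^bsub>K j\<^esub> z" j] z assms by simp
  qed
  then show ?thesis by (simp add: carrier_quotient_module)
qed

text \<open>
  This is where a bound on \<open>Ext\<^sup>i(R/J, R/\<qq>)\<close> comes from. Let \<open>m\<close> be the largest degree in which
  the homology is not killed by an element outside \<open>\<qq>\<close>. Above \<open>m\<close> the complex is generically
  exact, so it resolves the boundaries \<open>B m\<close>, and their Ext modules are torsion in the degrees
  below \<open>g - (h - m - 1)\<close> if those of the terms are torsion below \<open>g\<close>. If the Ext modules of \<open>R/\<qq>\<close> are torsion in degrees below \<open>i\<close>,
  then those of all homology modules are, and climbing up the complex from degree zero gives the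
  same for the cycles \<open>Z m\<close> in degree \<open>i\<close>. Hence the Ext module of \<open>H m = Z m/B m\<close> is torsion in
  degree \<open>i\<close>, and so is that of \<open>R/\<qq>\<close>, of which \<open>H m\<close> contains a copy. Induction on \<open>i\<close> does the rest.
\<close>

lemma generic_ext_torsion:
  assumes kill: "\<And>a j z. a \<in> \<qq> \<Longrightarrow> z \<in> Z j \<Longrightarrow> a \<odot>\<^bsub>K j\<^esub> z \<in> B j"
    and non: "\<And>s. s \<in> carrier R - \<qq> \<Longrightarrow> \<exists>z \<in> Z 0. s \<odot>\<^bsub>K 0\<^esub> z \<notin> B 0"
  shows "\<exists>s \<in> carrier R - \<qq>. \<forall>J m \<delta> g. quotient_resolution R J m \<delta> \<longrightarrow>
    (\<forall>j. \<forall>i<g. quotient_resolution.ext_torsion R m \<delta> s (K j) i) \<longrightarrow>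
    (\<forall>i. i + h < g \<longrightarrow> quotient_resolution.ext_torsion R m \<delta> s (cyclic R \<qq>) i)"
proof -
  interpret q: primeideal \<qq> R by (rule q)
  interpret K0: module R "K 0" by (rule K_module)
  note R = q.is_cring
  have Hk: "a \<odot>\<^bsub>H j\<^esub> X = \<zero>\<^bsub>H j\<^esub>" if "a \<in> \<qq>" "X \<in> carrier (H j)" for a j X
    using H_kill_iff[OF q.Icarr[OF that(1)]] kill[OF that(1)] that(2) by blast
  define dead where "dead j \<longleftrightarrow> generically R \<qq> (\<lambda>s. \<forall>X \<in> carrier (H j). s \<odot>\<^bsub>H j\<^esub> X = \<zero>\<^bsub>H j\<^esub>)" for j
  have "\<not> dead 0"
  proof
    assume "dead 0"
    then obtain s where s: "s \<in> carrier R - \<qq>" "\<forall>X \<in> carrier (H 0). s \<odot>\<^bsub>H 0\<^esub> X = \<zero>\<^bsub>H 0\<^esub>"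
      unfolding dead_def by (rule generically_obtain[OF q])
    then show False using non[OF s(1)] H_kill_iff[of s 0] by auto
  qed
  define m where "m = Max {j. j \<le> h \<and> \<not> dead j}"
  have fin: "finite {j. j \<le> h \<and> \<not> dead j}" and ne: "{j. j \<le> h \<and> \<not> dead j} \<noteq> {}"
    using \<open>\<not> dead 0\<close> by auto
  have m: "m \<le> h" "\<not> dead m" using Max_in[OF fin ne] by (auto simp: m_def)
  have above: "dead j" if "m < j" "j \<le> h" for j using Max_ge[OF fin, of j] that by (auto simp: m_def[symmetric])
  have g1: "generically R \<qq> (\<lambda>s. \<forall>j\<in>{..h}. ext_torsion_dominated R \<qq> (H j) s)"
    by (rule generically_ball_finite[OF q]) (auto intro: ext_torsion_of_domain[OF q H_module H_fin_gen Hk])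
  have g2: "generically R \<qq> (\<lambda>s. \<forall>j\<in>{m<..h}. \<forall>X \<in> carrier (H j). s \<odot>\<^bsub>H j\<^esub> X = \<zero>\<^bsub>H j\<^esub>)"
    by (rule generically_ball_finite[OF q]) (use above in \<open>auto simp: dead_def\<close>)
  note g3 = domain_ext_torsion_of_module[OF q H_module H_fin_gen Hk m(2)[unfolded dead_def]]
  from generically_conj[OF q g1 generically_conj[OF q g2 g3]]
  obtain s where s: "s \<in> carrier R - \<qq>" and
    s12: "(\<forall>j\<in>{..h}. ext_torsion_dominated R \<qq> (H j) s) \<and>
      (\<forall>j\<in>{m<..h}. \<forall>X \<in> carrier (H j). s \<odot>\<^bsub>H j\<^esub> X = \<zero>\<^bsub>H j\<^esub>) \<and>
      (\<forall>J ma \<delta> i. quotient_resolution R J ma \<delta> \<longrightarrow>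
        quotient_resolution.ext_torsion R ma \<delta> s (H m) i \<longrightarrow>
        (\<forall>j. i = Suc j \<longrightarrow> quotient_resolution.ext_torsion R ma \<delta> s (cyclic R \<qq>) j) \<longrightarrow>
        quotient_resolution.ext_torsion R ma \<delta> s (cyclic R \<qq>) i)"
    by (rule generically_obtain[OF q]) blast
  have sR: "s \<in> carrier R" using s by simp
  have "quotient_resolution.ext_torsion R ma \<delta> s (cyclic R \<qq>) i"
    if qr: "quotient_resolution R J ma \<delta>" and i: "i + h < g"
      and tK: "\<And>j i. i < g \<Longrightarrow> quotient_resolution.ext_torsion R ma \<delta> s (K j) i" for J ma \<delta> g i
    using i
  proof (induction i rule: less_induct)
    case (less i)
    interpret qr: quotient_resolution R J ma \<delta> by (rule qr)
    have tA: "qr.ext_torsion s (cyclic R \<qq>) k" if "k < i" for k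
      using less.IH[OF that] that less.prems by simp
    have tH: "qr.ext_torsion s (H j) k" if "k < i" "j \<le> h" for k j
      using s12 tA[OF that(1)] that(2) qr unfolding ext_torsion_dominated_def by blast
    \<comment> \<open>From below: torsion of the cycles in degrees up to \<open>i\<close> persists from each step to the next.\<close>
    have low: "qr.ext_torsion s (ZM j) k" if "k \<le> i" "j \<le> h" for j k
      using that
    proof (induction j arbitrary: k)
      case 0
      then show ?case using tK[of k 0] less.prems by (simp add: Z_def)
    next
      case (Suc j)
      have "qr.ext_torsion s (BM j) l" if l: "k = Suc l" for l
      proof (rule qr.ext_torsion_left[OF exact_H sR])
        show "qr.ext_torsion s (ZM j) l" using Suc l by simp
        show "qr.ext_torsion s (H j) l'" if "l = Suc l'" for l' using Suc(2,3) l that by (intro tH) simp_all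
      qed
      moreover have "qr.ext_torsion s (K (Suc j)) k" using Suc(2) less.prems by (intro tK) simp
      ultimately show ?case by (intro qr.ext_torsion_left[OF exact_B sR])
    qed
    \<comment> \<open>From above: the complex is generically exact there, and each step down costs a degree.\<close>
    have high: "qr.ext_torsion s (BM j) k" if "m \<le> j" "j \<le> h" "k + h < g + j + 1" for j k
      using that(2,1,3)
    proof (induction j arbitrary: k rule: inc_induct)
      case base
      have "B h = {\<zero>\<^bsub>K h\<^esub>}"
        using bounded[of "Suc h"] submodule_zero[OF B_submodule, of h] mod_hom_zero[OF d_hom K_module K_module, of h]
        unfolding B_def by auto
      then show ?case
        using module.smult_r_null[OF K_module sR] by (intro qr.ext_torsion_killed[OF BM_module sR]) simp
    next
      case (step j)
      have "\<forall>X \<in> carrier (H (Suc j)). s \<odot>\<^bsub>H (Suc j)\<^esub> X = \<zero>\<^bsub>H (Suc j)\<^esub>"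
        using s12 step by simp
      then have tH': "qr.ext_torsion s (H (Suc j)) (Suc k)"
        by (intro qr.ext_torsion_killed[OF H_module sR]) simp
      have "qr.ext_torsion s (BM (Suc j)) (Suc k)" using step by simp
      then have tZ: "qr.ext_torsion s (ZM (Suc j)) (Suc k)" by (rule qr.ext_torsion_middle[OF exact_H sR _ tH'])
      have "qr.ext_torsion s (K (Suc j)) k" using step by (intro tK) simp
      then show ?case by (rule qr.ext_torsion_right[OF exact_B sR _ tZ])
    qed
    have "qr.ext_torsion s (H m) i"
      by (rule qr.ext_torsion_right[OF exact_H sR low high]) (use m less.prems in simp_all)
    then show ?case using s12 qr tA by blast
  qed
  with s show ?thesis by blast
qed

end


section \<open>The Koszul complex\<close>

text \<open>
  The exterior algebra on generators \<open>e\<^sub>0, \<dots>, e\<^sub>h\<^sub>-\<^sub>1\<close> is the free module on the subsets of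
  \<open>{..<h}\<close>. An element for \<open>Suc h\<close> is \<open>a + b e\<^sub>h\<close> with \<open>a\<close>, \<open>b\<close> not involving \<open>e\<^sub>h\<close>, and the Koszul
  differential maps it to \<open>d a + x\<^sub>h b - (d b) e\<^sub>h\<close>.
\<close>

abbreviation exterior :: "('a, 'r) ring_scheme \<Rightarrow> nat \<Rightarrow> ('a, nat set \<Rightarrow> 'a) module"
  where "exterior R h \<equiv> free_module R (Pow {..<h})"

definition join_parts :: "nat \<Rightarrow> (nat set \<Rightarrow> 'a) \<Rightarrow> (nat set \<Rightarrow> 'a) \<Rightarrow> nat set \<Rightarrow> 'a"
  where "join_parts h a b = (\<lambda>S. if h \<in> S then b (S - {h}) else a S)"

definition low_part :: "('a, 'r) ring_scheme \<Rightarrow> nat \<Rightarrow> (nat set \<Rightarrow> 'a) \<Rightarrow> nat set \<Rightarrow> 'a"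
  where "low_part R h z = (\<lambda>S. if h \<in> S then \<zero>\<^bsub>R\<^esub> else z S)"

definition high_part :: "('a, 'r) ring_scheme \<Rightarrow> nat \<Rightarrow> (nat set \<Rightarrow> 'a) \<Rightarrow> nat set \<Rightarrow> 'a"
  where "high_part R h z = (\<lambda>S. if h \<in> S then \<zero>\<^bsub>R\<^esub> else z (insert h S))"

lemma join_low_high: "join_parts h (low_part R h z) (high_part R h z) = z"
  by (auto simp: join_parts_def low_part_def high_part_def insert_absorb fun_eq_iff)

lemma exterior_zero: "a \<in> carrier (exterior R h) \<Longrightarrow> h \<in> S \<Longrightarrow> a S = \<zero>\<^bsub>R\<^esub>"
  by (auto simp: carrier_free_module)

lemma low_join:
  assumes "a \<in> carrier (exterior R h)" shows "low_part R h (join_parts h a b) = a"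
  using exterior_zero[OF assms] by (intro ext) (simp add: join_parts_def low_part_def)

lemma high_join:
  assumes "b \<in> carrier (exterior R h)" shows "high_part R h (join_parts h a b) = b"
  using exterior_zero[OF assms] by (intro ext) (simp add: join_parts_def high_part_def)

lemma Pow_Suc_not_subset:
  "h \<notin> S \<Longrightarrow> \<not> S \<subseteq> {..<h} \<Longrightarrow> \<not> S \<subseteq> {..<Suc h}"
  "\<not> S \<subseteq> {..<Suc h} \<Longrightarrow> \<not> S \<subseteq> {..<h}"
  "\<not> S \<subseteq> {..<Suc h} \<Longrightarrow> \<not> S - {h} \<subseteq> {..<h}"
  by (auto simp: less_Suc_eq)

lemma join_carrier:
  assumes "cring R" "a \<in> carrier (exterior R h)" "b \<in> carrier (exterior R h)"
  shows "join_parts h a b \<in> carrier (exterior R (Suc h))"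
  using assms(2,3) Pow_Suc_not_subset(2,3)
  by (simp add: carrier_free_module'[OF assms(1)] join_parts_def)

lemma low_hom:
  assumes "cring R" shows "low_part R h \<in> mod_hom R (exterior R (Suc h)) (exterior R h)"
proof -
  interpret cring R by fact
  show ?thesis using Pow_Suc_not_subset(1)
    by (intro mod_homI) (simp_all add: low_part_def carrier_free_module'[OF assms] fun_eq_iff)
qed

lemma high_hom:
  assumes "cring R" shows "high_part R h \<in> mod_hom R (exterior R (Suc h)) (exterior R h)"
proof -
  interpret cring R by fact
  show ?thesis using Pow_Suc_not_subset(1)
    by (intro mod_homI) (simp_all add: high_part_def carrier_free_module'[OF assms] fun_eq_iff)
qed

lemma join_add:
  "join_parts h a b \<oplus>\<^bsub>exterior R k\<^esub> join_parts h a' b' =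
    join_parts h (a \<oplus>\<^bsub>exterior R h\<^esub> a') (b \<oplus>\<^bsub>exterior R h\<^esub> b')"
  by (auto simp: join_parts_def)

lemma join_smult:
  "r \<odot>\<^bsub>exterior R k\<^esub> join_parts h a b = join_parts h (r \<odot>\<^bsub>exterior R h\<^esub> a) (r \<odot>\<^bsub>exterior R h\<^esub> b)"
  by (auto simp: join_parts_def)

lemma join_hom:
  assumes R: "cring R" and f: "f \<in> mod_hom R M (exterior R h)" and g: "g \<in> mod_hom R M (exterior R h)"
  shows "(\<lambda>z. join_parts h (f z) (g z)) \<in> mod_hom R M (exterior R (Suc h))"
  by (rule mod_homI)
    (simp_all only: join_carrier[OF R mod_hom_closed[OF f] mod_hom_closed[OF g]] mod_hom_add[OF f]
      mod_hom_add[OF g] mod_hom_smult[OF f] mod_hom_smult[OF g] join_add join_smult)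

text \<open>Infinite sets are excluded because their \<open>card\<close> is \<open>0\<close>.\<close>

definition has_degree :: "('a, 'r) ring_scheme \<Rightarrow> nat \<Rightarrow> (nat set \<Rightarrow> 'a) \<Rightarrow> bool"
  where "has_degree R j z \<longleftrightarrow> (\<forall>S. finite S \<longrightarrow> card S \<noteq> j \<longrightarrow> z S = \<zero>\<^bsub>R\<^esub>)"

text \<open>Degree \<open>j - 1\<close>, which means zero for \<open>j = 0\<close>.\<close>

definition has_degree_below :: "('a, 'r) ring_scheme \<Rightarrow> nat \<Rightarrow> (nat set \<Rightarrow> 'a) \<Rightarrow> bool"
  where "has_degree_below R j z \<longleftrightarrow> (\<forall>S. finite S \<longrightarrow> Suc (card S) \<noteq> j \<longrightarrow> z S = \<zero>\<^bsub>R\<^esub>)"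

lemma low_degree: "has_degree R j z \<Longrightarrow> has_degree R j (low_part R h z)"
  by (simp add: has_degree_def low_part_def)

lemma high_degree: "has_degree R j z \<Longrightarrow> has_degree_below R j (high_part R h z)"
  by (auto simp: has_degree_def has_degree_below_def high_part_def)

lemma join_degree:
  assumes "has_degree R j a" "has_degree_below R j b" shows "has_degree R j (join_parts h a b)"
proof -
  have "b (S - {h}) = \<zero>\<^bsub>R\<^esub>" if S: "finite S" "h \<in> S" "card S \<noteq> j" for S
  proof -
    have "Suc (card (S - {h})) = card S" using S(1,2) by (metis card_Suc_Diff1)
    then show ?thesis using assms(2) S by (simp add: has_degree_below_def)
  qed
  then show ?thesis using assms(1) by (simp add: has_degree_def join_parts_def)
qed

lemma join_degree_below:
  assumes "has_degree_below R j a" "\<And>i. j = Suc i \<Longrightarrow> has_degree_below R i b" "j = 0 \<Longrightarrow> b = (\<lambda>S. \<zero>\<^bsub>R\<^esub>)"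
  shows "has_degree_below R j (join_parts h a b)"
proof (cases j)
  case 0
  then show ?thesis using assms(1,3) by (auto simp: has_degree_below_def join_parts_def)
next
  case (Suc i)
  have *: "has_degree_below R (Suc i) = has_degree R i" by (auto simp: has_degree_below_def has_degree_def fun_eq_iff)
  then show ?thesis using assms(1) assms(2)[OF Suc] join_degree[of R i a b h] Suc by simp
qed

text \<open>
  The homotopies \<open>E i\<close> are the multiplications by \<open>e\<^sub>i\<close>; by the third property each \<open>x i\<close> kills the
  homology.
\<close>

locale koszul_structure =
  fixes R :: "('a, 'r) ring_scheme" and x :: "nat \<Rightarrow> 'a" and h :: nat
    and D :: "(nat set \<Rightarrow> 'a) \<Rightarrow> nat set \<Rightarrow> 'a" and E :: "nat \<Rightarrow> (nat set \<Rightarrow> 'a) \<Rightarrow> nat set \<Rightarrow> 'a"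
  assumes D_hom: "D \<in> mod_hom R (exterior R h) (exterior R h)"
    and D_D: "z \<in> carrier (exterior R h) \<Longrightarrow> D (D z) = \<zero>\<^bsub>exterior R h\<^esub>"
    and E_hom: "i < h \<Longrightarrow> E i \<in> mod_hom R (exterior R h) (exterior R h)"
    and homotopy: "i < h \<Longrightarrow> z \<in> carrier (exterior R h) \<Longrightarrow>
      D (E i z) \<oplus>\<^bsub>exterior R h\<^esub> E i (D z) = x i \<odot>\<^bsub>exterior R h\<^esub> z"
    and D_degree: "z \<in> carrier (exterior R h) \<Longrightarrow> has_degree R j z \<Longrightarrow> has_degree_below R j (D z)"
    and E_degree: "i < h \<Longrightarrow> z \<in> carrier (exterior R h) \<Longrightarrow> has_degree R j z \<Longrightarrow> has_degree R (Suc j) (E i z)"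
    and D_augmentation: "z \<in> carrier (exterior R h) \<Longrightarrow> ideal A R \<Longrightarrow> x ` {..<h} \<subseteq> A \<Longrightarrow> D z {} \<in> A"

lemma koszul_exists:
  assumes R: "cring R" and x: "\<And>i. x i \<in> carrier R"
  shows "\<exists>D E. koszul_structure R x h D E"
proof (induction h)
  case 0
  let ?X = "exterior R 0"
  interpret X: module R ?X by (rule free_module_module[OF R])
  have "koszul_structure R x 0 (\<lambda>z. \<zero>\<^bsub>?X\<^esub>) (\<lambda>i z. z)"
  proof (rule koszul_structure.intro)
    show "(\<lambda>z. \<zero>\<^bsub>?X\<^esub>) \<in> mod_hom R ?X ?X" by (rule mod_hom_zero_map[OF X.module_axioms])
    show "\<zero>\<^bsub>?X\<^esub> {} \<in> A" if "ideal A R" for A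
      using additive_subgroup.zero_closed[OF ideal.axioms(1)[OF that]] by simp
  qed (simp_all add: has_degree_below_def)
  then show ?case by (intro exI)
next
  case (Suc h)
  then obtain D E where DE: "koszul_structure R x h D E" by blast
  let ?X = "exterior R h" and ?Y = "exterior R (Suc h)"
  have X: "module R ?X" and Y: "module R ?Y" by (rule free_module_module[OF R])+
  interpret X: module R ?X by (rule X)
  interpret Y: module R ?Y by (rule Y)
  interpret k: koszul_structure R x h D E by (rule DE)
  note D = k.D_hom and DD = k.D_D and E = k.E_hom and hom = k.homotopy and degD = k.D_degree
    and degE = k.E_degree and aug = k.D_augmentation
  let ?l = "low_part R h" and ?u = "high_part R h"
  note l = low_hom[OF R, of h] and u = high_hom[OF R, of h]
  note lc = mod_hom_closed[OF l] and uc = mod_hom_closed[OF u]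
  note Dc = mod_hom_closed[OF D] and Ec = mod_hom_closed[OF E]
  let ?D = "\<lambda>z. join_parts h (D (?l z) \<oplus>\<^bsub>?X\<^esub> x h \<odot>\<^bsub>?X\<^esub> ?u z) (\<ominus>\<^bsub>?X\<^esub> D (?u z))"
  let ?E = "\<lambda>i z. if i < h then join_parts h (E i (?l z)) (\<ominus>\<^bsub>?X\<^esub> E i (?u z)) else join_parts h \<zero>\<^bsub>?X\<^esub> (?l z)"
  have neg: "(\<lambda>z. \<ominus>\<^bsub>?X\<^esub> z) \<in> mod_hom R ?X ?X"
    by (rule mod_homI) (simp_all add: X.minus_add X.smult_r_minus X.a_comm del: free_module_simps)
  have Dh: "?D \<in> mod_hom R ?Y ?Y"
    by (rule join_hom[OF R mod_hom_sum[OF mod_hom_comp[OF l D] mod_hom_scale[OF u Y X x] Y X]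
          mod_hom_comp[OF mod_hom_comp[OF u D] neg]])
  have lD: "?l (?D z) = D (?l z) \<oplus>\<^bsub>?X\<^esub> x h \<odot>\<^bsub>?X\<^esub> ?u z" if "z \<in> carrier ?Y" for z
    by (rule low_join) (use that lc uc Dc x in \<open>simp del: free_module_simps\<close>)
  have uD: "?u (?D z) = \<ominus>\<^bsub>?X\<^esub> D (?u z)" if "z \<in> carrier ?Y" for z
    by (rule high_join) (use that lc uc Dc x in \<open>simp del: free_module_simps\<close>)
  have Dneg: "D (\<ominus>\<^bsub>?X\<^esub> z) = \<ominus>\<^bsub>?X\<^esub> D z" if "z \<in> carrier ?X" for z by (rule mod_hom_uminus[OF D X X that])
  have Eneg: "E i (\<ominus>\<^bsub>?X\<^esub> z) = \<ominus>\<^bsub>?X\<^esub> E i z" if "i < h" "z \<in> carrier ?X" for i z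
    by (rule mod_hom_uminus[OF E[OF that(1)] X X that(2)])
  have DDz: "?D (?D z) = \<zero>\<^bsub>?Y\<^esub>" if z: "z \<in> carrier ?Y" for z
  proof -
    have "D (?l (?D z)) \<oplus>\<^bsub>?X\<^esub> x h \<odot>\<^bsub>?X\<^esub> ?u (?D z) = \<zero>\<^bsub>?X\<^esub>"
      unfolding lD[OF z] uD[OF z]
      using z lc uc Dc x
      by (simp add: mod_hom_add[OF D] mod_hom_smult[OF D] DD X.smult_r_minus X.r_neg del: free_module_simps)
    moreover have "\<ominus>\<^bsub>?X\<^esub> D (?u (?D z)) = \<zero>\<^bsub>?X\<^esub>"
      unfolding uD[OF z] using z uc Dc by (simp add: Dneg DD del: free_module_simps)
    ultimately have "?D (?D z) = join_parts h \<zero>\<^bsub>?X\<^esub> \<zero>\<^bsub>?X\<^esub>" by simp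
    then show ?thesis by (simp add: join_parts_def)
  qed
  have Eh: "?E i \<in> mod_hom R ?Y ?Y" if "i < Suc h" for i
  proof (cases "i < h")
    case True
    have "(\<lambda>z. join_parts h (E i (?l z)) (\<ominus>\<^bsub>?X\<^esub> E i (?u z))) \<in> mod_hom R ?Y ?Y"
      by (rule join_hom[OF R mod_hom_comp[OF l E[OF True]] mod_hom_comp[OF mod_hom_comp[OF u E[OF True]] neg]])
    then show ?thesis using True by simp
  next
    case False
    have "(\<lambda>z. join_parts h \<zero>\<^bsub>?X\<^esub> (?l z)) \<in> mod_hom R ?Y ?Y"
      by (rule join_hom[OF R mod_hom_zero_map[OF X] l])
    then show ?thesis using False by simp
  qed
  have homot: "?D (?E i z) \<oplus>\<^bsub>?Y\<^esub> ?E i (?D z) = x i \<odot>\<^bsub>?Y\<^esub> z" if i: "i < Suc h" and z: "z \<in> carrier ?Y" for i z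
  proof (cases "i < h")
    case True
    note c = lc[OF z] uc[OF z]
    have lE: "?l (?E i z) = E i (?l z)" and uE: "?u (?E i z) = \<ominus>\<^bsub>?X\<^esub> E i (?u z)"
      using True low_join[OF Ec[OF True c(1)]] high_join[OF X.a_inv_closed[OF Ec[OF True c(2)]]] by simp_all
    have "D (?l (?E i z)) \<oplus>\<^bsub>?X\<^esub> x h \<odot>\<^bsub>?X\<^esub> ?u (?E i z) \<oplus>\<^bsub>?X\<^esub> E i (?l (?D z)) = x i \<odot>\<^bsub>?X\<^esub> ?l z"
    proof -
      have w: "x h \<odot>\<^bsub>?X\<^esub> E i (?u z) \<in> carrier ?X" "D (E i (?l z)) \<in> carrier ?X" "E i (D (?l z)) \<in> carrier ?X"
        using c Ec[OF True] Dc x by (auto simp del: free_module_simps)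
      have "D (?l (?E i z)) \<oplus>\<^bsub>?X\<^esub> x h \<odot>\<^bsub>?X\<^esub> ?u (?E i z) \<oplus>\<^bsub>?X\<^esub> E i (?l (?D z)) =
        (D (E i (?l z)) \<oplus>\<^bsub>?X\<^esub> \<ominus>\<^bsub>?X\<^esub> (x h \<odot>\<^bsub>?X\<^esub> E i (?u z))) \<oplus>\<^bsub>?X\<^esub> (E i (D (?l z)) \<oplus>\<^bsub>?X\<^esub> x h \<odot>\<^bsub>?X\<^esub> E i (?u z))"
        unfolding lE uE lD[OF z] using c Ec[OF True] Dc x
        by (simp add: mod_hom_add[OF E[OF True]] mod_hom_smult[OF E[OF True]] X.smult_r_minus del: free_module_simps)
      also have "\<dots> = D (E i (?l z)) \<oplus>\<^bsub>?X\<^esub> E i (D (?l z))"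
        using w by (simp add: X.a_assoc X.a_comm[of "E i (D (?l z))"] X.r_neg2[OF w(1)] X.r_neg1[OF w(1)] del: free_module_simps)
      finally show ?thesis using hom[OF True c(1)] by simp
    qed
    moreover have "\<ominus>\<^bsub>?X\<^esub> D (?u (?E i z)) \<oplus>\<^bsub>?X\<^esub> \<ominus>\<^bsub>?X\<^esub> E i (?u (?D z)) = x i \<odot>\<^bsub>?X\<^esub> ?u z"
      unfolding uE uD[OF z] using c Ec[OF True] Dc hom[OF True c(2)]
      by (simp add: Dneg Eneg[OF True] del: free_module_simps)
    ultimately have "?D (?E i z) \<oplus>\<^bsub>?Y\<^esub> ?E i (?D z) = join_parts h (x i \<odot>\<^bsub>?X\<^esub> ?l z) (x i \<odot>\<^bsub>?X\<^esub> ?u z)"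
      using True unfolding join_add[where R = R and k = "Suc h" and h = h] by (simp add: join_add[where R = R and k = "Suc h" and h = h] del: free_module_simps)
    then show ?thesis by (simp only: join_smult[where R = R and k = "Suc h" and h = h, symmetric] join_low_high)
  next
    case False
    then have ih: "i = h" using i by simp
    note c = lc[OF z] uc[OF z]
    have lE: "?l (?E i z) = \<zero>\<^bsub>?X\<^esub>" and uE: "?u (?E i z) = ?l z"
      using False low_join[OF X.zero_closed] high_join[OF c(1)] by (simp_all del: free_module_simps)
    have "?D (?E i z) \<oplus>\<^bsub>?Y\<^esub> ?E i (?D z) =
      join_parts h (D \<zero>\<^bsub>?X\<^esub> \<oplus>\<^bsub>?X\<^esub> x h \<odot>\<^bsub>?X\<^esub> ?l z \<oplus>\<^bsub>?X\<^esub> \<zero>\<^bsub>?X\<^esub>)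
        (\<ominus>\<^bsub>?X\<^esub> D (?l z) \<oplus>\<^bsub>?X\<^esub> (D (?l z) \<oplus>\<^bsub>?X\<^esub> x h \<odot>\<^bsub>?X\<^esub> ?u z))"
      unfolding lE uE using False by (simp only: if_False join_add[where R = R and k = "Suc h" and h = h] lD[OF z])
    also have "\<dots> = join_parts h (x i \<odot>\<^bsub>?X\<^esub> ?l z) (x i \<odot>\<^bsub>?X\<^esub> ?u z)"
      using c Dc x mod_hom_zero[OF D X X] ih by (simp add: X.r_neg1 del: free_module_simps)
    finally show ?thesis by (simp only: join_smult[where R = R and k = "Suc h" and h = h, symmetric] join_low_high)
  qed
  have neg0: "(\<ominus>\<^bsub>?X\<^esub> z) S = \<zero>\<^bsub>R\<^esub>" if "z \<in> carrier ?X" "z S = \<zero>\<^bsub>R\<^esub>" for z S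
  proof -
    have "\<ominus>\<^bsub>?X\<^esub> z = (\<ominus>\<^bsub>R\<^esub> \<one>\<^bsub>R\<^esub>) \<odot>\<^bsub>?X\<^esub> z" using that(1) X.smult_l_minus[of "\<one>\<^bsub>R\<^esub>" z] X.smult_one[OF that(1)] by simp
    then show ?thesis using that(2) by simp
  qed
  have Dd: "has_degree_below R j (?D z)" if z: "z \<in> carrier ?Y" and dz: "has_degree R j z" for j z
  proof (rule join_degree_below)
    note c = lc[OF z] uc[OF z]
    have ud: "has_degree_below R j (?u z)" by (rule high_degree[OF dz])
    show "has_degree_below R j (D (?l z) \<oplus>\<^bsub>?X\<^esub> x h \<odot>\<^bsub>?X\<^esub> ?u z)"
      using degD[OF c(1) low_degree[OF dz]] ud x by (simp add: has_degree_below_def)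
    show "has_degree_below R i (\<ominus>\<^bsub>?X\<^esub> D (?u z))" if "j = Suc i" for i
    proof -
      have "has_degree R i (?u z)" using ud that by (simp add: has_degree_below_def has_degree_def)
      then have "has_degree_below R i (D (?u z))" by (rule degD[OF c(2)])
      then show ?thesis using neg0[OF Dc[OF c(2)]] by (simp add: has_degree_below_def)
    qed
    show "\<ominus>\<^bsub>?X\<^esub> D (?u z) = (\<lambda>S. \<zero>\<^bsub>R\<^esub>)" if "j = 0"
    proof -
      have "?u z S = \<zero>\<^bsub>R\<^esub>" for S
        using ud that c(2) finite_subset[of S "{..<h}"] by (cases "S \<subseteq> {..<h}") (auto simp: has_degree_below_def carrier_free_module)
      then have "?u z = \<zero>\<^bsub>?X\<^esub>" by auto
      then show ?thesis using mod_hom_zero[OF D X X] mod_hom_zero[OF neg X X] by simp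
    qed
  qed
  have Ed: "has_degree R (Suc j) (?E i z)" if i: "i < Suc h" and z: "z \<in> carrier ?Y" and dz: "has_degree R j z" for i j z
  proof (cases "i < h")
    case True
    note c = lc[OF z] uc[OF z]
    have "has_degree_below R (Suc j) (\<ominus>\<^bsub>?X\<^esub> E i (?u z))"
    proof (cases j)
      case 0
      have "?u z S = \<zero>\<^bsub>R\<^esub>" for S
        using high_degree[OF dz, of h] 0 c(2) finite_subset[of S "{..<h}"]
        by (cases "S \<subseteq> {..<h}") (auto simp: has_degree_below_def carrier_free_module)
      then have "?u z = \<zero>\<^bsub>?X\<^esub>" by auto
      then have "\<ominus>\<^bsub>?X\<^esub> E i (?u z) = \<zero>\<^bsub>?X\<^esub>" using mod_hom_zero[OF E[OF True] X X] mod_hom_zero[OF neg X X] by simp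
      then show ?thesis by (simp add: has_degree_below_def)
    next
      case (Suc k)
      have "has_degree R k (?u z)" using high_degree[OF dz, of h] Suc by (simp add: has_degree_below_def has_degree_def)
      then have "has_degree R (Suc k) (E i (?u z))" by (rule degE[OF True c(2)])
      then show ?thesis using neg0[OF Ec[OF True c(2)]] Suc by (simp add: has_degree_below_def has_degree_def)
    qed
    then show ?thesis using True join_degree[OF degE[OF True c(1) low_degree[OF dz]]] by simp
  next
    case False
    have "has_degree_below R (Suc j) (?l z)" using low_degree[OF dz, of h] by (simp add: has_degree_below_def has_degree_def)
    then show ?thesis using False join_degree[of R "Suc j" "\<zero>\<^bsub>?X\<^esub>" "?l z" h] by (simp add: has_degree_def)
  qed
  have au: "?D z {} \<in> A" if z: "z \<in> carrier ?Y" and A: "ideal A R" "x ` {..<Suc h} \<subseteq> A" for A z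
  proof -
    interpret A: ideal A R by (rule A(1))
    have "D (?l z) {} \<in> A" by (rule aug[OF lc[OF z] A(1)]) (use A(2) in auto)
    moreover have "x h \<otimes>\<^bsub>R\<^esub> ?u z {} \<in> A" using A(2) free_module_value[OF R uc[OF z]] by (intro A.I_r_closed) auto
    ultimately show ?thesis by (simp add: join_parts_def)
  qed
  have "koszul_structure R x (Suc h) ?D ?E"
    by (rule koszul_structure.intro[OF Dh DDz Eh homot Dd Ed au])
  then show ?case by (intro exI)
qed


section \<open>A uniform bound for the vanishing of Ext\<close>

text \<open>The Koszul complex on generators of \<open>\<qq>\<close> has homology killed by \<open>\<qq>\<close>, and its zeroth homology is \<open>R/\<qq>\<close>.\<close>

lemma generic_ext_torsion_domain:
  assumes R: "cring R" and noeth: "noetherian_ring R" and q: "primeideal \<qq> R"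
  shows "\<exists>h. \<exists>s \<in> carrier R - \<qq>. \<forall>J m \<delta> g. quotient_resolution R J m \<delta> \<longrightarrow>
    (\<forall>i<g. quotient_resolution.ext_torsion R m \<delta> \<one>\<^bsub>R\<^esub> (self_module R) i) \<longrightarrow>
    (\<forall>i. i + h < g \<longrightarrow> quotient_resolution.ext_torsion R m \<delta> s (cyclic R \<qq>) i)"
proof -
  interpret q: primeideal \<qq> R by fact
  interpret N: noetherian_ring R by fact
  obtain A where A: "A \<subseteq> carrier R" "finite A" "\<qq> = Idl\<^bsub>R\<^esub> A" using N.finetely_gen[OF q.is_ideal] by blast
  define h where "h = card A"
  obtain v where v: "bij_betw v {..<h} A" using ex_bij_betw_nat_finite[OF A(2)] atLeast0LessThan h_def by metis
  define x where "x i = (if i < h then v i else \<zero>\<^bsub>R\<^esub>)" for i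
  have xA: "x ` {..<h} = A" using v by (auto simp: x_def bij_betw_def)
  have AI: "A \<subseteq> \<qq>" using A(3) q.genideal_self[OF A(1)] by simp
  have xR: "x i \<in> carrier R" for i
  proof (cases "i < h")
    case True
    then have "x i \<in> A" using xA by auto
    then show ?thesis using A(1) by auto
  qed (simp add: x_def)
  obtain D E where "koszul_structure R x h D E" using koszul_exists[where x = x and h = h, OF R xR] by blast
  then interpret k: koszul_structure R x h D E .
  define X where "X j = {S. S \<subseteq> {..<h} \<and> card S = j}" for j
  let ?T = "exterior R h" and ?K = "\<lambda>j. free_module R (X j)"
  have finX: "finite (X j)" for j by (simp add: X_def)
  have K_iff: "z \<in> carrier (?K j) \<longleftrightarrow> z \<in> carrier ?T \<and> has_degree R j z" for z j
    unfolding carrier_free_module'[OF R] has_degree_def X_def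
    using finite_subset[of _ "{..<h}"] by auto
  have below_iff: "has_degree_below R (Suc j) z \<longleftrightarrow> has_degree R j z" for j z
    by (simp add: has_degree_below_def has_degree_def)
  have Khom: "f \<in> mod_hom R (?K a) (?K b)"
    if f: "f \<in> mod_hom R ?T ?T" and deg: "\<And>z. z \<in> carrier ?T \<Longrightarrow> has_degree R a z \<Longrightarrow> has_degree R b (f z)" for f a b
  proof (rule mod_homI)
    show "f z \<in> carrier (?K b)" if "z \<in> carrier (?K a)" for z
      using that mod_hom_closed[OF f] deg by (simp add: K_iff)
    show "f (z \<oplus>\<^bsub>?K a\<^esub> w) = f z \<oplus>\<^bsub>?K b\<^esub> f w" if "z \<in> carrier (?K a)" "w \<in> carrier (?K a)" for z w
      using that mod_hom_add[OF f, of z w] by (simp add: K_iff)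
    show "f (r \<odot>\<^bsub>?K a\<^esub> z) = r \<odot>\<^bsub>?K b\<^esub> f z" if "r \<in> carrier R" "z \<in> carrier (?K a)" for r z
      using that mod_hom_smult[OF f, of r z] by (simp add: K_iff)
  qed
  have DK: "D \<in> mod_hom R (?K (Suc j)) (?K j)" for j
    by (rule Khom[OF k.D_hom]) (use k.D_degree below_iff in blast)
  have K_module: "module R (?K j)" for j by (rule free_module_module[OF R])
  interpret K: killed_homology R \<qq> ?K "\<lambda>_. D" h
  proof
    show "noetherian_module R (?K j)" for j by (rule free_module_noetherian[OF R noeth finX])
    show "D \<in> mod_hom R (?K (Suc j)) (?K j)" for j by (rule DK)
    show "D (D z) = \<zero>\<^bsub>?K j\<^esub>" if "z \<in> carrier (?K (Suc (Suc j)))" for j z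
      using k.D_D[of z] that by (simp add: K_iff)
    show "z = \<zero>\<^bsub>?K j\<^esub>" if "h < j" "z \<in> carrier (?K j)" for j z
    proof -
      have "S \<notin> X j" for S
        using that(1) card_mono[of "{..<h}" S] by (cases "S \<subseteq> {..<h}") (simp_all add: X_def)
      then show ?thesis using that(2) by (auto simp: carrier_free_module)
    qed
  qed
  have Z_D: "D z = \<zero>\<^bsub>?T\<^esub>" if z: "z \<in> K.Z j" for z j
  proof (cases j)
    case 0
    have zc: "z \<in> carrier ?T" "has_degree R 0 z" using z 0 K_iff by (auto simp: K.Z_def)
    have "has_degree_below R 0 (D z)" by (rule k.D_degree[OF zc])
    then have "D z S = \<zero>\<^bsub>R\<^esub>" for S
      using mod_hom_closed[OF k.D_hom zc(1)] finite_subset[of S "{..<h}"]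
      by (cases "S \<subseteq> {..<h}") (auto simp: has_degree_below_def carrier_free_module)
    then show ?thesis by auto
  next
    case (Suc i)
    then show ?thesis using z by (simp add: K.Z_def mod_ker_def)
  qed
  have kill: "a \<odot>\<^bsub>?K j\<^esub> z \<in> K.B j" if a: "a \<in> \<qq>" and z: "z \<in> K.Z j" for a j z
  proof -
    interpret Kj: module R "?K j" by (rule K_module)
    have zK: "z \<in> carrier (?K j)" using Kj.submoduleE(1)[OF K.Z_submodule] z by blast
    have zT: "z \<in> carrier ?T" "has_degree R j z" using zK K_iff by auto
    have c: "(\<lambda>a. a \<odot>\<^bsub>?K j\<^esub> z) \<in> mod_hom R (self_module R) (?K j)"
      using zK by (intro mod_homI) (simp_all add: Kj.smult_l_distr Kj.smult_assoc1 del: free_module_simps)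
    let ?I = "{a \<in> carrier R. a \<odot>\<^bsub>?K j\<^esub> z \<in> K.B j}"
    have I: "ideal ?I R"
      using submodule_vimage[OF c self_module_module[OF R] K_module K.B_submodule] submodule_self_iff_ideal[OF R] by simp
    have "A \<subseteq> ?I"
    proof
      fix a assume a: "a \<in> A"
      then obtain i where i: "i < h" "a = x i" using xA by auto
      have Ez: "E i z \<in> carrier (?K (Suc j))"
        using mod_hom_closed[OF k.E_hom[OF i(1)] zT(1)] k.E_degree[OF i(1) zT] K_iff by blast
      have "x i \<odot>\<^bsub>?T\<^esub> z = D (E i z) \<oplus>\<^bsub>?T\<^esub> E i (D z)" using k.homotopy[OF i(1) zT(1)] by simp
      also have "E i (D z) = \<zero>\<^bsub>?T\<^esub>"
        using Z_D[OF z] mod_hom_zero[OF k.E_hom[OF i(1)] free_module_module[OF R] free_module_module[OF R]] by simp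
      also have "D (E i z) \<oplus>\<^bsub>?T\<^esub> \<zero>\<^bsub>?T\<^esub> = D (E i z)"
        using free_module_value[OF R mod_hom_closed[OF DK Ez]] by simp
      finally have "a \<odot>\<^bsub>?K j\<^esub> z = D (E i z)" using i by simp
      then show "a \<in> ?I" using Ez a A(1) by (auto simp: K.B_def)
    qed
    then have "\<qq> \<subseteq> ?I" unfolding A(3) by (rule q.genideal_minimal[OF I])
    then show ?thesis using a by blast
  qed
  have non: "\<exists>z \<in> K.Z 0. s \<odot>\<^bsub>?K 0\<^esub> z \<notin> K.B 0" if s: "s \<in> carrier R - \<qq>" for s
  proof
    have "{} \<in> X 0" by (simp add: X_def)
    then show "unit_vec R {} \<in> K.Z 0" using unit_vec_carrier[OF R, of "{}" "X 0"] by (simp add: K.Z_def)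
    show "s \<odot>\<^bsub>?K 0\<^esub> unit_vec R {} \<notin> K.B 0"
    proof
      assume "s \<odot>\<^bsub>?K 0\<^esub> unit_vec R {} \<in> K.B 0"
      then obtain w where w: "w \<in> carrier (?K (Suc 0))" "s \<odot>\<^bsub>?K 0\<^esub> unit_vec R {} = D w"
        unfolding K.B_def by (elim imageE)
      have "D w {} \<in> \<qq>" using k.D_augmentation[OF _ q.is_ideal] w(1) xA AI K_iff by blast
      then have "s \<otimes>\<^bsub>R\<^esub> \<one>\<^bsub>R\<^esub> \<in> \<qq>" unfolding w(2)[symmetric] by (simp add: unit_vec_def)
      then show False using s by simp
    qed
  qed
  have "\<exists>s \<in> carrier R - \<qq>. \<forall>J m \<delta> g. quotient_resolution R J m \<delta> \<longrightarrow>
      (\<forall>j. \<forall>i<g. quotient_resolution.ext_torsion R m \<delta> s (?K j) i) \<longrightarrow>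
      (\<forall>i. i + h < g \<longrightarrow> quotient_resolution.ext_torsion R m \<delta> s (cyclic R \<qq>) i)"
    by (rule K.generic_ext_torsion[OF kill non])
  then obtain s where s: "s \<in> carrier R - \<qq>"
    and b: "\<forall>J m \<delta> g. quotient_resolution R J m \<delta> \<longrightarrow>
      (\<forall>j. \<forall>i<g. quotient_resolution.ext_torsion R m \<delta> s (?K j) i) \<longrightarrow>
      (\<forall>i. i + h < g \<longrightarrow> quotient_resolution.ext_torsion R m \<delta> s (cyclic R \<qq>) i)"
    by (elim bexE)
  show ?thesis
  proof (intro exI[of _ h] bexI[OF _ s] allI impI)
    fix J m \<delta> g i
    assume qr: "quotient_resolution R J m \<delta>" and i: "i + h < g"
      and t: "\<forall>i<g. quotient_resolution.ext_torsion R m \<delta> \<one>\<^bsub>R\<^esub> (self_module R) i"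
    interpret qr: quotient_resolution R J m \<delta> by fact
    have sR: "s \<in> carrier R" using s by simp
    have tK: "qr.ext_torsion s (?K j) k" if "k < g" for j k
      using t that by (intro qr.ext_torsion_free[OF sR finX] qr.ext_torsion_one[OF self_module_module[OF R] sR]) simp
    show "qr.ext_torsion s (cyclic R \<qq>) i" by (rule b[rule_format, OF qr tK i])
  qed
qed

lemma noetherian_ideal_induct [consumes 2, case_names step]:
  assumes noeth: "noetherian_ring R" and A: "ideal A R"
    and step: "\<And>A. ideal A R \<Longrightarrow> (\<And>B. ideal B R \<Longrightarrow> A \<subset> B \<Longrightarrow> P B) \<Longrightarrow> P A"
  shows "P A"
proof (rule ccontr)
  interpret N: noetherian_ring R by fact
  let ?S = "{B. ideal B R \<and> \<not> P B}"
  assume "\<not> P A"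
  then have ne: "?S \<noteq> {}" using A by auto
  have "\<exists>M\<in>?S. \<forall>B\<in>?S. M \<subseteq> B \<longrightarrow> B = M"
  proof (rule subset_Zorn_nonempty[OF ne])
    fix C assume C: "C \<noteq> {}" "subset.chain ?S C"
    then have "subset.chain {I. ideal I R} C" by (auto simp: subset_chain_def)
    then have "\<Union>C \<in> C" by (rule N.ideal_chain_is_trivial[OF C(1)])
    then show "\<Union>C \<in> ?S" using C(2) by (auto simp: subset_chain_def)
  qed
  then obtain M where M: "ideal M R" "\<not> P M" "\<And>B. ideal B R \<Longrightarrow> \<not> P B \<Longrightarrow> M \<subseteq> B \<Longrightarrow> B = M" by blast
  have "P M" by (rule step[OF M(1)]) (use M(3) in blast)
  then show False using M(2) by simp
qed

text \<open>
  Vanishing of \<open>Ext\<^sup>i(R/J, R)\<close> for \<open>i < g\<close> implies vanishing of \<open>Ext\<^sup>i(R/J, M)\<close> for \<open>i < g - n\<close>, where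
  \<open>n\<close> does not depend on \<open>J\<close> and \<open>g\<close>.
\<close>

definition grade_defect_bounded :: "('a, 'r) ring_scheme \<Rightarrow> ('a, 'm) module \<Rightarrow> nat \<Rightarrow> bool"
  where "grade_defect_bounded R M n \<longleftrightarrow> (\<forall>J m d g. quotient_resolution R J m d \<longrightarrow>
    (\<forall>i<g. quotient_resolution.ext_torsion R m d \<one>\<^bsub>R\<^esub> (self_module R) i) \<longrightarrow>
    (\<forall>i. i + n < g \<longrightarrow> quotient_resolution.ext_torsion R m d \<one>\<^bsub>R\<^esub> M i))"

text \<open>
  Noetherian induction: a quotient by a non-prime ideal is an extension of smaller quotients. For a
  prime ideal \<open>\<qq>\<close> the Ext modules of \<open>R/\<qq>\<close> are \<open>s\<close>-torsion for some \<open>s \<notin> \<qq>\<close>, and the bound for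
  \<open>R/(\<qq> + sR)\<close> shows that they have no \<open>s\<close>-torsion.
\<close>

theorem cyclic_grade_defect_bounded:
  assumes R: "cring R" and noeth: "noetherian_ring R" and A: "ideal A R"
  shows "\<exists>n. grade_defect_bounded R (cyclic R A) n"
  using noeth A
proof (induction A rule: noetherian_ideal_induct)
  case (step A)
  interpret R: cring R by fact
  interpret A: ideal A R by (rule step)
  have one: "\<one>\<^bsub>R\<^esub> \<in> carrier R" by simp
  consider "A = carrier R" | "primeideal A R"
    | x y where "x \<in> carrier R" "y \<in> carrier R" "x \<otimes>\<^bsub>R\<^esub> y \<in> A" "x \<notin> A" "y \<notin> A"
    using primeidealI[OF step(1) R] by blast
  then show ?case
  proof cases
    case 1
    have "quotient_resolution.ext_torsion R m d \<one>\<^bsub>R\<^esub> (cyclic R A) i" if qr: "quotient_resolution R J m d" for J m d i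
    proof (rule quotient_resolution.ext_torsion_killed[OF qr cyclic_module[OF R step(1)] one])
      fix X assume "X \<in> carrier (cyclic R A)"
      then obtain a where a: "a \<in> carrier (self_module R)" "X = A +>\<^bsub>self_module R\<^esub> a" by (rule quotient_moduleE)
      then show "\<one>\<^bsub>R\<^esub> \<odot>\<^bsub>cyclic R A\<^esub> X = \<zero>\<^bsub>cyclic R A\<^esub>"
        using cyclic_smult[OF R step(1), of a "\<one>\<^bsub>R\<^esub>"] cyclic_eq_zero_iff[OF R step(1), of a] 1 by simp
    qed
    then show ?thesis unfolding grade_defect_bounded_def by blast
  next
    case 2
    from generic_ext_torsion_domain[OF R noeth 2]
    obtain h s where s: "s \<in> carrier R - A" and hs: "\<forall>J m d g. quotient_resolution R J m d \<longrightarrow>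
      (\<forall>i<g. quotient_resolution.ext_torsion R m d \<one>\<^bsub>R\<^esub> (self_module R) i) \<longrightarrow>
      (\<forall>i. i + h < g \<longrightarrow> quotient_resolution.ext_torsion R m d s (cyclic R A) i)"
      by (elim exE bexE)
    have sR: "s \<in> carrier R" using s by simp
    note ad = adjoin_ideal[OF R step(1) sR]
    have "A \<subset> adjoin R A s" using ad(2,3) s by blast
    then obtain n where n: "grade_defect_bounded R (cyclic R (adjoin R A s)) n" using step(2)[OF ad(1)] by blast
    have reg: "a \<in> A" if "a \<in> carrier R" "s \<otimes>\<^bsub>R\<^esub> a \<in> A" for a
      using primeideal.I_prime[OF 2 sR that] s by blast
    obtain g where g: "short_exact R (cyclic R A) (cyclic R A) (cyclic R (adjoin R A s)) (\<lambda>X. s \<odot>\<^bsub>cyclic R A\<^esub> X) g"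
      by (rule short_exact_cyclic_regular[OF R step(1) sR reg]) blast+
    have "grade_defect_bounded R (cyclic R A) (n + h)"
      unfolding grade_defect_bounded_def
    proof (intro allI impI)
      fix J m d k i assume qr: "quotient_resolution R J m d"
        and t: "\<forall>i<k. quotient_resolution.ext_torsion R m d \<one>\<^bsub>R\<^esub> (self_module R) i" and i: "i + (n + h) < k"
      interpret qr: quotient_resolution R J m d by fact
      show "qr.ext_torsion \<one>\<^bsub>R\<^esub> (cyclic R A) i"
      proof (rule qr.ext_vanishing_of_torsion[OF g sR])
        show "qr.ext_torsion s (cyclic R A) i" 
          by (rule hs[rule_format, OF qr, of k]) (use t i in auto)
        show "qr.ext_torsion \<one>\<^bsub>R\<^esub> (cyclic R (adjoin R A s)) j" if "i = Suc j" for j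
          by (rule n[unfolded grade_defect_bounded_def, rule_format, OF qr, of k]) (use t that i in auto)
      qed
    qed
    then show ?thesis by blast
  next
    case (3 x y)
    note ad = adjoin_ideal[OF R step(1) 3(1)] and co = colon_ideal[OF R step(1) 3(1)]
    have "A \<subset> adjoin R A x" using ad(2,3) 3 by blast
    then obtain n1 where n1: "grade_defect_bounded R (cyclic R (adjoin R A x)) n1" using step(2)[OF ad(1)] by blast
    have "A \<subseteq> colon R A x" using A.I_r_closed[OF _ 3(1)] A.Icarr unfolding colon_def by blast
    moreover have "y \<in> colon R A x" using 3 R.m_comm[of x y] by (simp add: colon_def)
    ultimately have "A \<subset> colon R A x" using 3(5) by blast
    then obtain n2 where n2: "grade_defect_bounded R (cyclic R (colon R A x)) n2" using step(2)[OF co] by blast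
    obtain f g where fg: "short_exact R (cyclic R (colon R A x)) (cyclic R A) (cyclic R (adjoin R A x)) f g"
      by (rule short_exact_cyclic[OF R step(1) 3(1)])
    have "grade_defect_bounded R (cyclic R A) (n1 + n2)"
      unfolding grade_defect_bounded_def
    proof (intro allI impI)
      fix J m d k i assume qr: "quotient_resolution R J m d"
        and t: "\<forall>i<k. quotient_resolution.ext_torsion R m d \<one>\<^bsub>R\<^esub> (self_module R) i" and i: "i + (n1 + n2) < k"
      show "quotient_resolution.ext_torsion R m d \<one>\<^bsub>R\<^esub> (cyclic R A) i"
      proof (rule quotient_resolution.ext_torsion_middle[OF qr fg one])
        show "quotient_resolution.ext_torsion R m d \<one>\<^bsub>R\<^esub> (cyclic R (colon R A x)) i"
          by (rule n2[unfolded grade_defect_bounded_def, rule_format, OF qr, of k]) (use t i in auto)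
        show "quotient_resolution.ext_torsion R m d \<one>\<^bsub>R\<^esub> (cyclic R (adjoin R A x)) i"
          by (rule n1[unfolded grade_defect_bounded_def, rule_format, OF qr, of k]) (use t i in auto)
      qed
    qed
    then show ?thesis by blast
  qed
qed


section \<open>Syzygies\<close>

text \<open>Passing to a syzygy improves the defect by one, until it is zero.\<close>

lemma grade_defect_bounded_syzygy:
  assumes ex: "short_exact R L (free_module R X) N f g" and X: "finite X" and n: "grade_defect_bounded R N n"
  shows "grade_defect_bounded R L (n - 1)"
  unfolding grade_defect_bounded_def
proof (intro allI impI)
  fix J m d k i assume qr: "quotient_resolution R J m d"
    and t: "\<forall>i<k. quotient_resolution.ext_torsion R m d \<one>\<^bsub>R\<^esub> (self_module R) i" and i: "i + (n - 1) < k"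
  interpret qr: quotient_resolution R J m d by fact
  interpret R: cring R by (rule qr.R)
  have one: "\<one>\<^bsub>R\<^esub> \<in> carrier R" by simp
  show "qr.ext_torsion \<one>\<^bsub>R\<^esub> L i"
  proof (rule qr.ext_torsion_left[OF ex one])
    show "qr.ext_torsion \<one>\<^bsub>R\<^esub> (free_module R X) i" by (rule qr.ext_torsion_free[OF one X]) (use t i in simp)
    show "qr.ext_torsion \<one>\<^bsub>R\<^esub> N j" if "i = Suc j" for j
      by (rule n[unfolded grade_defect_bounded_def, rule_format, OF qr, of k]) (use t i that in auto)
  qed
qed

lemma grade_defect_bounded_iso:
  assumes "mod_iso R M N" "module R M" "module R N" and n: "grade_defect_bounded R M n"
  shows "grade_defect_bounded R N n"
  unfolding grade_defect_bounded_def
proof (intro allI impI)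
  fix J m d k i assume qr: "quotient_resolution R J m d"
    and t: "\<forall>i<k. quotient_resolution.ext_torsion R m d \<one>\<^bsub>R\<^esub> (self_module R) i" and i: "i + n < k"
  interpret N: module R N by fact
  show "quotient_resolution.ext_torsion R m d \<one>\<^bsub>R\<^esub> N i"
    by (rule quotient_resolution.ext_torsion_iso[OF qr assms(1-3) N.R.one_closed])
      (rule n[unfolded grade_defect_bounded_def, rule_format, OF qr, of k], use t i in auto)
qed

context quotient_resolution
begin

text \<open>For \<open>n \<ge> 1\<close> this is an \<open>n\<close>-th syzygy of \<open>R/J\<close>, because of the shift of degrees in \<open>G\<close>.\<close>

abbreviation syzygy :: "nat \<Rightarrow> ('a, nat \<Rightarrow> 'a) module"
  where "syzygy n \<equiv> G n\<lparr>carrier := d n ` carrier (G (Suc n))\<rparr>"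

lemma image_submodule: "submodule (d n ` carrier (G (Suc n))) R (G n)"
  by (rule submodule_image[OF d_hom G_module G_module module.carrier_is_submodule[OF G_module]])

lemma syzygy_module: "module R (syzygy n)"
  by (rule module_restrict[OF G_module image_submodule])

lemma syzygy_fin_gen: "fin_gen R (syzygy n)"
  by (rule fin_gen_image[OF mod_hom_corestrict[OF d_hom] _ G_module syzygy_module free_module_fin_gen[OF R finite_lessThan]]) simp_all

lemma syzygy_exact:
  assumes "n \<ge> 1"
  shows "short_exact R (syzygy (Suc n)) (G (Suc n)) (syzygy n) (\<lambda>x. x) (d n)"
proof -
  have "mod_ker (G (Suc n)) (syzygy n) (d n) = d (Suc n) ` carrier (G (Suc (Suc n)))"
    using d_exact[OF assms] by (simp add: mod_ker_def)
  moreover have "short_exact R (G (Suc n)\<lparr>carrier := mod_ker (G (Suc n)) (syzygy n) (d n)\<rparr>) (G (Suc n)) (syzygy n) (\<lambda>x. x) (d n)"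
    by (rule short_exact_kernel[OF mod_hom_corestrict[OF d_hom] G_module syzygy_module]) simp_all
  ultimately show ?thesis by simp
qed

lemma syzygy_one_exact:
  assumes J: "ideal J R"
  shows "short_exact R (syzygy 1) (G 1) (cyclic R J) (\<lambda>x. x) (\<lambda>x. J +>\<^bsub>self_module R\<^esub> x 0)"
proof -
  interpret R: cring R by (rule R)
  have e: "(\<lambda>x. x 0) \<in> mod_hom R (G 1) (self_module R)"
    by (simp add: mod_hom_def Pi_def free_module_value[OF R])
  note g = mod_hom_comp[OF e cyclic_proj[OF R J]]
  have "(\<lambda>x. x 0) ` carrier (G 1) = carrier R"
  proof (intro equalityI subsetI)
    fix a assume a: "a \<in> carrier R"
    show "a \<in> (\<lambda>x. x 0) ` carrier (G 1)"
      by (rule image_eqI[of _ _ "\<lambda>i. if i = 0 then a else \<zero>\<^bsub>R\<^esub>"]) (use a in \<open>auto simp: carrier_free_module m1[simplified]\<close>)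
  qed (use mod_hom_closed[OF e] in auto)
  then have surj: "(\<lambda>x. J +>\<^bsub>self_module R\<^esub> x 0) ` carrier (G 1) = carrier (cyclic R J)"
    unfolding carrier_cyclic by (metis image_image)
  have ker: "mod_ker (G 1) (cyclic R J) (\<lambda>x. J +>\<^bsub>self_module R\<^esub> x 0) = d 1 ` carrier (G (Suc 1))"
    using d_one cyclic_eq_zero_iff[OF R J] mod_hom_closed[OF e] by (auto simp: mod_ker_def numeral_2_eq_2)
  show ?thesis using short_exact_kernel[OF g G_module cyclic_module[OF R J] surj] unfolding ker .
qed

lemma syzygy_grade_defect:
  assumes J: "ideal J R" and n: "grade_defect_bounded R (cyclic R J) n"
  shows "grade_defect_bounded R (syzygy (Suc k)) (n - Suc k)"
proof (induction k)
  case 0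
  show ?case using grade_defect_bounded_syzygy[OF syzygy_one_exact[OF J] finite_lessThan n] by simp
next
  case (Suc k)
  show ?case using grade_defect_bounded_syzygy[OF syzygy_exact[of "Suc k"] finite_lessThan Suc] by simp
qed

end


section \<open>Isomorphic copies in another type\<close>

lemma module_image:
  assumes M: "module R M" and f: "f \<in> mod_hom R M N" and surj: "f ` carrier M = carrier N"
    and z: "f \<zero>\<^bsub>M\<^esub> = \<zero>\<^bsub>N\<^esub>"
  shows "module R N"
proof -
  interpret M: module R M by fact
  have c: "carrier N = f ` carrier M" using surj by simp
  have a: "f x \<oplus>\<^bsub>N\<^esub> f y = f (x \<oplus>\<^bsub>M\<^esub> y)" if "x \<in> carrier M" "y \<in> carrier M" for x y
    using that mod_hom_add[OF f] by simp
  have s: "r \<odot>\<^bsub>N\<^esub> f x = f (r \<odot>\<^bsub>M\<^esub> x)" if "r \<in> carrier R" "x \<in> carrier M" for r x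
    using that mod_hom_smult[OF f] by simp
  show ?thesis
  proof (rule moduleI)
    show "cring R" by (rule M.is_cring)
    show "abelian_group N"
    proof (rule abelian_groupI)
      show "\<exists>y\<in>carrier N. y \<oplus>\<^bsub>N\<^esub> x = \<zero>\<^bsub>N\<^esub>" if x: "x \<in> carrier N" for x
      proof -
        obtain w where w: "w \<in> carrier M" "x = f w" using x unfolding c by (elim imageE)
        then show ?thesis unfolding c z[symmetric] using a[of "\<ominus>\<^bsub>M\<^esub> w" w] M.l_neg[of w]
          by (intro bexI[of _ "f (\<ominus>\<^bsub>M\<^esub> w)"]) simp_all
      qed
    qed (auto simp: c z[symmetric] a M.a_ac)
  qed (auto simp: c a s M.smult_l_distr M.smult_r_distr M.smult_assoc1)
qed

text \<open>
  Projectivity, injectivity and the category \<open>mod R\<close> are tied to one type of elements; structures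
  that live in other types enter through copies.
\<close>

definition transfer_module :: "('m \<Rightarrow> 'n) \<Rightarrow> ('a, 'm) module \<Rightarrow> ('a, 'n) module"
  where "transfer_module \<phi> M =
    \<lparr>carrier = \<phi> ` carrier M, monoid.mult = undefined, one = undefined, zero = \<phi> \<zero>\<^bsub>M\<^esub>,
     add = (\<lambda>x y. \<phi> (inv_into (carrier M) \<phi> x \<oplus>\<^bsub>M\<^esub> inv_into (carrier M) \<phi> y)),
     smult = (\<lambda>a x. \<phi> (a \<odot>\<^bsub>M\<^esub> inv_into (carrier M) \<phi> x))\<rparr>"

lemma transfer_module:
  assumes M: "module R M" and inj: "inj_on \<phi> (carrier M)"
  shows "module R (transfer_module \<phi> M)" "\<phi> \<in> mod_hom R M (transfer_module \<phi> M)"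
    "bij_betw \<phi> (carrier M) (carrier (transfer_module \<phi> M))"
proof -
  show h: "\<phi> \<in> mod_hom R M (transfer_module \<phi> M)"
    by (rule mod_homI) (simp_all add: transfer_module_def inv_into_f_f[OF inj])
  show "bij_betw \<phi> (carrier M) (carrier (transfer_module \<phi> M))"
    using inj by (simp add: bij_betw_def transfer_module_def)
  show "module R (transfer_module \<phi> M)"
    by (rule module_image[OF M h]) (simp_all add: transfer_module_def)
qed

lemma transfer_module_iso:
  "module R M \<Longrightarrow> inj_on \<phi> (carrier M) \<Longrightarrow> mod_iso R M (transfer_module \<phi> M)"
  unfolding mod_iso_def using transfer_module(2,3) by (intro bexI)

definition to_univ :: "(nat \<Rightarrow> 'a) \<Rightarrow> 'a univ"
  where "to_univ f = {f}"

lemma inj_to_univ: "inj_on to_univ X"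
  by (auto simp: inj_on_def to_univ_def)


section \<open>Local cohomology\<close>

text \<open>Injectivity is applied to a copy of \<open>M\<close> in the type of \<open>E\<close>.\<close>

lemma injective_extension:
  fixes E :: "('a, 'u) module" and M :: "('a, 'm) module" and \<phi> :: "'m \<Rightarrow> 'u"
  assumes E: "injective_module R E" and M: "module R M" and \<phi>: "inj_on \<phi> (carrier M)"
    and H: "submodule H R M" and f: "f \<in> mod_hom R (M\<lparr>carrier := H\<rparr>) E"
  shows "\<exists>f' \<in> mod_hom R M E. \<forall>x\<in>H. f' x = f x"
proof -
  let ?T = "transfer_module \<phi> M" and ?i = "inv_into (carrier M) \<phi>"
  note T = transfer_module[OF M \<phi>]
  have Hs: "H \<subseteq> carrier M" by (rule submodule_subset[OF M H])
  have HT: "submodule (\<phi> ` H) R ?T" by (rule submodule_image[OF T(2) M T(1) H])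
  let ?A = "?T\<lparr>carrier := \<phi> ` H\<rparr>"
  have A: "module R ?A" by (rule module_restrict[OF T(1) HT])
  have i: "?i \<in> mod_hom R ?T M" by (rule mod_hom_inv_into[OF T(2,3) M])
  have iH: "?i (\<phi> x) = x" if "x \<in> carrier M" for x using that by (simp add: inv_into_f_f[OF \<phi>])
  have "?i \<in> mod_hom R ?A (M\<lparr>carrier := H\<rparr>)"
  proof (rule mod_hom_corestrict[OF mod_hom_restrict[OF i submodule_subset[OF T(1) HT]]])
    show "?i ` carrier ?A \<subseteq> H"
    proof
      fix y assume "y \<in> ?i ` carrier ?A"
      then obtain x where "x \<in> H" "y = ?i (\<phi> x)" by auto
      then show "y \<in> H" using iH[of x] Hs by auto
    qed
  qed
  from mod_hom_comp[OF this f] have c: "(\<lambda>y. f (?i y)) \<in> mod_hom R ?A E" .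
  have j: "(\<lambda>y. y) \<in> mod_hom R ?A ?T" by (rule mod_hom_restrict[OF mod_hom_id submodule_subset[OF T(1) HT]])
  have "inj_on (\<lambda>y. y) (carrier ?A)" by simp
  with E A T(1) j c have "\<exists>h\<in>mod_hom R ?T E. \<forall>x\<in>carrier ?A. h x = f (?i x)"
    unfolding injective_module_def by blast
  then obtain h where h: "h \<in> mod_hom R ?T E" "\<forall>x\<in>carrier ?A. h x = f (?i x)" by (elim bexE)
  have "h (\<phi> x) = f x" if "x \<in> H" for x using h(2) that iH[of x] Hs by auto
  then show ?thesis by (intro bexI[OF _ mod_hom_comp[OF T(2) h(1)]] ballI)
qed

context quotient_resolution
begin

text \<open>
  A cocycle vanishes on the image of the next differential, so it factors through the image of
  \<open>d i\<close> and extends from there to \<open>G i\<close>.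
\<close>

lemma ext_torsion_injective:
  fixes E :: "('a, 'a univ) module"
  assumes E: "injective_module R E" and i: "i \<ge> 1"
  shows "ext_torsion \<one>\<^bsub>R\<^esub> E i"
proof (rule ext_torsionI)
  have mE: "module R E" using E by (simp add: injective_module_def)
  interpret E: module R E by (rule mE)
  fix c assume c: "c \<in> mod_hom R (G (Suc i)) E"
    and cd: "\<And>y. y \<in> carrier (G (Suc (Suc i))) \<Longrightarrow> c (d (Suc i) y) = \<zero>\<^bsub>E\<^esub>"
  have dh: "d i \<in> mod_hom R (G (Suc i)) (syzygy i)" by (rule mod_hom_corestrict[OF d_hom]) simp
  have ck: "c y = \<zero>\<^bsub>E\<^esub>" if y: "y \<in> carrier (G (Suc i))" "d i y = \<zero>\<^bsub>syzygy i\<^esub>" for y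
  proof -
    have "y \<in> mod_ker (G (Suc i)) (G i) (d i)" using y by (simp add: mod_ker_def)
    then obtain w where "w \<in> carrier (G (Suc (Suc i)))" "y = d (Suc i) w" unfolding d_exact[OF i, symmetric] by (elim imageE)
    then show ?thesis using cd by simp
  qed
  obtain c' where c': "c' \<in> mod_hom R (syzygy i) E" "\<And>y. y \<in> carrier (G (Suc i)) \<Longrightarrow> c' (d i y) = c y"
    by (rule factor_through_surj[OF dh _ G_module syzygy_module mE c ck]) (simp, blast+)
  obtain b where b: "b \<in> mod_hom R (G i) E" "\<forall>x\<in>d i ` carrier (G (Suc i)). b x = c' x"
    using injective_extension[OF E G_module inj_to_univ image_submodule c'(1)] by (elim bexE)
  have "(\<one>\<^bsub>R\<^esub> [^]\<^bsub>R\<^esub> (0::nat)) \<odot>\<^bsub>E\<^esub> c y = b (d i y)" if y: "y \<in> carrier (G (Suc i))" for y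
    using b(2) c'(2)[OF y] y mod_hom_closed[OF c y] by simp
  then show "\<exists>(k::nat). \<exists>b \<in> mod_hom R (G i) E. \<forall>y\<in>carrier (G (Suc i)). (\<one>\<^bsub>R\<^esub> [^]\<^bsub>R\<^esub> k) \<odot>\<^bsub>E\<^esub> c y = b (d i y)"
    by (intro exI[of _ 0] bexI[OF _ b(1)] ballI)
qed

text \<open>
  Dimension shifting along an injective resolution: its cocycles \<open>Z b\<close> in degree \<open>b\<close> form a \<open>b\<close>-th
  cosyzygy of \<open>M\<close>, so that \<open>Ext\<^sup>1(R/J, Z b) = Ext\<^sup>b\<^sup>+\<^sup>1(R/J, M)\<close>. If this is zero, then a cocycle in
  degree \<open>b + 1\<close> that is killed by \<open>J\<close> bounds an element killed by \<open>J\<close>.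
\<close>

lemma injective_resolution_cocycle:
  fixes M :: "('a, 'a univ) module"
  assumes J: "ideal J R" and M: "module R M" and res: "injective_resolution R M \<epsilon> E \<delta>"
    and t: "\<And>j. j \<le> n \<Longrightarrow> ext_torsion \<one>\<^bsub>R\<^esub> M j"
    and z: "z \<in> carrier (E n)" "\<delta> n z = \<zero>\<^bsub>E (Suc n)\<^esub>" and Jz: "\<And>a. a \<in> J \<Longrightarrow> a \<odot>\<^bsub>E n\<^esub> z = \<zero>\<^bsub>E n\<^esub>"
  shows "case n of 0 \<Rightarrow> z = \<zero>\<^bsub>E 0\<^esub>
    | Suc b \<Rightarrow> \<exists>y \<in> carrier (E b). \<delta> b y = z \<and> (\<forall>a\<in>J. a \<odot>\<^bsub>E b\<^esub> y = \<zero>\<^bsub>E b\<^esub>)"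
proof -
  interpret R: cring R by (rule R)
  interpret J: ideal J R by fact
  note res' = res[unfolded injective_resolution_def]
  have inj: "injective_module R (E i)" for i using res' by simp
  then have E: "module R (E i)" for i by (simp add: injective_module_def)
  have \<delta>: "\<delta> i \<in> mod_hom R (E i) (E (Suc i))" for i using res' by simp
  have \<epsilon>: "\<epsilon> \<in> mod_hom R M (E 0)" "inj_on \<epsilon> (carrier M)" "\<epsilon> ` carrier M = mod_ker (E 0) (E 1) (\<delta> 0)"
    using res' by auto
  have exact: "\<delta> i ` carrier (E i) = mod_ker (E (Suc i)) (E (Suc (Suc i))) (\<delta> (Suc i))" for i using res' by simp
  let ?Z = "\<lambda>b. E b\<lparr>carrier := mod_ker (E b) (E (Suc b)) (\<delta> b)\<rparr>"
  have Zs: "submodule (mod_ker (E b) (E (Suc b)) (\<delta> b)) R (E b)" for b by (rule mod_ker_submodule[OF \<delta> E E])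
  have Z: "module R (?Z b)" for b by (rule module_restrict[OF E Zs])
  have \<delta>Z: "\<delta> b \<in> mod_hom R (E b) (?Z (Suc b))" for b by (rule mod_hom_corestrict[OF \<delta>]) (simp add: exact)
  have surj: "\<delta> b ` carrier (E b) = carrier (?Z (Suc b))" for b by (simp add: exact)
  have ex: "short_exact R (?Z b) (E b) (?Z (Suc b)) (\<lambda>x. x) (\<delta> b)" for b
    using short_exact_kernel[OF \<delta>Z E Z surj] by (simp add: mod_ker_def)
  have iso: "mod_iso R M (?Z 0)"
    unfolding mod_iso_def using \<epsilon> by (intro bexI[of _ \<epsilon>] mod_hom_corestrict) (simp_all add: bij_betw_def)
  have tZ: "ext_torsion \<one>\<^bsub>R\<^esub> (?Z b) i" if "i \<ge> 1" "i + b \<le> n" for b i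
    using that
  proof (induction b arbitrary: i)
    case 0
    show ?case by (rule ext_torsion_iso[OF iso M Z R.one_closed]) (use t 0 in simp)
  next
    case (Suc b)
    show ?case
      by (rule ext_torsion_right[OF ex R.one_closed ext_torsion_injective[OF inj]]) (use Suc in simp_all)
  qed
  let ?u = "unit_vec R 0"
  have u: "?u \<in> carrier (G 1)" by (rule unit_vec_carrier[OF R]) (simp add: m1[simplified])
  have eval: "(\<lambda>x. x 0 \<odot>\<^bsub>N\<^esub> w) \<in> mod_hom R (G 1) N" if N: "module R N" and w: "w \<in> carrier N" for N :: "('a, 'a univ) module" and w
  proof -
    interpret N: module R N by (rule N)
    show ?thesis using w by (intro mod_homI) (simp_all add: N.smult_l_distr N.smult_assoc1 free_module_value[OF R])
  qed
  have dJ: "d 1 y 0 \<in> J" if "y \<in> carrier (G 2)" for y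
    using d_one that by auto
  show ?thesis
  proof (cases n)
    case 0
    interpret M: module R M by (rule M)
    have "z \<in> \<epsilon> ` carrier M" using z 0 \<epsilon>(3) by (simp add: mod_ker_def)
    then obtain w where w: "w \<in> carrier M" "z = \<epsilon> w" by (elim imageE)
    have Jw: "a \<odot>\<^bsub>M\<^esub> w = \<zero>\<^bsub>M\<^esub>" if a: "a \<in> J" for a
    proof -
      have "\<epsilon> (a \<odot>\<^bsub>M\<^esub> w) = \<zero>\<^bsub>E 0\<^esub>" using Jz[OF a] mod_hom_smult[OF \<epsilon>(1) J.Icarr[OF a] w(1)] w(2) 0 by simp
      then show ?thesis using \<epsilon>(2) inj_on_mod_hom_iff[OF \<epsilon>(1) M E] J.Icarr[OF a] w(1) by simp
    qed
    have c: "(\<lambda>x. x 0 \<odot>\<^bsub>M\<^esub> w) \<in> mod_hom R (G (Suc 0)) M" using eval[OF M w(1)] by simp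
    have cz: "d (Suc 0) y 0 \<odot>\<^bsub>M\<^esub> w = \<zero>\<^bsub>M\<^esub>" if "y \<in> carrier (G (Suc (Suc 0)))" for y
      using Jw[OF dJ[of y]] that by (simp add: numeral_2_eq_2)
    have t0: "ext_torsion \<one>\<^bsub>R\<^esub> M 0" using t[of 0] by simp
    obtain k b where b: "b \<in> mod_hom R (G 0) M"
      "\<And>y. y \<in> carrier (G (Suc 0)) \<Longrightarrow> (\<one>\<^bsub>R\<^esub> [^]\<^bsub>R\<^esub> (k::nat)) \<odot>\<^bsub>M\<^esub> (y 0 \<odot>\<^bsub>M\<^esub> w) = b (d 0 y)"
      by (rule ext_torsionE[OF t0 c cz]) blast+
    have "w = b (d 0 ?u)" using b(2)[of ?u] u w(1) by (simp add: unit_vec_def)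
    also have "\<dots> = \<zero>\<^bsub>M\<^esub>" using d_zero[OF u] mod_hom_zero[OF b(1) G_module M] by simp
    finally show ?thesis using w(2) mod_hom_zero[OF \<epsilon>(1) M E] 0 by simp
  next
    case (Suc b)
    interpret E: module R "E b" by (rule E)
    interpret Zb: module R "?Z b" by (rule Z)
    have zZ: "z \<in> carrier (?Z (Suc b))" using z Suc by (simp add: mod_ker_def)
    have c: "(\<lambda>x. x 0 \<odot>\<^bsub>?Z (Suc b)\<^esub> z) \<in> mod_hom R (free_module R {..<m 1}) (?Z (Suc b))" by (rule eval[OF Z zZ])
    obtain c' where c': "c' \<in> mod_hom R (G 1) (E b)" "\<And>y. y \<in> carrier (G 1) \<Longrightarrow> \<delta> b (c' y) = y 0 \<odot>\<^bsub>?Z (Suc b)\<^esub> z"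
      by (rule lift_through_surj[OF \<delta>Z surj E Z finite_lessThan c]) blast+
    have d1: "d 1 \<in> mod_hom R (G 2) (G 1)" using d_hom[of 1] by (simp add: numeral_2_eq_2)
    have e: "(\<lambda>y. c' (d 1 y)) \<in> mod_hom R (G 2) (?Z b)"
    proof (rule mod_hom_corestrict[OF mod_hom_comp[OF d1 c'(1)]], rule image_subsetI)
      fix y assume y: "y \<in> carrier (G 2)"
      have "\<delta> b (c' (d 1 y)) = \<zero>\<^bsub>E (Suc b)\<^esub>"
        using c'(2)[OF mod_hom_closed[OF d1 y]] Jz[OF dJ[OF y]] Suc by simp
      then show "c' (d 1 y) \<in> mod_ker (E b) (E (Suc b)) (\<delta> b)"
        using mod_hom_closed[OF c'(1) mod_hom_closed[OF d1 y]] by (simp add: mod_ker_def)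
    qed
    have ed: "c' (d 1 (d (Suc 1) y)) = \<zero>\<^bsub>?Z b\<^esub>" if "y \<in> carrier (G (Suc (Suc 1)))" for y
      using d_d[OF that] mod_hom_zero[OF c'(1) G_module E] by simp
    have e': "(\<lambda>y. c' (d 1 y)) \<in> mod_hom R (G (Suc 1)) (?Z b)" using e by (simp add: numeral_2_eq_2)
    have tt: "ext_torsion \<one>\<^bsub>R\<^esub> (?Z b) 1" using tZ[of 1 b] Suc by simp
    obtain k p where p: "p \<in> mod_hom R (G 1) (?Z b)"
      "\<And>y. y \<in> carrier (G (Suc 1)) \<Longrightarrow> (\<one>\<^bsub>R\<^esub> [^]\<^bsub>R\<^esub> (k::nat)) \<odot>\<^bsub>?Z b\<^esub> c' (d 1 y) = p (d 1 y)"
      by (rule ext_torsionE[OF tt e' ed]) blast+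
    have pc: "p y \<in> carrier (E b)" "\<delta> b (p y) = \<zero>\<^bsub>E (Suc b)\<^esub>" if "y \<in> carrier (G 1)" for y
      using mod_hom_closed[OF p(1) that] by (simp_all add: mod_ker_def)
    have cc: "c' y \<in> carrier (E b)" if "y \<in> carrier (G 1)" for y by (rule mod_hom_closed[OF c'(1) that])
    have p2: "p (d 1 y) = c' (d 1 y)" if "y \<in> carrier (G 2)" for y
      using p(2)[of y] that cc[OF mod_hom_closed[OF d1 that]] by (simp add: numeral_2_eq_2)
    let ?y = "c' ?u \<ominus>\<^bsub>E b\<^esub> p ?u"
    have y: "?y \<in> carrier (E b)" using cc[OF u] pc(1)[OF u] by simp
    interpret Ez: module R "E (Suc b)" by (rule E)
    have "\<delta> b ?y = z \<ominus>\<^bsub>E (Suc b)\<^esub> \<zero>\<^bsub>E (Suc b)\<^esub>"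
      using mod_hom_minus[OF \<delta> E E cc[OF u] pc(1)[OF u]] pc(2)[OF u] c'(2)[OF u] z(1) Suc by (simp add: unit_vec_def)
    also have "\<dots> = z" using z(1) Suc Ez.add.inv_one by (simp add: a_minus_def a_inv_def)
    finally have \<delta>y: "\<delta> b ?y = z" .
    have "a \<odot>\<^bsub>E b\<^esub> ?y = \<zero>\<^bsub>E b\<^esub>" if a: "a \<in> J" for a
    proof -
      have aR: "a \<in> carrier R" by (rule J.Icarr[OF a])
      interpret G1: module R "G 1" by (rule G_module)
      have au: "a \<odot>\<^bsub>G 1\<^esub> ?u \<in> carrier (G 1)" by (rule G1.smult_closed[OF aR u])
      have "a \<odot>\<^bsub>G 1\<^esub> ?u \<in> d 1 ` carrier (G 2)" unfolding d_one using au a aR by (simp add: unit_vec_def)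
      then obtain w where w: "w \<in> carrier (G 2)" "a \<odot>\<^bsub>G 1\<^esub> ?u = d 1 w" by (elim imageE)
      have p1: "p \<in> mod_hom R (G 1) (E b)" by (rule mod_hom_expand[OF p(1)]) (auto simp: mod_ker_def)
      have "a \<odot>\<^bsub>E b\<^esub> ?y = c' (a \<odot>\<^bsub>G 1\<^esub> ?u) \<ominus>\<^bsub>E b\<^esub> p (a \<odot>\<^bsub>G 1\<^esub> ?u)"
        using mod_hom_smult[OF mod_hom_diff[OF c'(1) p1 G_module E] aR u] by simp
      also have "\<dots> = \<zero>\<^bsub>E b\<^esub>"
        unfolding w(2) p2[OF w(1)] using cc[OF mod_hom_closed[OF d1 w(1)]] module_minus_eq_zero_iff[OF E] by simp
      finally show ?thesis .
    qed
    then show ?thesis using y \<delta>y Suc by auto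
  qed
qed

end


lemma ideal_power_ideal:
  assumes R: "cring R" and I: "ideal I R" shows "ideal (I [^]\<^bsub>ideals_set R\<^esub> (n::nat)) R"
proof -
  interpret R: cring R by fact
  show ?thesis
  proof (induction n)
    case 0
    show ?case using R.oneideal by (simp add: nat_pow_def ideals_set_def)
  next
    case (Suc n)
    then show ?case using R.ideal_prod_is_ideal[OF _ I] by (simp add: nat_pow_def ideals_set_def)
  qed
qed

lemma ideal_power_Suc: "I [^]\<^bsub>ideals_set R\<^esub> (Suc n) = ideal_prod R (I [^]\<^bsub>ideals_set R\<^esub> n) I"
  by (simp add: nat_pow_def ideals_set_def)

lemma power_mem_ideal_power:
  assumes R: "cring R" and I: "ideal I R" and x: "x \<in> I"
  shows "x [^]\<^bsub>R\<^esub> n \<in> I [^]\<^bsub>ideals_set R\<^esub> (n::nat)"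
proof -
  interpret R: cring R by fact
  show ?thesis
  proof (induction n)
    case 0
    show ?case by (simp add: nat_pow_def ideals_set_def)
  next
    case (Suc n)
    show ?case unfolding ideal_power_Suc R.nat_pow_Suc by (rule ideal_prod.prod[OF Suc x])
  qed
qed

lemma ideal_power_decreasing:
  assumes R: "cring R" and I: "ideal I R"
  shows "I [^]\<^bsub>ideals_set R\<^esub> (n + k) \<subseteq> I [^]\<^bsub>ideals_set R\<^esub> (n::nat)"
proof -
  interpret R: cring R by fact
  show ?thesis
  proof (induction k)
    case (Suc k)
    have "I [^]\<^bsub>ideals_set R\<^esub> (Suc (n + k)) \<subseteq> I [^]\<^bsub>ideals_set R\<^esub> (n + k)"
      unfolding ideal_power_Suc using R.ideal_prod_inter[OF ideal_power_ideal[OF R I] I] by blast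
    then show ?case using Suc by simp
  qed simp
qed

definition torsion_set :: "('a, 'r) ring_scheme \<Rightarrow> 'a set \<Rightarrow> ('a, 'm) module \<Rightarrow> 'm set"
  where "torsion_set R I M = {x \<in> carrier M. \<exists>n::nat. \<forall>a \<in> I [^]\<^bsub>ideals_set R\<^esub> n. a \<odot>\<^bsub>M\<^esub> x = \<zero>\<^bsub>M\<^esub>}"

lemma torsion_eq: "torsion R I M = M\<lparr>carrier := torsion_set R I M\<rparr>"
  by (simp add: torsion_def torsion_set_def)

lemma torsion_set_submodule:
  assumes M: "module R M" and I: "ideal I R" shows "submodule (torsion_set R I M) R M"
proof -
  interpret M: module R M by fact
  note R = M.is_cring
  have carr: "a \<in> carrier R" if "a \<in> I [^]\<^bsub>ideals_set R\<^esub> n" for a and n :: nat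
    using ideal.Icarr[OF ideal_power_ideal[OF R I] that] .
  show ?thesis
  proof (rule submoduleI'[OF M])
    show "torsion_set R I M \<subseteq> carrier M" by (auto simp: torsion_set_def)
    show "\<zero>\<^bsub>M\<^esub> \<in> torsion_set R I M" using carr by (auto simp: torsion_set_def)
    show "x \<oplus>\<^bsub>M\<^esub> y \<in> torsion_set R I M" if x: "x \<in> torsion_set R I M" and y: "y \<in> torsion_set R I M" for x y
    proof -
      obtain n k :: nat where n: "\<forall>a \<in> I [^]\<^bsub>ideals_set R\<^esub> n. a \<odot>\<^bsub>M\<^esub> x = \<zero>\<^bsub>M\<^esub>"
        and k: "\<forall>a \<in> I [^]\<^bsub>ideals_set R\<^esub> k. a \<odot>\<^bsub>M\<^esub> y = \<zero>\<^bsub>M\<^esub>"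
        using x y by (auto simp: torsion_set_def)
      have xy: "x \<in> carrier M" "y \<in> carrier M" using x y by (auto simp: torsion_set_def)
      have "a \<odot>\<^bsub>M\<^esub> (x \<oplus>\<^bsub>M\<^esub> y) = \<zero>\<^bsub>M\<^esub>" if a: "a \<in> I [^]\<^bsub>ideals_set R\<^esub> (n + k)" for a
      proof -
        have "a \<in> I [^]\<^bsub>ideals_set R\<^esub> n" "a \<in> I [^]\<^bsub>ideals_set R\<^esub> k"
          using a ideal_power_decreasing[OF R I, of n k] ideal_power_decreasing[OF R I, of k n]
          by (auto simp: add.commute)
        then show ?thesis using n k xy carr[OF a] by (simp add: M.smult_r_distr)
      qed
      then show ?thesis using xy unfolding torsion_set_def by blast
    qed
    show "r \<odot>\<^bsub>M\<^esub> x \<in> torsion_set R I M" if r: "r \<in> carrier R" and x: "x \<in> torsion_set R I M" for r x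
    proof -
      obtain n :: nat where n: "\<forall>a \<in> I [^]\<^bsub>ideals_set R\<^esub> n. a \<odot>\<^bsub>M\<^esub> x = \<zero>\<^bsub>M\<^esub>" using x by (auto simp: torsion_set_def)
      have xM: "x \<in> carrier M" using x by (auto simp: torsion_set_def)
      have "a \<odot>\<^bsub>M\<^esub> (r \<odot>\<^bsub>M\<^esub> x) = \<zero>\<^bsub>M\<^esub>" if a: "a \<in> I [^]\<^bsub>ideals_set R\<^esub> n" for a
        using M.smult_assoc1[OF carr[OF a] r xM] M.smult_assoc1[OF r carr[OF a] xM] M.R.m_comm[OF r carr[OF a]]
          bspec[OF n a] r by simp
      then show ?thesis using xM r unfolding torsion_set_def by blast
    qed
  qed
qed

text \<open>
  If \<open>grade(I, R)\<close> is infinite by convention, then \<open>I = R\<close>, and \<open>\<one> \<in> I\<^sup>k\<close> kills the Ext modules.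
  Otherwise a regular sequence of length greater than \<open>i\<close> does it.
\<close>

lemma ext_vanishing_below_grade:
  assumes R: "cring R" and I: "ideal I R" and qr: "quotient_resolution R (I [^]\<^bsub>ideals_set R\<^esub> (k::nat)) m d"
    and i: "enat i < grade R I (self_module R)" and j: "j \<le> i"
  shows "quotient_resolution.ext_torsion R m d \<one>\<^bsub>R\<^esub> (self_module R) j"
proof -
  interpret R: cring R by fact
  interpret qr: quotient_resolution R "I [^]\<^bsub>ideals_set R\<^esub> k" m d by fact
  interpret I: ideal I R by fact
  note J = ideal_power_ideal[OF R I, of k]
  show ?thesis
  proof (cases "set_smult R I (self_module R) = carrier (self_module R)")
    case True
    have "I \<subseteq> carrier R" using I.a_subset .
    then have "set_smult R I (self_module R) \<subseteq> I" using set_smult_self_subset_iff[OF R _ I] by simp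
    then have "\<one>\<^bsub>R\<^esub> \<in> I" using True by auto
    then have "\<one>\<^bsub>R\<^esub> \<in> I [^]\<^bsub>ideals_set R\<^esub> k" using power_mem_ideal_power[OF R I, of "\<one>\<^bsub>R\<^esub>" k] by simp
    then show ?thesis by (rule qr.ext_torsion_of_mem[OF J _ self_module_module[OF R]])
  next
    case False
    then have "enat i < Sup {enat (length xs) | xs. set xs \<subseteq> I \<and> regular_sequence R (self_module R) xs}"
      using i by (simp add: grade_def)
    then obtain xs where xs: "set xs \<subseteq> I" "regular_sequence R (self_module R) xs" "i < length xs"
      unfolding less_Sup_iff by auto
    show ?thesis
    proof (rule qr.ext_vanishing_of_regular_sequence[OF J xs(2)])
      show "\<exists>n::nat. x [^]\<^bsub>R\<^esub> n \<in> I [^]\<^bsub>ideals_set R\<^esub> k" if "x \<in> set xs" for x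
        using power_mem_ideal_power[OF R I, of x k] that xs(1) by blast
    qed (use j xs(3) in simp)
  qed
qed

text \<open>
  A cocycle in the \<open>I\<close>-torsion of an injective resolution is killed by some \<open>I\<^sup>k\<close>, so
  \<open>injective_resolution_cocycle\<close> for \<open>J = I\<^sup>k\<close> makes it a coboundary.
\<close>

lemma local_cohomology_vanishing:
  fixes M :: "('a, 'a univ) module"
  assumes R: "cring R" and noeth: "noetherian_ring R" and M: "module R M" and b0: "grade_defect_bounded R M 0"
    and I: "ideal I R" and i: "enat i < grade R I (self_module R)" and H: "is_local_cohomology R I i M H"
    and h: "h \<in> carrier H"
  shows "h = \<zero>\<^bsub>H\<^esub>" and "module R H"
proof -
  obtain \<epsilon> E \<delta> where res: "injective_resolution R M \<epsilon> E \<delta>"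
    and Hd: "H = cohomology (\<lambda>j. torsion R I (E j)) \<delta> i"
    using H unfolding is_local_cohomology_def by blast
  note res' = res[unfolded injective_resolution_def]
  have E: "module R (E j)" for j using res' by (simp add: injective_module_def)
  have \<delta>: "\<delta> j \<in> mod_hom R (E j) (E (Suc j))" for j using res' by simp
  have ds: "\<delta> j ` carrier (E j) = mod_ker (E (Suc j)) (E (Suc (Suc j))) (\<delta> (Suc j))" for j using res' by simp
  let ?\<Gamma> = "\<lambda>j. torsion_set R I (E j)"
  let ?C = "\<lambda>j. E j\<lparr>carrier := ?\<Gamma> j\<rparr>"
  note \<Gamma> = torsion_set_submodule[OF E I]
  have C: "module R (?C j)" for j by (rule module_restrict[OF E \<Gamma>])
  have d\<Gamma>: "\<delta> j x \<in> ?\<Gamma> (Suc j)" if x\<Gamma>: "x \<in> ?\<Gamma> j" for j x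
  proof -
    obtain n :: nat where n: "\<forall>a \<in> I [^]\<^bsub>ideals_set R\<^esub> n. a \<odot>\<^bsub>E j\<^esub> x = \<zero>\<^bsub>E j\<^esub>" and x: "x \<in> carrier (E j)"
      using x\<Gamma> unfolding torsion_set_def by blast
    have "a \<odot>\<^bsub>E (Suc j)\<^esub> \<delta> j x = \<zero>\<^bsub>E (Suc j)\<^esub>" if a: "a \<in> I [^]\<^bsub>ideals_set R\<^esub> n" for a
      using mod_hom_smult[OF \<delta> ideal.Icarr[OF ideal_power_ideal[OF R I] a] x] n a mod_hom_zero[OF \<delta> E E] by simp
    then show ?thesis using mod_hom_closed[OF \<delta> x] unfolding torsion_set_def by blast
  qed
  have dC: "\<delta> j \<in> mod_hom R (?C j) (?C (Suc j))" for j
    by (rule mod_hom_corestrict[OF mod_hom_restrict[OF \<delta> submodule_subset[OF E \<Gamma>]]]) (auto intro: d\<Gamma>)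
  let ?K = "mod_ker (?C i) (?C (Suc i)) (\<delta> i)"
  let ?B = "case i of 0 \<Rightarrow> {\<zero>\<^bsub>?C 0\<^esub>} | Suc j \<Rightarrow> \<delta> j ` carrier (?C j)"
  let ?Z = "?C i\<lparr>carrier := ?K\<rparr>"
  have K: "submodule ?K R (?C i)" by (rule mod_ker_submodule[OF dC C C])
  have Z: "module R ?Z" by (rule module_restrict[OF C K])
  have Heq: "H = quotient_module ?Z ?B" unfolding Hd cohomology_def torsion_eq ..
  have B: "submodule ?B R (?C i)"
  proof (cases i)
    case 0
    then show ?thesis using submodule_zero_set[OF C, of 0] by simp
  next
    case (Suc j)
    then show ?thesis
      using submodule_image[OF dC C C module.carrier_is_submodule[OF C], of j] by simp
  qed
  have BK: "?B \<subseteq> ?K"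
  proof (cases i)
    case 0
    then show ?thesis using submodule_zero[OF K] by simp
  next
    case (Suc j)
    have "\<delta> j x \<in> ?K" if x: "x \<in> ?\<Gamma> j" for x
    proof -
      have "x \<in> carrier (E j)" using x by (simp add: torsion_set_def)
      then have "\<delta> j x \<in> mod_ker (E (Suc j)) (E (Suc (Suc j))) (\<delta> (Suc j))" using ds[of j] by blast
      then show ?thesis using d\<Gamma>[OF x] Suc by (simp add: mod_ker_def)
    qed
    then show ?thesis using Suc by auto
  qed
  have BZ: "submodule ?B R ?Z" using B BK submodule_restrict_iff[OF C K] by blast
  show "module R H" unfolding Heq by (rule quotient_module_module[OF Z BZ])
  obtain z where z: "z \<in> carrier ?Z" "h = ?B +>\<^bsub>?Z\<^esub> z" using h unfolding Heq by (rule quotient_moduleE)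
  have z\<Gamma>: "z \<in> ?\<Gamma> i" and dz: "\<delta> i z = \<zero>\<^bsub>E (Suc i)\<^esub>" using z(1) by (auto simp: mod_ker_def)
  obtain k :: nat where k: "\<And>a. a \<in> I [^]\<^bsub>ideals_set R\<^esub> k \<Longrightarrow> a \<odot>\<^bsub>E i\<^esub> z = \<zero>\<^bsub>E i\<^esub>" and zE: "z \<in> carrier (E i)"
    using z\<Gamma> unfolding torsion_set_def by blast
  note J = ideal_power_ideal[OF R I, of k]
  obtain m d where qr: "quotient_resolution R (I [^]\<^bsub>ideals_set R\<^esub> k) m d"
    using exists_quotient_resolution[OF R noeth J] by blast
  interpret qr: quotient_resolution R "I [^]\<^bsub>ideals_set R\<^esub> k" m d by fact
  have t: "qr.ext_torsion \<one>\<^bsub>R\<^esub> M j" if "j \<le> i" for j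
  proof (rule b0[unfolded grade_defect_bounded_def, rule_format, OF qr, of "Suc i"])
    show "qr.ext_torsion \<one>\<^bsub>R\<^esub> (self_module R) l" if "l < Suc i" for l
      by (rule ext_vanishing_below_grade[OF R I qr i]) (use that in simp)
  qed (use that in simp)
  note cocycle = qr.injective_resolution_cocycle[OF J M res t zE dz k]
  have "z \<in> ?B"
  proof (cases i)
    case 0
    then show ?thesis using cocycle by simp
  next
    case (Suc b)
    then obtain y where y: "y \<in> carrier (E b)" "\<delta> b y = z" "\<forall>a\<in>I [^]\<^bsub>ideals_set R\<^esub> k. a \<odot>\<^bsub>E b\<^esub> y = \<zero>\<^bsub>E b\<^esub>"
      using cocycle by auto
    then have "y \<in> ?\<Gamma> b" unfolding torsion_set_def by blast
    then show ?thesis using y(2) Suc by auto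
  qed
  then show "h = \<zero>\<^bsub>H\<^esub>" unfolding z(2) Heq using quotient_module_eq_zero_iff[OF Z BZ z(1)] by simp
qed

lemma R_cat_membership:
  fixes M :: "('a, 'a univ) module"
  assumes R: "cring R" and noeth: "noetherian_ring R" and p: "primeideal \<pp> R"
    and M: "module R M" and fg: "fin_gen R M" and b0: "grade_defect_bounded R M 0"
  shows "M \<in> R_cat R \<pp>"
proof -
  have "\<one>\<^bsub>R\<^esub> \<odot>\<^bsub>H\<^esub> h = \<zero>\<^bsub>H\<^esub>"
    if I: "ideal I R" and i: "enat i < grade R I (self_module R)" and H: "is_local_cohomology R I i M H" and h: "h \<in> carrier H"
    for I i H h
  proof -
    note v = local_cohomology_vanishing[OF R noeth M b0 I i H h]
    interpret H: module R H by (rule v(2))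
    show ?thesis using v(1) by simp
  qed
  then show ?thesis
    using M fg primeideal_one_notin[OF p] unfolding R_cat_def fg_modules_def by blast
qed


section \<open>Localization\<close>

locale localization =
  fixes R :: "('a, 'r) ring_scheme" and \<qq> :: "'a set"
  assumes R: "cring R" and q: "primeideal \<qq> R"
begin

abbreviation U where "U \<equiv> carrier R - \<qq>"
abbreviation Rq where "Rq \<equiv> loc_ring R \<qq>"
abbreviation loc where "loc M \<equiv> loc_module R \<qq> M"

lemma U_mult: "s \<in> U \<Longrightarrow> t \<in> U \<Longrightarrow> s \<otimes>\<^bsub>R\<^esub> t \<in> U"
  by (rule primeideal_mult_notin[OF q])

lemma U_one: "\<one>\<^bsub>R\<^esub> \<in> U"
  by (rule primeideal_one_notin[OF q])

lemma smult_swap: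
  assumes "module R M" "a \<in> carrier R" "b \<in> carrier R" "x \<in> carrier M"
  shows "a \<odot>\<^bsub>M\<^esub> (b \<odot>\<^bsub>M\<^esub> x) = b \<odot>\<^bsub>M\<^esub> (a \<odot>\<^bsub>M\<^esub> x)"
proof -
  interpret M: module R M by fact
  show ?thesis using assms M.smult_assoc1[of a b x] M.smult_assoc1[of b a x] M.R.m_comm[of a b] by simp
qed

lemma frac_eq_iff:
  assumes M: "module R M" and m: "m \<in> carrier M" "m' \<in> carrier M" and s: "s \<in> U" "s' \<in> U"
  shows "frac R \<qq> M m s = frac R \<qq> M m' s' \<longleftrightarrow> (\<exists>t\<in>U. t \<odot>\<^bsub>M\<^esub> (s' \<odot>\<^bsub>M\<^esub> m) = t \<odot>\<^bsub>M\<^esub> (s \<odot>\<^bsub>M\<^esub> m'))"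
proof
  interpret M: module R M by fact
  assume "frac R \<qq> M m s = frac R \<qq> M m' s'"
  moreover have "(m', s') \<in> frac R \<qq> M m' s'" using m s U_one by (auto simp: frac_def)
  ultimately have "(m', s') \<in> frac R \<qq> M m s" by simp
  then show "\<exists>t\<in>U. t \<odot>\<^bsub>M\<^esub> (s' \<odot>\<^bsub>M\<^esub> m) = t \<odot>\<^bsub>M\<^esub> (s \<odot>\<^bsub>M\<^esub> m')" by (simp add: frac_def)
next
  interpret M: module R M by fact
  assume "\<exists>t\<in>U. t \<odot>\<^bsub>M\<^esub> (s' \<odot>\<^bsub>M\<^esub> m) = t \<odot>\<^bsub>M\<^esub> (s \<odot>\<^bsub>M\<^esub> m')"
  then obtain t where t: "t \<in> U" "t \<odot>\<^bsub>M\<^esub> (s' \<odot>\<^bsub>M\<^esub> m) = t \<odot>\<^bsub>M\<^esub> (s \<odot>\<^bsub>M\<^esub> m')" ..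
  \<comment> \<open>Transitivity of the relation between numerators and denominators.\<close>
  have trans: "\<exists>v\<in>U. v \<odot>\<^bsub>M\<^esub> (s2 \<odot>\<^bsub>M\<^esub> m0) = v \<odot>\<^bsub>M\<^esub> (s0 \<odot>\<^bsub>M\<^esub> m2)"
    if c: "m0 \<in> carrier M" "m1 \<in> carrier M" "m2 \<in> carrier M" "s0 \<in> U" "s1 \<in> U" "s2 \<in> U" "t \<in> U" "u \<in> U"
      and e: "t \<odot>\<^bsub>M\<^esub> (s1 \<odot>\<^bsub>M\<^esub> m0) = t \<odot>\<^bsub>M\<^esub> (s0 \<odot>\<^bsub>M\<^esub> m1)" "u \<odot>\<^bsub>M\<^esub> (s2 \<odot>\<^bsub>M\<^esub> m1) = u \<odot>\<^bsub>M\<^esub> (s1 \<odot>\<^bsub>M\<^esub> m2)"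
    for m0 m1 m2 s0 s1 s2 t u
  proof -
    have r: "s0 \<in> carrier R" "s1 \<in> carrier R" "s2 \<in> carrier R" "t \<in> carrier R" "u \<in> carrier R" using c by auto
    note sw = smult_swap[OF M]
    have "(t \<otimes>\<^bsub>R\<^esub> u \<otimes>\<^bsub>R\<^esub> s1) \<odot>\<^bsub>M\<^esub> (s2 \<odot>\<^bsub>M\<^esub> m0) = u \<odot>\<^bsub>M\<^esub> (s2 \<odot>\<^bsub>M\<^esub> (t \<odot>\<^bsub>M\<^esub> (s1 \<odot>\<^bsub>M\<^esub> m0)))"
      using r c by (simp add: M.smult_assoc1[symmetric] M.R.m_ac del: M.smult_assoc1)
    also have "\<dots> = t \<odot>\<^bsub>M\<^esub> (s0 \<odot>\<^bsub>M\<^esub> (u \<odot>\<^bsub>M\<^esub> (s2 \<odot>\<^bsub>M\<^esub> m1)))"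
      unfolding e(1) using r c by (simp add: M.smult_assoc1[symmetric] M.R.m_ac)
    also have "\<dots> = (t \<otimes>\<^bsub>R\<^esub> u \<otimes>\<^bsub>R\<^esub> s1) \<odot>\<^bsub>M\<^esub> (s0 \<odot>\<^bsub>M\<^esub> m2)"
      unfolding e(2) using r c by (simp add: M.smult_assoc1[symmetric] M.R.m_ac)
    finally show ?thesis using U_mult c by (intro bexI[of _ "t \<otimes>\<^bsub>R\<^esub> u \<otimes>\<^bsub>R\<^esub> s1"]) auto
  qed
  show "frac R \<qq> M m s = frac R \<qq> M m' s'"
  proof (intro equalityI subsetI)
    fix p assume "p \<in> frac R \<qq> M m s"
    then obtain m2 s2 u where p: "p = (m2, s2)" "m2 \<in> carrier M" "s2 \<in> U" "u \<in> U" "u \<odot>\<^bsub>M\<^esub> (s2 \<odot>\<^bsub>M\<^esub> m) = u \<odot>\<^bsub>M\<^esub> (s \<odot>\<^bsub>M\<^esub> m2)"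
      unfolding frac_def by blast
    show "p \<in> frac R \<qq> M m' s'"
      using trans[OF m(2,1) p(2) s(2,1) p(3) t(1) p(4) t(2)[symmetric] p(5)] p unfolding frac_def by blast
  next
    fix p assume "p \<in> frac R \<qq> M m' s'"
    then obtain m2 s2 u where p: "p = (m2, s2)" "m2 \<in> carrier M" "s2 \<in> U" "u \<in> U" "u \<odot>\<^bsub>M\<^esub> (s2 \<odot>\<^bsub>M\<^esub> m') = u \<odot>\<^bsub>M\<^esub> (s' \<odot>\<^bsub>M\<^esub> m2)"
      unfolding frac_def by blast
    show "p \<in> frac R \<qq> M m s"
      using trans[OF m p(2) s p(3) t(1) p(4) t(2) p(5)] p unfolding frac_def by blast
  qed
qed

lemma frac_mem: 
  assumes "module R M" "m \<in> carrier M" "s \<in> U" shows "(m, s) \<in> frac R \<qq> M m s"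
  using assms U_one by (auto simp: frac_def)

lemma frac_memD:
  assumes M: "module R M" and m: "m \<in> carrier M" "s \<in> U" and p: "(m', s') \<in> frac R \<qq> M m s"
  shows "m' \<in> carrier M" "s' \<in> U" "frac R \<qq> M m' s' = frac R \<qq> M m s"
proof -
  show c: "m' \<in> carrier M" "s' \<in> U" using p by (auto simp: frac_def)
  have "\<exists>t\<in>U. t \<odot>\<^bsub>M\<^esub> (s' \<odot>\<^bsub>M\<^esub> m) = t \<odot>\<^bsub>M\<^esub> (s \<odot>\<^bsub>M\<^esub> m')" using p by (simp add: frac_def)
  then show "frac R \<qq> M m' s' = frac R \<qq> M m s" using frac_eq_iff[OF M m(1) c(1) m(2) c(2)] by simp
qed

lemma frac_cancel:
  assumes M: "module R M" and m: "m \<in> carrier M" and s: "s \<in> U" "u \<in> U"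
  shows "frac R \<qq> M (u \<odot>\<^bsub>M\<^esub> m) (u \<otimes>\<^bsub>R\<^esub> s) = frac R \<qq> M m s"
proof -
  interpret M: module R M by fact
  have r: "s \<in> carrier R" "u \<in> carrier R" using s by auto
  have "\<one>\<^bsub>R\<^esub> \<odot>\<^bsub>M\<^esub> (s \<odot>\<^bsub>M\<^esub> (u \<odot>\<^bsub>M\<^esub> m)) = \<one>\<^bsub>R\<^esub> \<odot>\<^bsub>M\<^esub> ((u \<otimes>\<^bsub>R\<^esub> s) \<odot>\<^bsub>M\<^esub> m)"
    using r m M.smult_assoc1[of s u m] M.R.m_comm[of s u] by simp
  then show ?thesis
    using frac_eq_iff[OF M _ m U_mult[OF s(2,1)] s(1), of "u \<odot>\<^bsub>M\<^esub> m"] U_one r m by auto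
qed

lemma loc_carrier: "carrier (loc M) = {frac R \<qq> M m s | m s. m \<in> carrier M \<and> s \<in> U}"
  by (simp add: loc_module_def)

lemma locI: "m \<in> carrier M \<Longrightarrow> s \<in> U \<Longrightarrow> frac R \<qq> M m s \<in> carrier (loc M)"
  unfolding loc_carrier by blast

lemma locE:
  assumes "X \<in> carrier (loc M)" obtains m s where "m \<in> carrier M" "s \<in> U" "X = frac R \<qq> M m s"
  using assms unfolding loc_carrier by blast

text \<open>With common denominators the module axioms reduce to those of \<open>M\<close>.\<close>

lemma loc_common:
  assumes M: "module R M" and X: "X \<in> carrier (loc M)" "Y \<in> carrier (loc M)"
  obtains m n s where "m \<in> carrier M" "n \<in> carrier M" "s \<in> U" "X = frac R \<qq> M m s" "Y = frac R \<qq> M n s"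
proof -
  interpret M: module R M by fact
  obtain m s where m: "m \<in> carrier M" "s \<in> U" "X = frac R \<qq> M m s" using X(1) by (rule locE)
  obtain n t where n: "n \<in> carrier M" "t \<in> U" "Y = frac R \<qq> M n t" using X(2) by (rule locE)
  show ?thesis
  proof (rule that[of "t \<odot>\<^bsub>M\<^esub> m" "s \<odot>\<^bsub>M\<^esub> n" "t \<otimes>\<^bsub>R\<^esub> s"])
    show "X = frac R \<qq> M (t \<odot>\<^bsub>M\<^esub> m) (t \<otimes>\<^bsub>R\<^esub> s)" using frac_cancel[OF M m(1,2) n(2)] m(3) by simp
    have "t \<otimes>\<^bsub>R\<^esub> s = s \<otimes>\<^bsub>R\<^esub> t" using m n M.R.m_comm by simp
    then show "Y = frac R \<qq> M (s \<odot>\<^bsub>M\<^esub> n) (t \<otimes>\<^bsub>R\<^esub> s)" using frac_cancel[OF M n(1,2) m(2)] n(3) by simp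
    show "t \<otimes>\<^bsub>R\<^esub> s \<in> U" by (rule U_mult[OF n(2) m(2)])
  qed (use m n in auto)
qed

lemma loc_common3:
  assumes M: "module R M" and X: "X \<in> carrier (loc M)" "Y \<in> carrier (loc M)" "Z \<in> carrier (loc M)"
  obtains m n p s where "m \<in> carrier M" "n \<in> carrier M" "p \<in> carrier M" "s \<in> U"
    "X = frac R \<qq> M m s" "Y = frac R \<qq> M n s" "Z = frac R \<qq> M p s"
proof -
  interpret M: module R M by fact
  obtain m n s where m: "m \<in> carrier M" "n \<in> carrier M" "s \<in> U" "X = frac R \<qq> M m s" "Y = frac R \<qq> M n s"
    by (rule loc_common[OF M X(1,2)])
  obtain p t where p: "p \<in> carrier M" "t \<in> U" "Z = frac R \<qq> M p t" using X(3) by (rule locE)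
  show ?thesis
  proof (rule that[of "t \<odot>\<^bsub>M\<^esub> m" "t \<odot>\<^bsub>M\<^esub> n" "s \<odot>\<^bsub>M\<^esub> p" "t \<otimes>\<^bsub>R\<^esub> s"])
    show "X = frac R \<qq> M (t \<odot>\<^bsub>M\<^esub> m) (t \<otimes>\<^bsub>R\<^esub> s)" "Y = frac R \<qq> M (t \<odot>\<^bsub>M\<^esub> n) (t \<otimes>\<^bsub>R\<^esub> s)"
      using frac_cancel[OF M m(1,3) p(2)] frac_cancel[OF M m(2,3) p(2)] m by simp_all
    have "t \<otimes>\<^bsub>R\<^esub> s = s \<otimes>\<^bsub>R\<^esub> t" using m p M.R.m_comm by simp
    then show "Z = frac R \<qq> M (s \<odot>\<^bsub>M\<^esub> p) (t \<otimes>\<^bsub>R\<^esub> s)" using frac_cancel[OF M p(1,2) m(3)] p(3) by simp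
    show "t \<otimes>\<^bsub>R\<^esub> s \<in> U" by (rule U_mult[OF p(2) m(3)])
  qed (use m p in auto)
qed

lemma loc_add_general:
  assumes M: "module R M" and m: "m \<in> carrier M" "s \<in> U" and n: "n \<in> carrier M" "t \<in> U"
  shows "frac R \<qq> M m s \<oplus>\<^bsub>loc M\<^esub> frac R \<qq> M n t = frac R \<qq> M (t \<odot>\<^bsub>M\<^esub> m \<oplus>\<^bsub>M\<^esub> s \<odot>\<^bsub>M\<^esub> n) (s \<otimes>\<^bsub>R\<^esub> t)"
proof -
  interpret M: module R M by fact
  let ?F = "\<lambda>m s n t. frac R \<qq> M (t \<odot>\<^bsub>M\<^esub> m \<oplus>\<^bsub>M\<^esub> s \<odot>\<^bsub>M\<^esub> n) (s \<otimes>\<^bsub>R\<^esub> t)"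
  have wd: "?F m' s' n' t' = ?F m s n t"
    if m': "(m', s') \<in> frac R \<qq> M m s" and n': "(n', t') \<in> frac R \<qq> M n t" for m' s' n' t'
  proof -
    note cm = frac_memD[OF M m m'] and cn = frac_memD[OF M n n']
    obtain a where a: "a \<in> U" "a \<odot>\<^bsub>M\<^esub> (s' \<odot>\<^bsub>M\<^esub> m) = a \<odot>\<^bsub>M\<^esub> (s \<odot>\<^bsub>M\<^esub> m')"
      using m' by (auto simp: frac_def)
    obtain b where b: "b \<in> U" "b \<odot>\<^bsub>M\<^esub> (t' \<odot>\<^bsub>M\<^esub> n) = b \<odot>\<^bsub>M\<^esub> (t \<odot>\<^bsub>M\<^esub> n')"
      using n' by (auto simp: frac_def)
    have r: "a \<in> carrier R" "b \<in> carrier R" "s \<in> carrier R" "t \<in> carrier R" "s' \<in> carrier R" "t' \<in> carrier R"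
      using a b m n cm cn by auto
    note z = m(1) n(1) cm(1) cn(1)
    note flat = M.smult_assoc1[symmetric] M.R.m_ac
    have 1: "(a \<otimes>\<^bsub>R\<^esub> b) \<odot>\<^bsub>M\<^esub> ((s' \<otimes>\<^bsub>R\<^esub> t') \<odot>\<^bsub>M\<^esub> (t \<odot>\<^bsub>M\<^esub> m)) = (a \<otimes>\<^bsub>R\<^esub> b) \<odot>\<^bsub>M\<^esub> ((s \<otimes>\<^bsub>R\<^esub> t) \<odot>\<^bsub>M\<^esub> (t' \<odot>\<^bsub>M\<^esub> m'))"
    proof -
      have "(a \<otimes>\<^bsub>R\<^esub> b) \<odot>\<^bsub>M\<^esub> ((s' \<otimes>\<^bsub>R\<^esub> t') \<odot>\<^bsub>M\<^esub> (t \<odot>\<^bsub>M\<^esub> m)) = (b \<otimes>\<^bsub>R\<^esub> t' \<otimes>\<^bsub>R\<^esub> t) \<odot>\<^bsub>M\<^esub> (a \<odot>\<^bsub>M\<^esub> (s' \<odot>\<^bsub>M\<^esub> m))"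
        using r z by (simp add: flat)
      also have "\<dots> = (a \<otimes>\<^bsub>R\<^esub> b) \<odot>\<^bsub>M\<^esub> ((s \<otimes>\<^bsub>R\<^esub> t) \<odot>\<^bsub>M\<^esub> (t' \<odot>\<^bsub>M\<^esub> m'))"
        unfolding a(2) using r z by (simp add: flat)
      finally show ?thesis .
    qed
    have 2: "(a \<otimes>\<^bsub>R\<^esub> b) \<odot>\<^bsub>M\<^esub> ((s' \<otimes>\<^bsub>R\<^esub> t') \<odot>\<^bsub>M\<^esub> (s \<odot>\<^bsub>M\<^esub> n)) = (a \<otimes>\<^bsub>R\<^esub> b) \<odot>\<^bsub>M\<^esub> ((s \<otimes>\<^bsub>R\<^esub> t) \<odot>\<^bsub>M\<^esub> (s' \<odot>\<^bsub>M\<^esub> n'))"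
    proof -
      have "(a \<otimes>\<^bsub>R\<^esub> b) \<odot>\<^bsub>M\<^esub> ((s' \<otimes>\<^bsub>R\<^esub> t') \<odot>\<^bsub>M\<^esub> (s \<odot>\<^bsub>M\<^esub> n)) = (a \<otimes>\<^bsub>R\<^esub> s' \<otimes>\<^bsub>R\<^esub> s) \<odot>\<^bsub>M\<^esub> (b \<odot>\<^bsub>M\<^esub> (t' \<odot>\<^bsub>M\<^esub> n))"
        using r z by (simp add: flat)
      also have "\<dots> = (a \<otimes>\<^bsub>R\<^esub> b) \<odot>\<^bsub>M\<^esub> ((s \<otimes>\<^bsub>R\<^esub> t) \<odot>\<^bsub>M\<^esub> (s' \<odot>\<^bsub>M\<^esub> n'))"
        unfolding b(2) using r z by (simp add: flat)
      finally show ?thesis .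
    qed
    have "(a \<otimes>\<^bsub>R\<^esub> b) \<odot>\<^bsub>M\<^esub> ((s' \<otimes>\<^bsub>R\<^esub> t') \<odot>\<^bsub>M\<^esub> (t \<odot>\<^bsub>M\<^esub> m \<oplus>\<^bsub>M\<^esub> s \<odot>\<^bsub>M\<^esub> n)) =
        (a \<otimes>\<^bsub>R\<^esub> b) \<odot>\<^bsub>M\<^esub> ((s \<otimes>\<^bsub>R\<^esub> t) \<odot>\<^bsub>M\<^esub> (t' \<odot>\<^bsub>M\<^esub> m' \<oplus>\<^bsub>M\<^esub> s' \<odot>\<^bsub>M\<^esub> n'))"
      using 1 2 r z by (simp add: M.smult_r_distr)
    then have "?F m s n t = ?F m' s' n' t'"
      using frac_eq_iff[OF M _ _ U_mult[OF m(2) n(2)] U_mult[OF cm(2) cn(2)],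
          of "t \<odot>\<^bsub>M\<^esub> m \<oplus>\<^bsub>M\<^esub> s \<odot>\<^bsub>M\<^esub> n" "t' \<odot>\<^bsub>M\<^esub> m' \<oplus>\<^bsub>M\<^esub> s' \<odot>\<^bsub>M\<^esub> n'"] r z U_mult[OF a(1) b(1)] by auto
    then show ?thesis by simp
  qed
  have "frac R \<qq> M m s \<oplus>\<^bsub>loc M\<^esub> frac R \<qq> M n t =
    (\<Union>p\<in>frac R \<qq> M m s. \<Union>r\<in>frac R \<qq> M n t. ?F (fst p) (snd p) (fst r) (snd r))"
    by (simp add: loc_module_def case_prod_beta)
  also have "\<dots> = (\<Union>p\<in>frac R \<qq> M m s. \<Union>r\<in>frac R \<qq> M n t. ?F m s n t)"
    using wd by (intro SUP_cong refl) simp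
  also have "\<dots> = ?F m s n t"
    using frac_mem[OF M m] frac_mem[OF M n] by auto
  finally show ?thesis .
qed

lemma loc_add:
  assumes M: "module R M" and m: "m \<in> carrier M" "n \<in> carrier M" "s \<in> U"
  shows "frac R \<qq> M m s \<oplus>\<^bsub>loc M\<^esub> frac R \<qq> M n s = frac R \<qq> M (m \<oplus>\<^bsub>M\<^esub> n) s"
proof -
  interpret M: module R M by fact
  have "s \<odot>\<^bsub>M\<^esub> m \<oplus>\<^bsub>M\<^esub> s \<odot>\<^bsub>M\<^esub> n = s \<odot>\<^bsub>M\<^esub> (m \<oplus>\<^bsub>M\<^esub> n)" using m by (simp add: M.smult_r_distr)
  then show ?thesis
    using loc_add_general[OF M m(1,3,2,3)] frac_cancel[OF M _ m(3) m(3), of "m \<oplus>\<^bsub>M\<^esub> n"] m by simp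
qed

lemma loc_zero: "\<zero>\<^bsub>loc M\<^esub> = frac R \<qq> M \<zero>\<^bsub>M\<^esub> \<one>\<^bsub>R\<^esub>"
  by (simp add: loc_module_def)

lemma frac_eq_zero_iff:
  assumes M: "module R M" and m: "m \<in> carrier M" "s \<in> U"
  shows "frac R \<qq> M m s = \<zero>\<^bsub>loc M\<^esub> \<longleftrightarrow> (\<exists>t\<in>U. t \<odot>\<^bsub>M\<^esub> m = \<zero>\<^bsub>M\<^esub>)"
proof -
  interpret M: module R M by fact
  have "(\<exists>t\<in>U. t \<odot>\<^bsub>M\<^esub> (\<one>\<^bsub>R\<^esub> \<odot>\<^bsub>M\<^esub> m) = t \<odot>\<^bsub>M\<^esub> (s \<odot>\<^bsub>M\<^esub> \<zero>\<^bsub>M\<^esub>)) \<longleftrightarrow> (\<exists>t\<in>U. t \<odot>\<^bsub>M\<^esub> m = \<zero>\<^bsub>M\<^esub>)"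
    using m by (intro bex_cong) auto
  then show ?thesis unfolding loc_zero using frac_eq_iff[OF M m(1) M.zero_closed m(2) U_one] by simp
qed

lemma frac_zero:
  assumes M: "module R M" and s: "s \<in> U" shows "frac R \<qq> M \<zero>\<^bsub>M\<^esub> s = \<zero>\<^bsub>loc M\<^esub>"
proof -
  interpret M: module R M by fact
  show ?thesis using frac_eq_zero_iff[OF M M.zero_closed s] U_one by auto
qed

lemma loc_smult:
  assumes M: "module R M" and a: "a \<in> carrier R" "s \<in> U" and m: "m \<in> carrier M" "t \<in> U"
  shows "frac R \<qq> (self_module R) a s \<odot>\<^bsub>loc M\<^esub> frac R \<qq> M m t = frac R \<qq> M (a \<odot>\<^bsub>M\<^esub> m) (s \<otimes>\<^bsub>R\<^esub> t)"
proof -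
  interpret M: module R M by fact
  note SM = self_module_module[OF R]
  let ?F = "\<lambda>a s m t. frac R \<qq> M (a \<odot>\<^bsub>M\<^esub> m) (s \<otimes>\<^bsub>R\<^esub> t)"
  have aS: "a \<in> carrier (self_module R)" using a by simp
  have wd: "?F a' s' m' t' = ?F a s m t"
    if a': "(a', s') \<in> frac R \<qq> (self_module R) a s" and m': "(m', t') \<in> frac R \<qq> M m t" for a' s' m' t'
  proof -
    note ca = frac_memD[OF SM aS a(2) a'] and cm = frac_memD[OF M m m']
    obtain u where u: "u \<in> U" "u \<otimes>\<^bsub>R\<^esub> (s' \<otimes>\<^bsub>R\<^esub> a) = u \<otimes>\<^bsub>R\<^esub> (s \<otimes>\<^bsub>R\<^esub> a')"
      using a' by (auto simp: frac_def)
    obtain v where v: "v \<in> U" "v \<odot>\<^bsub>M\<^esub> (t' \<odot>\<^bsub>M\<^esub> m) = v \<odot>\<^bsub>M\<^esub> (t \<odot>\<^bsub>M\<^esub> m')"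
      using m' by (auto simp: frac_def)
    have r: "u \<in> carrier R" "v \<in> carrier R" "s \<in> carrier R" "t \<in> carrier R" "s' \<in> carrier R" "t' \<in> carrier R"
      "a \<in> carrier R" "a' \<in> carrier R"
      using u v m a ca cm by auto
    note z = m(1) cm(1)
    note flat = M.smult_assoc1[symmetric] M.R.m_ac
    have "(u \<otimes>\<^bsub>R\<^esub> v) \<odot>\<^bsub>M\<^esub> ((s' \<otimes>\<^bsub>R\<^esub> t') \<odot>\<^bsub>M\<^esub> (a \<odot>\<^bsub>M\<^esub> m)) = (u \<otimes>\<^bsub>R\<^esub> (s' \<otimes>\<^bsub>R\<^esub> a)) \<odot>\<^bsub>M\<^esub> (v \<odot>\<^bsub>M\<^esub> (t' \<odot>\<^bsub>M\<^esub> m))"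
      using r z by (simp add: flat)
    also have "\<dots> = (u \<otimes>\<^bsub>R\<^esub> v) \<odot>\<^bsub>M\<^esub> ((s \<otimes>\<^bsub>R\<^esub> t) \<odot>\<^bsub>M\<^esub> (a' \<odot>\<^bsub>M\<^esub> m'))"
      unfolding u(2) v(2) using r z by (simp add: flat)
    finally have "?F a s m t = ?F a' s' m' t'"
      using frac_eq_iff[OF M _ _ U_mult[OF a(2) m(2)] U_mult[OF ca(2) cm(2)], of "a \<odot>\<^bsub>M\<^esub> m" "a' \<odot>\<^bsub>M\<^esub> m'"]
        r z U_mult[OF u(1) v(1)] by auto
    then show ?thesis by simp
  qed
  have "frac R \<qq> (self_module R) a s \<odot>\<^bsub>loc M\<^esub> frac R \<qq> M m t =
    (\<Union>p\<in>frac R \<qq> (self_module R) a s. \<Union>r\<in>frac R \<qq> M m t. ?F (fst p) (snd p) (fst r) (snd r))"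
    by (simp add: loc_module_def case_prod_beta)
  also have "\<dots> = (\<Union>p\<in>frac R \<qq> (self_module R) a s. \<Union>r\<in>frac R \<qq> M m t. ?F a s m t)"
    using wd by (intro SUP_cong refl) simp
  also have "\<dots> = ?F a s m t"
    using frac_mem[OF SM aS a(2)] frac_mem[OF M m] by auto
  finally show ?thesis .
qed

lemma loc_abelian_group:
  assumes M: "module R M" shows "abelian_group (loc M)"
proof -
  interpret M: module R M by fact
  note add = loc_add[OF M]
  show ?thesis
  proof (rule abelian_groupI)
    fix X Y assume X: "X \<in> carrier (loc M)" and Y: "Y \<in> carrier (loc M)"
    obtain m n s where c: "m \<in> carrier M" "n \<in> carrier M" "s \<in> U" "X = frac R \<qq> M m s" "Y = frac R \<qq> M n s"
      by (rule loc_common[OF M X Y])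
    show "X \<oplus>\<^bsub>loc M\<^esub> Y \<in> carrier (loc M)" using c add[OF c(1-3)] locI[of "m \<oplus>\<^bsub>M\<^esub> n" M s] by simp
    show "X \<oplus>\<^bsub>loc M\<^esub> Y = Y \<oplus>\<^bsub>loc M\<^esub> X" using c add[OF c(1-3)] add[OF c(2,1,3)] by (simp add: M.a_comm)
    fix Z assume Z: "Z \<in> carrier (loc M)"
    obtain m n p s where c: "m \<in> carrier M" "n \<in> carrier M" "p \<in> carrier M" "s \<in> U"
      "X = frac R \<qq> M m s" "Y = frac R \<qq> M n s" "Z = frac R \<qq> M p s"
      by (rule loc_common3[OF M X Y Z])
    show "X \<oplus>\<^bsub>loc M\<^esub> Y \<oplus>\<^bsub>loc M\<^esub> Z = X \<oplus>\<^bsub>loc M\<^esub> (Y \<oplus>\<^bsub>loc M\<^esub> Z)"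
      using c by (simp add: add M.a_assoc)
  next
    show "\<zero>\<^bsub>loc M\<^esub> \<in> carrier (loc M)" unfolding loc_zero by (rule locI[OF M.zero_closed U_one])
    fix X assume "X \<in> carrier (loc M)"
    then obtain m s where c: "m \<in> carrier M" "s \<in> U" "X = frac R \<qq> M m s" by (rule locE)
    show "\<zero>\<^bsub>loc M\<^esub> \<oplus>\<^bsub>loc M\<^esub> X = X"
      using add[OF M.zero_closed c(1,2)] c frac_zero[OF M c(2)] by simp
    have "frac R \<qq> M (\<ominus>\<^bsub>M\<^esub> m) s \<oplus>\<^bsub>loc M\<^esub> X = \<zero>\<^bsub>loc M\<^esub>"
      using add[OF M.a_inv_closed[OF c(1)] c(1,2)] c frac_zero[OF M c(2)] by (simp add: M.l_neg)
    then show "\<exists>Y\<in>carrier (loc M). Y \<oplus>\<^bsub>loc M\<^esub> X = \<zero>\<^bsub>loc M\<^esub>"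
      by (intro bexI[OF _ locI[OF M.a_inv_closed[OF c(1)] c(2)]])
  qed
qed

lemma Rq_simps:
  "carrier Rq = carrier (loc (self_module R))" "x \<otimes>\<^bsub>Rq\<^esub> y = x \<odot>\<^bsub>loc (self_module R)\<^esub> y"
  "\<one>\<^bsub>Rq\<^esub> = frac R \<qq> (self_module R) \<one>\<^bsub>R\<^esub> \<one>\<^bsub>R\<^esub>" "\<zero>\<^bsub>Rq\<^esub> = \<zero>\<^bsub>loc (self_module R)\<^esub>"
  "x \<oplus>\<^bsub>Rq\<^esub> y = x \<oplus>\<^bsub>loc (self_module R)\<^esub> y"
  by (simp_all add: loc_ring_def)

lemma RqE:
  assumes "A \<in> carrier Rq" obtains a s where "a \<in> carrier R" "s \<in> U" "A = frac R \<qq> (self_module R) a s"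
proof -
  obtain a s where "a \<in> carrier (self_module R)" "s \<in> U" "A = frac R \<qq> (self_module R) a s"
    using assms unfolding Rq_simps by (rule locE)
  then show ?thesis by (intro that[of a s]) simp_all
qed

lemma RqI: "a \<in> carrier R \<Longrightarrow> s \<in> U \<Longrightarrow> frac R \<qq> (self_module R) a s \<in> carrier Rq"
  unfolding Rq_simps by (rule locI) simp_all

lemma loc_smult_closed:
  assumes M: "module R M" and A: "A \<in> carrier Rq" and X: "X \<in> carrier (loc M)"
  shows "A \<odot>\<^bsub>loc M\<^esub> X \<in> carrier (loc M)"
proof -
  interpret M: module R M by fact
  obtain a s where a: "a \<in> carrier R" "s \<in> U" "A = frac R \<qq> (self_module R) a s" using A by (rule RqE)
  obtain m t where m: "m \<in> carrier M" "t \<in> U" "X = frac R \<qq> M m t" using X by (rule locE)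
  show ?thesis
    unfolding a(3) m(3) loc_smult[OF M a(1,2) m(1,2)] by (rule locI[OF M.smult_closed[OF a(1) m(1)] U_mult[OF a(2) m(2)]])
qed

lemma loc_smult_l_distr:
  assumes M: "module R M" and A: "A \<in> carrier Rq" "B \<in> carrier Rq" and X: "X \<in> carrier (loc M)"
  shows "(A \<oplus>\<^bsub>Rq\<^esub> B) \<odot>\<^bsub>loc M\<^esub> X = A \<odot>\<^bsub>loc M\<^esub> X \<oplus>\<^bsub>loc M\<^esub> B \<odot>\<^bsub>loc M\<^esub> X"
proof -
  interpret M: module R M by fact
  note SM = self_module_module[OF R]
  obtain a b s where a: "a \<in> carrier R" "b \<in> carrier R" "s \<in> U"
    "A = frac R \<qq> (self_module R) a s" "B = frac R \<qq> (self_module R) b s"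
    using loc_common[OF SM A[unfolded Rq_simps]] by auto
  obtain m t where m: "m \<in> carrier M" "t \<in> U" "X = frac R \<qq> M m t" using X by (rule locE)
  have "A \<oplus>\<^bsub>Rq\<^esub> B = frac R \<qq> (self_module R) (a \<oplus>\<^bsub>R\<^esub> b) s"
    using loc_add[OF SM, of a b s] a by (simp add: Rq_simps)
  then have "(A \<oplus>\<^bsub>Rq\<^esub> B) \<odot>\<^bsub>loc M\<^esub> X = frac R \<qq> M (a \<odot>\<^bsub>M\<^esub> m \<oplus>\<^bsub>M\<^esub> b \<odot>\<^bsub>M\<^esub> m) (s \<otimes>\<^bsub>R\<^esub> t)"
    using loc_smult[OF M _ a(3) m(1,2), of "a \<oplus>\<^bsub>R\<^esub> b"] a m by (simp add: M.smult_l_distr)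
  then show ?thesis
    using loc_add[OF M, of "a \<odot>\<^bsub>M\<^esub> m" "b \<odot>\<^bsub>M\<^esub> m" "s \<otimes>\<^bsub>R\<^esub> t"] a m U_mult[OF a(3) m(2)]
      loc_smult[OF M a(1,3) m(1,2)] loc_smult[OF M a(2,3) m(1,2)] by simp
qed

lemma loc_smult_r_distr:
  assumes M: "module R M" and A: "A \<in> carrier Rq" and X: "X \<in> carrier (loc M)" "Y \<in> carrier (loc M)"
  shows "A \<odot>\<^bsub>loc M\<^esub> (X \<oplus>\<^bsub>loc M\<^esub> Y) = A \<odot>\<^bsub>loc M\<^esub> X \<oplus>\<^bsub>loc M\<^esub> A \<odot>\<^bsub>loc M\<^esub> Y"
proof -
  interpret M: module R M by fact
  obtain a s where a: "a \<in> carrier R" "s \<in> U" "A = frac R \<qq> (self_module R) a s" using A by (rule RqE)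
  obtain m n t where m: "m \<in> carrier M" "n \<in> carrier M" "t \<in> U" "X = frac R \<qq> M m t" "Y = frac R \<qq> M n t"
    by (rule loc_common[OF M X])
  show ?thesis
    unfolding a(3) m(4,5) loc_add[OF M m(1-3)] loc_smult[OF M a(1,2) m(1,3)] loc_smult[OF M a(1,2) m(2,3)]
    using loc_smult[OF M a(1,2) _ m(3), of "m \<oplus>\<^bsub>M\<^esub> n"] a m
      loc_add[OF M, of "a \<odot>\<^bsub>M\<^esub> m" "a \<odot>\<^bsub>M\<^esub> n" "s \<otimes>\<^bsub>R\<^esub> t"] U_mult[OF a(2) m(3)]
    by (simp add: M.smult_r_distr)
qed

lemma loc_smult_assoc:
  assumes M: "module R M" and A: "A \<in> carrier Rq" "B \<in> carrier Rq" and X: "X \<in> carrier (loc M)"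
  shows "(A \<otimes>\<^bsub>Rq\<^esub> B) \<odot>\<^bsub>loc M\<^esub> X = A \<odot>\<^bsub>loc M\<^esub> (B \<odot>\<^bsub>loc M\<^esub> X)"
proof -
  interpret M: module R M by fact
  note SM = self_module_module[OF R]
  obtain a s where a: "a \<in> carrier R" "s \<in> U" "A = frac R \<qq> (self_module R) a s" using A(1) by (rule RqE)
  obtain b t where b: "b \<in> carrier R" "t \<in> U" "B = frac R \<qq> (self_module R) b t" using A(2) by (rule RqE)
  obtain m u where m: "m \<in> carrier M" "u \<in> U" "X = frac R \<qq> M m u" using X by (rule locE)
  have "A \<otimes>\<^bsub>Rq\<^esub> B = frac R \<qq> (self_module R) (a \<otimes>\<^bsub>R\<^esub> b) (s \<otimes>\<^bsub>R\<^esub> t)"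
    using loc_smult[OF SM a(1,2) _ b(2), of b] a b by (simp add: Rq_simps)
  then show ?thesis
    unfolding b(3) m(3) loc_smult[OF M b(1,2) m(1,2)]
    using a b m loc_smult[OF M _ U_mult[OF a(2) b(2)] m(1,2), of "a \<otimes>\<^bsub>R\<^esub> b"]
      loc_smult[OF M a(1,2) M.smult_closed[OF b(1) m(1)] U_mult[OF b(2) m(2)]]
    by (simp add: M.smult_assoc1 M.R.m_assoc)
qed

lemma loc_smult_one:
  assumes M: "module R M" and X: "X \<in> carrier (loc M)" shows "\<one>\<^bsub>Rq\<^esub> \<odot>\<^bsub>loc M\<^esub> X = X"
proof -
  interpret M: module R M by fact
  obtain m u where m: "m \<in> carrier M" "u \<in> U" "X = frac R \<qq> M m u" using X by (rule locE)
  show ?thesis unfolding Rq_simps m(3) using loc_smult[OF M _ U_one m(1,2), of "\<one>\<^bsub>R\<^esub>"] m by simp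
qed

lemma Rq_cring: "cring Rq"
proof -
  interpret R: cring R by (rule R)
  note SM = self_module_module[OF R]
  note ag = loc_abelian_group[OF SM]
  have comm: "A \<otimes>\<^bsub>Rq\<^esub> B = B \<otimes>\<^bsub>Rq\<^esub> A" if A: "A \<in> carrier Rq" and B: "B \<in> carrier Rq" for A B
  proof -
    obtain a s where a: "a \<in> carrier R" "s \<in> U" "A = frac R \<qq> (self_module R) a s" using A by (rule RqE)
    obtain b t where b: "b \<in> carrier R" "t \<in> U" "B = frac R \<qq> (self_module R) b t" using B by (rule RqE)
    show ?thesis using loc_smult[OF SM a(1,2) _ b(2), of b] loc_smult[OF SM b(1,2) _ a(2), of a] a b
      by (simp add: Rq_simps R.m_comm)
  qed
  show ?thesis
  proof (rule cringI)
    interpret L: abelian_group "loc (self_module R)" by (rule ag)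
    show "abelian_group Rq"
    proof (rule abelian_groupI)
      show "\<exists>Y\<in>carrier Rq. Y \<oplus>\<^bsub>Rq\<^esub> X = \<zero>\<^bsub>Rq\<^esub>" if "X \<in> carrier Rq" for X
        using that L.l_neg[of X] unfolding Rq_simps by (intro bexI[OF _ L.a_inv_closed])
    qed (simp_all add: Rq_simps L.a_ac)
    show "comm_monoid Rq"
    proof (rule comm_monoidI)
      show "A \<otimes>\<^bsub>Rq\<^esub> B \<in> carrier Rq" if "A \<in> carrier Rq" "B \<in> carrier Rq" for A B
        using loc_smult_closed[OF SM that(1)] that(2) by (simp add: Rq_simps)
      show "\<one>\<^bsub>Rq\<^esub> \<in> carrier Rq" unfolding Rq_simps(3) by (rule RqI[OF R.one_closed U_one])
      show "A \<otimes>\<^bsub>Rq\<^esub> B \<otimes>\<^bsub>Rq\<^esub> C = A \<otimes>\<^bsub>Rq\<^esub> (B \<otimes>\<^bsub>Rq\<^esub> C)"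
        if "A \<in> carrier Rq" "B \<in> carrier Rq" "C \<in> carrier Rq" for A B C
        using loc_smult_assoc[OF SM that(1,2)] that(3) by (simp add: Rq_simps)
      show "\<one>\<^bsub>Rq\<^esub> \<otimes>\<^bsub>Rq\<^esub> A = A" if "A \<in> carrier Rq" for A
        using loc_smult_one[OF SM] that by (simp add: Rq_simps)
      show "A \<otimes>\<^bsub>Rq\<^esub> B = B \<otimes>\<^bsub>Rq\<^esub> A" if "A \<in> carrier Rq" "B \<in> carrier Rq" for A B by (rule comm[OF that])
    qed
    show "(A \<oplus>\<^bsub>Rq\<^esub> B) \<otimes>\<^bsub>Rq\<^esub> C = A \<otimes>\<^bsub>Rq\<^esub> C \<oplus>\<^bsub>Rq\<^esub> B \<otimes>\<^bsub>Rq\<^esub> C"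
      if "A \<in> carrier Rq" "B \<in> carrier Rq" "C \<in> carrier Rq" for A B C
      using loc_smult_l_distr[OF SM that(1,2)] that(3) by (simp add: Rq_simps)
  qed
qed

lemma loc_module: "module R M \<Longrightarrow> module Rq (loc M)"
  by (rule moduleI[OF Rq_cring loc_abelian_group])
    (simp_all add: loc_smult_closed loc_smult_l_distr loc_smult_r_distr loc_smult_assoc loc_smult_one)

end


context localization
begin

definition loc_map :: "('a, 'n) module \<Rightarrow> ('m \<Rightarrow> 'n) \<Rightarrow> ('m \<times> 'a) set \<Rightarrow> ('n \<times> 'a) set"
  where "loc_map N f X = (\<Union>p\<in>X. frac R \<qq> N (f (fst p)) (snd p))"

lemma loc_map_frac:
  assumes f: "f \<in> mod_hom R M N" and M: "module R M" and N: "module R N"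
    and m: "m \<in> carrier M" "s \<in> U"
  shows "loc_map N f (frac R \<qq> M m s) = frac R \<qq> N (f m) s"
proof -
  interpret M: module R M by fact
  interpret N: module R N by fact
  have wd: "frac R \<qq> N (f m') s' = frac R \<qq> N (f m) s" if m': "(m', s') \<in> frac R \<qq> M m s" for m' s'
  proof -
    note c = frac_memD(1,2)[OF M m m']
    obtain t where t: "t \<in> U" "t \<odot>\<^bsub>M\<^esub> (s' \<odot>\<^bsub>M\<^esub> m) = t \<odot>\<^bsub>M\<^esub> (s \<odot>\<^bsub>M\<^esub> m')" using m' by (auto simp: frac_def)
    have r: "t \<in> carrier R" "s \<in> carrier R" "s' \<in> carrier R" using t m c by auto
    have "f (t \<odot>\<^bsub>M\<^esub> (s' \<odot>\<^bsub>M\<^esub> m)) = t \<odot>\<^bsub>N\<^esub> (s' \<odot>\<^bsub>N\<^esub> f m)" "f (t \<odot>\<^bsub>M\<^esub> (s \<odot>\<^bsub>M\<^esub> m')) = t \<odot>\<^bsub>N\<^esub> (s \<odot>\<^bsub>N\<^esub> f m')"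
      using r m c by (simp_all add: mod_hom_smult[OF f])
    then have "t \<odot>\<^bsub>N\<^esub> (s' \<odot>\<^bsub>N\<^esub> f m) = t \<odot>\<^bsub>N\<^esub> (s \<odot>\<^bsub>N\<^esub> f m')" using t(2) by simp
    then have "frac R \<qq> N (f m) s = frac R \<qq> N (f m') s'"
      using frac_eq_iff[OF N mod_hom_closed[OF f m(1)] mod_hom_closed[OF f c(1)] m(2) c(2)] t(1) by blast
    then show ?thesis by simp
  qed
  have "loc_map N f (frac R \<qq> M m s) = (\<Union>p\<in>frac R \<qq> M m s. frac R \<qq> N (f m) s)"
    unfolding loc_map_def using wd by (intro SUP_cong refl) simp
  also have "\<dots> = frac R \<qq> N (f m) s" using frac_mem[OF M m] by auto
  finally show ?thesis .
qed

lemma loc_map_hom: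
  assumes f: "f \<in> mod_hom R M N" and M: "module R M" and N: "module R N"
  shows "loc_map N f \<in> mod_hom Rq (loc M) (loc N)"
proof (rule mod_homI)
  interpret M: module R M by fact
  note fr = loc_map_frac[OF f M N] and fc = mod_hom_closed[OF f]
  show "loc_map N f X \<in> carrier (loc N)" if X: "X \<in> carrier (loc M)" for X
  proof -
    obtain m s where m: "m \<in> carrier M" "s \<in> U" "X = frac R \<qq> M m s" using X by (rule locE)
    show ?thesis unfolding m(3) fr[OF m(1,2)] by (rule locI[OF fc[OF m(1)] m(2)])
  qed
  show "loc_map N f (X \<oplus>\<^bsub>loc M\<^esub> Y) = loc_map N f X \<oplus>\<^bsub>loc N\<^esub> loc_map N f Y"
    if XY: "X \<in> carrier (loc M)" "Y \<in> carrier (loc M)" for X Y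
  proof -
    obtain m n s where c: "m \<in> carrier M" "n \<in> carrier M" "s \<in> U" "X = frac R \<qq> M m s" "Y = frac R \<qq> M n s"
      by (rule loc_common[OF M XY])
    show ?thesis
      unfolding c(4,5) loc_add[OF M c(1-3)] fr[OF c(1,3)] fr[OF c(2,3)] loc_add[OF N fc[OF c(1)] fc[OF c(2)] c(3)]
      using fr[OF _ c(3), of "m \<oplus>\<^bsub>M\<^esub> n"] c by (simp add: mod_hom_add[OF f])
  qed
  show "loc_map N f (A \<odot>\<^bsub>loc M\<^esub> X) = A \<odot>\<^bsub>loc N\<^esub> loc_map N f X"
    if A: "A \<in> carrier Rq" and X: "X \<in> carrier (loc M)" for A X
  proof -
    obtain a s where a: "a \<in> carrier R" "s \<in> U" "A = frac R \<qq> (self_module R) a s" using A by (rule RqE)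
    obtain m t where m: "m \<in> carrier M" "t \<in> U" "X = frac R \<qq> M m t" using X by (rule locE)
    show ?thesis
      unfolding a(3) m(3) loc_smult[OF M a(1,2) m(1,2)] fr[OF m(1,2)] loc_smult[OF N a(1,2) fc[OF m(1)] m(2)]
      using fr[OF M.smult_closed[OF a(1) m(1)] U_mult[OF a(2) m(2)]] mod_hom_smult[OF f a(1) m(1)] by simp
  qed
qed

lemma loc_map_surj:
  assumes f: "f \<in> mod_hom R M N" and M: "module R M" and N: "module R N" and surj: "f ` carrier M = carrier N"
  shows "loc_map N f ` carrier (loc M) = carrier (loc N)"
proof (intro equalityI subsetI)
  show "Y \<in> carrier (loc N)" if "Y \<in> loc_map N f ` carrier (loc M)" for Y
    using that mod_hom_closed[OF loc_map_hom[OF f M N]] by (elim imageE) simp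
  fix Y assume "Y \<in> carrier (loc N)"
  then obtain n s where n: "n \<in> carrier N" "s \<in> U" "Y = frac R \<qq> N n s" by (rule locE)
  have "n \<in> f ` carrier M" using n(1) surj by simp
  then obtain m where m: "m \<in> carrier M" "n = f m" by (elim imageE)
  show "Y \<in> loc_map N f ` carrier (loc M)"
    using loc_map_frac[OF f M N m(1) n(2)] m n by (intro image_eqI[OF _ locI[OF m(1) n(2)]]) simp
qed

lemma loc_short_exact:
  assumes ex: "short_exact R L M N f g"
  shows "short_exact Rq (loc L) (loc M) (loc N) (loc_map M f) (loc_map N g)"
proof -
  note ex' = ex[unfolded short_exact_def]
  have L: "module R L" and M: "module R M" and N: "module R N"
    and f: "f \<in> mod_hom R L M" and inj: "inj_on f (carrier L)"
    and g: "g \<in> mod_hom R M N" and surj: "g ` carrier M = carrier N"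
    and ker: "f ` carrier L = mod_ker M N g" using ex' by auto
  interpret L: module R L by fact
  interpret M: module R M by fact
  note ff = loc_map_frac[OF f L M] and gg = loc_map_frac[OF g M N]
  have gf: "g (f l) = \<zero>\<^bsub>N\<^esub>" if "l \<in> carrier L" for l using that ker by (auto simp: mod_ker_def)
  have 1: "inj_on (loc_map M f) (carrier (loc L))"
    unfolding inj_on_mod_hom_iff[OF loc_map_hom[OF f L M] loc_module[OF L] loc_module[OF M]]
  proof (intro ballI impI)
    fix X assume X: "X \<in> carrier (loc L)" "loc_map M f X = \<zero>\<^bsub>loc M\<^esub>"
    obtain l s where l: "l \<in> carrier L" "s \<in> U" "X = frac R \<qq> L l s" using X(1) by (rule locE)
    have "frac R \<qq> M (f l) s = \<zero>\<^bsub>loc M\<^esub>" using X(2) ff[OF l(1,2)] l(3) by simp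
    then obtain t where t: "t \<in> U" "t \<odot>\<^bsub>M\<^esub> f l = \<zero>\<^bsub>M\<^esub>"
      using frac_eq_zero_iff[OF M mod_hom_closed[OF f l(1)] l(2)] by auto
    have tR: "t \<in> carrier R" using t by simp
    have "t \<odot>\<^bsub>L\<^esub> l = \<zero>\<^bsub>L\<^esub>"
      using inj inj_on_mod_hom_iff[OF f L M] mod_hom_smult[OF f tR l(1)] t(2) tR l(1) by simp
    then show "X = \<zero>\<^bsub>loc L\<^esub>" unfolding l(3) using frac_eq_zero_iff[OF L l(1,2)] t(1) by blast
  qed
  have 2: "loc_map M f ` carrier (loc L) = mod_ker (loc M) (loc N) (loc_map N g)"
  proof (intro equalityI subsetI)
    fix Y assume "Y \<in> loc_map M f ` carrier (loc L)"
    then obtain X where X: "X \<in> carrier (loc L)" "Y = loc_map M f X" by (elim imageE)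
    obtain l s where l: "l \<in> carrier L" "s \<in> U" "X = frac R \<qq> L l s" using X(1) by (rule locE)
    have Y: "Y = frac R \<qq> M (f l) s" using X(2) ff[OF l(1,2)] l(3) by simp
    have "loc_map N g Y = \<zero>\<^bsub>loc N\<^esub>"
      unfolding Y gg[OF mod_hom_closed[OF f l(1)] l(2)] gf[OF l(1)] by (rule frac_zero[OF N l(2)])
    then show "Y \<in> mod_ker (loc M) (loc N) (loc_map N g)"
      using mod_hom_closed[OF loc_map_hom[OF f L M] X(1)] X(2) by (simp add: mod_ker_def)
  next
    fix Y assume Y: "Y \<in> mod_ker (loc M) (loc N) (loc_map N g)"
    then have "Y \<in> carrier (loc M)" by (simp add: mod_ker_def)
    then obtain m s where m: "m \<in> carrier M" "s \<in> U" "Y = frac R \<qq> M m s" by (rule locE)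
    have "frac R \<qq> N (g m) s = \<zero>\<^bsub>loc N\<^esub>" using Y gg[OF m(1,2)] m(3) by (simp add: mod_ker_def)
    then obtain t where t: "t \<in> U" "t \<odot>\<^bsub>N\<^esub> g m = \<zero>\<^bsub>N\<^esub>"
      using frac_eq_zero_iff[OF N mod_hom_closed[OF g m(1)] m(2)] by auto
    have tR: "t \<in> carrier R" using t by simp
    have "t \<odot>\<^bsub>M\<^esub> m \<in> f ` carrier L"
      unfolding ker using t(2) mod_hom_smult[OF g tR m(1)] tR m(1) by (simp add: mod_ker_def)
    then obtain l where l: "l \<in> carrier L" "t \<odot>\<^bsub>M\<^esub> m = f l" by (elim imageE)
    have ts: "t \<otimes>\<^bsub>R\<^esub> s \<in> U" by (rule U_mult[OF t(1) m(2)])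
    have "Y = loc_map M f (frac R \<qq> L l (t \<otimes>\<^bsub>R\<^esub> s))"
      unfolding ff[OF l(1) ts] l(2)[symmetric] frac_cancel[OF M m(1,2) t(1)] by (rule m(3))
    then show "Y \<in> loc_map M f ` carrier (loc L)" by (rule image_eqI) (rule locI[OF l(1) ts])
  qed
  show ?thesis
    unfolding short_exact_def
    using loc_module[OF L] loc_module[OF M] loc_module[OF N] loc_map_hom[OF f L M] loc_map_hom[OF g M N]
      1 2 loc_map_surj[OF g M N surj] by simp
qed

text \<open>An isomorphism is a short exact sequence whose last term is zero.\<close>

lemma loc_iso:
  fixes M :: "('a, 'm) module" and N :: "('a, 'n) module"
  assumes iso: "mod_iso R M N" and M: "module R M" and N: "module R N"
  shows "mod_iso Rq (loc M) (loc N)"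
proof -
  obtain f where f: "f \<in> mod_hom R M N" "bij_betw f (carrier M) (carrier N)"
    using iso unfolding mod_iso_def ..
  let ?Z = "N\<lparr>carrier := {\<zero>\<^bsub>N\<^esub>}\<rparr>"
  have Z: "module R ?Z" by (rule module_restrict[OF N submodule_zero_set[OF N]])
  interpret N: module R N by fact
  have "short_exact R M N ?Z f (\<lambda>x. \<zero>\<^bsub>N\<^esub>)"
    using f M N Z mod_hom_zero_map[OF Z, of N] by (auto simp: short_exact_def bij_betw_def mod_ker_def)
  from loc_short_exact[OF this] have "inj_on (loc_map N f) (carrier (loc M))" by (simp add: short_exact_def)
  then show ?thesis
    unfolding mod_iso_def using loc_map_hom[OF f(1) M N] loc_map_surj[OF f(1) M N] f(2)
    by (intro bexI[of _ "loc_map N f"]) (simp_all add: bij_betw_def)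
qed

lemma loc_free_common_denominator:
  assumes X: "finite X" and g: "\<And>i. i \<in> X \<Longrightarrow> g i \<in> carrier Rq" and g0: "\<And>i. i \<notin> X \<Longrightarrow> g i = \<zero>\<^bsub>Rq\<^esub>"
  shows "\<exists>f \<in> carrier (free_module R X). \<exists>s \<in> U. \<forall>i. g i = frac R \<qq> (self_module R) (f i) s"
  using X g g0
proof (induction X arbitrary: g)
  case empty
  have "g i = frac R \<qq> (self_module R) \<zero>\<^bsub>R\<^esub> \<one>\<^bsub>R\<^esub>" for i
    using empty(2)[of i] frac_zero[OF self_module_module[OF R] U_one] by (simp add: Rq_simps)
  then show ?case
    using U_one by (intro bexI[of _ "\<lambda>i. \<zero>\<^bsub>R\<^esub>"] bexI[of _ "\<one>\<^bsub>R\<^esub>"]) (auto simp: carrier_free_module)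
next
  case (insert x X)
  interpret R: cring R by (rule R)
  note SM = self_module_module[OF R]
  let ?g = "g(x := \<zero>\<^bsub>Rq\<^esub>)"
  have "\<exists>f \<in> carrier (free_module R X). \<exists>s \<in> U. \<forall>i. ?g i = frac R \<qq> (self_module R) (f i) s"
    by (rule insert.IH) (use insert in auto)
  then obtain f s where f: "f \<in> carrier (free_module R X)" "s \<in> U" "\<And>i. ?g i = frac R \<qq> (self_module R) (f i) s"
    by blast
  obtain a t where a: "a \<in> carrier R" "t \<in> U" "g x = frac R \<qq> (self_module R) a t"
    by (rule RqE[OF insert(4)[of x]]) simp_all
  let ?f = "\<lambda>i. if i = x then s \<otimes>\<^bsub>R\<^esub> a else t \<otimes>\<^bsub>R\<^esub> f i"
  note fv = free_module_value[OF R f(1)]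
  have "?f \<in> carrier (free_module R (insert x X))"
    using f(1,2) a fv by (auto simp: carrier_free_module)
  moreover have "g i = frac R \<qq> (self_module R) (?f i) (t \<otimes>\<^bsub>R\<^esub> s)" for i
  proof (cases "i = x")
    case True
    have "t \<otimes>\<^bsub>R\<^esub> s = s \<otimes>\<^bsub>R\<^esub> t" using f(2) a(2) R.m_comm by simp
    then show ?thesis using frac_cancel[OF SM _ a(2) f(2), of a] a True by simp
  next
    case False
    then show ?thesis using frac_cancel[OF SM _ f(2) a(2), of "f i"] f(3)[of i] fv[of i] by simp
  qed
  ultimately show ?case
    by (intro bexI[of _ ?f] bexI[OF _ U_mult[OF a(2) f(2)]] allI)
qed

text \<open>
  The coordinates of a fraction of tuples are fractions. For injectivity, multiply the elements that
  kill the numerators; for surjectivity, take a common denominator.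
\<close>

lemma loc_free_iso:
  assumes X: "finite X" shows "mod_iso Rq (loc (free_module R X)) (free_module Rq X)"
proof -
  interpret R: cring R by (rule R)
  let ?F = "free_module R X"
  note SM = self_module_module[OF R] and FM = free_module_module[OF R, of X]
  have ev: "(\<lambda>f. f i) \<in> mod_hom R ?F (self_module R)" for i
    by (simp add: mod_hom_def Pi_def free_module_value[OF R])
  let ?e = "\<lambda>i. loc_map (self_module R) (\<lambda>f. f i)"
  note eh = loc_map_hom[OF ev FM SM]
  note efr = loc_map_frac[OF ev FM SM]
  let ?p = "\<lambda>Z i. ?e i Z"
  have p: "?p \<in> mod_hom Rq (loc ?F) (free_module Rq X)"
  proof (rule mod_homI)
    show "?p Z \<in> carrier (free_module Rq X)" if Z: "Z \<in> carrier (loc ?F)" for Z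
    proof -
      obtain f s where f: "f \<in> carrier ?F" "s \<in> U" "Z = frac R \<qq> ?F f s" using Z by (rule locE)
      have "?e i Z = \<zero>\<^bsub>Rq\<^esub>" if "i \<notin> X" for i
        using efr[OF f(1,2), of i] f that frac_zero[OF SM f(2)] by (simp add: carrier_free_module Rq_simps)
      then show ?thesis using mod_hom_closed[OF eh Z] by (simp add: carrier_free_module Rq_simps)
    qed
    show "?p (Z \<oplus>\<^bsub>loc ?F\<^esub> W) = ?p Z \<oplus>\<^bsub>free_module Rq X\<^esub> ?p W" if "Z \<in> carrier (loc ?F)" "W \<in> carrier (loc ?F)" for Z W
      using mod_hom_add[OF eh that] by (simp add: Rq_simps)
    show "?p (A \<odot>\<^bsub>loc ?F\<^esub> Z) = A \<odot>\<^bsub>free_module Rq X\<^esub> ?p Z" if "A \<in> carrier Rq" "Z \<in> carrier (loc ?F)" for A Z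
      using mod_hom_smult[OF eh that] by (simp add: Rq_simps)
  qed
  have "inj_on ?p (carrier (loc ?F))"
    unfolding inj_on_mod_hom_iff[OF p loc_module[OF FM] free_module_module[OF Rq_cring]]
  proof (intro ballI impI)
    fix Z assume Z: "Z \<in> carrier (loc ?F)" "?p Z = \<zero>\<^bsub>free_module Rq X\<^esub>"
    obtain f s where f: "f \<in> carrier ?F" "s \<in> U" "Z = frac R \<qq> ?F f s" using Z(1) by (rule locE)
    have "frac R \<qq> (self_module R) (f i) s = \<zero>\<^bsub>loc (self_module R)\<^esub>" for i
      using fun_cong[OF Z(2), of i] efr[OF f(1,2), of i] f(3) by (simp add: Rq_simps)
    then have e: "\<exists>t\<in>U. t \<otimes>\<^bsub>R\<^esub> f i = \<zero>\<^bsub>R\<^esub>" for i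
      using frac_eq_zero_iff[OF SM _ f(2), of "f i"] free_module_value[OF R f(1)] by simp
    have "\<exists>t\<in>U. \<forall>i\<in>Y. t \<otimes>\<^bsub>R\<^esub> f i = \<zero>\<^bsub>R\<^esub>" if "finite Y" for Y
      using that
    proof (induction Y)
      case empty
      show ?case using U_one by auto
    next
      case (insert y Y)
      obtain t where t: "t \<in> U" "\<forall>i\<in>Y. t \<otimes>\<^bsub>R\<^esub> f i = \<zero>\<^bsub>R\<^esub>" using insert by blast
      obtain u where u: "u \<in> U" "u \<otimes>\<^bsub>R\<^esub> f y = \<zero>\<^bsub>R\<^esub>" using e by blast
      have "(t \<otimes>\<^bsub>R\<^esub> u) \<otimes>\<^bsub>R\<^esub> f i = \<zero>\<^bsub>R\<^esub>" if "i \<in> insert y Y" for i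
      proof -
        have c: "t \<in> carrier R" "u \<in> carrier R" "f i \<in> carrier R" using t u free_module_value[OF R f(1)] by auto
        have "(t \<otimes>\<^bsub>R\<^esub> u) \<otimes>\<^bsub>R\<^esub> f i = t \<otimes>\<^bsub>R\<^esub> (u \<otimes>\<^bsub>R\<^esub> f i)" "(t \<otimes>\<^bsub>R\<^esub> u) \<otimes>\<^bsub>R\<^esub> f i = u \<otimes>\<^bsub>R\<^esub> (t \<otimes>\<^bsub>R\<^esub> f i)"
          using c by (simp_all add: R.m_ac)
        then show ?thesis using that t u c by auto
      qed
      then show ?case using U_mult[OF t(1) u(1)] by blast
    qed
    then obtain t where t: "t \<in> U" "\<forall>i\<in>X. t \<otimes>\<^bsub>R\<^esub> f i = \<zero>\<^bsub>R\<^esub>" using X by blast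
    have "t \<odot>\<^bsub>?F\<^esub> f = \<zero>\<^bsub>?F\<^esub>"
    proof (rule ext)
      fix i show "(t \<odot>\<^bsub>?F\<^esub> f) i = \<zero>\<^bsub>?F\<^esub> i"
        using t f(1) by (cases "i \<in> X") (auto simp: carrier_free_module)
    qed
    then show "Z = \<zero>\<^bsub>loc ?F\<^esub>" unfolding f(3) using frac_eq_zero_iff[OF FM f(1,2)] t(1) by blast
  qed
  moreover have "?p ` carrier (loc ?F) = carrier (free_module Rq X)"
  proof (intro equalityI subsetI)
    show "g \<in> carrier (free_module Rq X)" if "g \<in> ?p ` carrier (loc ?F)" for g
      using that mod_hom_closed[OF p] by (elim imageE) simp
    fix g assume g: "g \<in> carrier (free_module Rq X)"
    have "\<exists>f \<in> carrier ?F. \<exists>s \<in> U. \<forall>i. g i = frac R \<qq> (self_module R) (f i) s"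
      by (rule loc_free_common_denominator[OF X]) (use g in \<open>auto simp: carrier_free_module\<close>)
    then obtain f s where f: "f \<in> carrier ?F" "s \<in> U" "\<forall>i. g i = frac R \<qq> (self_module R) (f i) s" by blast
    have "g = ?p (frac R \<qq> ?F f s)" using f(3) efr[OF f(1,2)] by auto
    then show "g \<in> ?p ` carrier (loc ?F)" by (rule image_eqI) (rule locI[OF f(1,2)])
  qed
  ultimately show ?thesis unfolding mod_iso_def by (intro bexI[OF _ p]) (simp add: bij_betw_def)
qed

text \<open>\<open>\<qq>R\<^sub>\<qq>\<close> is the kernel of the localization \<open>R\<^sub>\<qq> \<rightarrow> (R/\<qq>)\<^sub>\<qq>\<close> of the projection.\<close>

lemma residue_field_iso:
  "module Rq (residue_field_module R \<qq>)" "mod_iso Rq (residue_field_module R \<qq>) (loc (cyclic R \<qq>))"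
proof -
  interpret q: primeideal \<qq> R by (rule q)
  note SM = self_module_module[OF R] and I = q.is_ideal
  note CM = cyclic_module[OF R I] and pr = cyclic_proj[OF R I]
  let ?S = "self_module Rq" and ?c = "loc_map (cyclic R \<qq>) (\<lambda>a. \<qq> +>\<^bsub>self_module R\<^esub> a)"
  have S: "module Rq ?S" by (rule self_module_module[OF Rq_cring])
  note ch = loc_map_hom[OF pr SM CM] and cfr = loc_map_frac[OF pr SM CM]
  have c: "?c \<in> mod_hom Rq ?S (loc (cyclic R \<qq>))"
    using ch by (simp add: mod_hom_def Rq_simps)
  have surj: "?c ` carrier ?S = carrier (loc (cyclic R \<qq>))"
    using loc_map_surj[OF pr SM CM] by (simp add: carrier_cyclic Rq_simps)
  have z: "?c (frac R \<qq> (self_module R) a s) = \<zero>\<^bsub>loc (cyclic R \<qq>)\<^esub> \<longleftrightarrow> a \<in> \<qq>" if a: "a \<in> carrier R" "s \<in> U" for a s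
  proof -
    have aS: "a \<in> carrier (self_module R)" using a by simp
    have "?c (frac R \<qq> (self_module R) a s) = \<zero>\<^bsub>loc (cyclic R \<qq>)\<^esub> \<longleftrightarrow> (\<exists>t\<in>U. t \<odot>\<^bsub>cyclic R \<qq>\<^esub> (\<qq> +>\<^bsub>self_module R\<^esub> a) = \<zero>\<^bsub>cyclic R \<qq>\<^esub>)"
      using cfr[OF aS a(2)] frac_eq_zero_iff[OF CM mod_hom_closed[OF pr aS] a(2)] by simp
    also have "\<dots> \<longleftrightarrow> (\<exists>t\<in>U. t \<otimes>\<^bsub>R\<^esub> a \<in> \<qq>)"
      using a by (intro bex_cong refl) (simp add: cyclic_smult[OF R I] cyclic_eq_zero_iff[OF R I])
    also have "\<dots> \<longleftrightarrow> a \<in> \<qq>"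
      using q.I_prime[OF _ a(1)] q.I_l_closed[of a] U_one by blast
    finally show ?thesis .
  qed
  have max: "loc_max_ideal R \<qq> = mod_ker ?S (loc (cyclic R \<qq>)) ?c"
  proof (intro equalityI subsetI)
    fix X assume "X \<in> loc_max_ideal R \<qq>"
    then obtain a s where a: "a \<in> \<qq>" "s \<in> U" "X = frac R \<qq> (self_module R) a s" unfolding loc_max_ideal_def by blast
    then show "X \<in> mod_ker ?S (loc (cyclic R \<qq>)) ?c"
      using z[OF q.Icarr[OF a(1)] a(2)] RqI[OF q.Icarr[OF a(1)] a(2)] by (simp add: mod_ker_def)
  next
    fix X assume X: "X \<in> mod_ker ?S (loc (cyclic R \<qq>)) ?c"
    then have "X \<in> carrier Rq" by (simp add: mod_ker_def)
    then obtain a s where a: "a \<in> carrier R" "s \<in> U" "X = frac R \<qq> (self_module R) a s" by (rule RqE)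
    then have "a \<in> \<qq>" using z[OF a(1,2)] X by (simp add: mod_ker_def)
    then show "X \<in> loc_max_ideal R \<qq>" using a unfolding loc_max_ideal_def by blast
  qed
  have sub: "submodule (loc_max_ideal R \<qq>) Rq ?S" unfolding max by (rule mod_ker_submodule[OF c S loc_module[OF CM]])
  show Q: "module Rq (residue_field_module R \<qq>)"
    unfolding residue_field_module_def by (rule quotient_module_module[OF S sub])
  show "mod_iso Rq (residue_field_module R \<qq>) (loc (cyclic R \<qq>))"
    unfolding residue_field_module_def
  proof (rule mod_iso_of_same_kernel[OF quotient_module_proj[OF S sub] carrier_quotient_module[symmetric] S
        quotient_module_module[OF S sub] loc_module[OF CM] c surj])
    show "loc_max_ideal R \<qq> +>\<^bsub>?S\<^esub> X = \<zero>\<^bsub>quotient_module ?S (loc_max_ideal R \<qq>)\<^esub> \<longleftrightarrow> ?c X = \<zero>\<^bsub>loc (cyclic R \<qq>)\<^esub>"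
      if "X \<in> carrier ?S" for X
      unfolding quotient_module_eq_zero_iff[OF S sub that] using that by (simp add: max mod_ker_def)
  qed
qed

end


section \<open>Dominance\<close>

lemma projective_module_transfer_free:
  fixes \<phi> :: "('i \<Rightarrow> 'b) \<Rightarrow> 'm"
  assumes S: "cring S" and X: "finite X" and \<phi>: "inj_on \<phi> (carrier (free_module S X))"
  shows "projective_module S (transfer_module \<phi> (free_module S X))"
  unfolding projective_module_def
proof (intro conjI allI impI)
  let ?F = "free_module S X" and ?P = "transfer_module \<phi> (free_module S X)"
  note F = free_module_module[OF S, of X]
  note T = transfer_module[OF F \<phi>]
  show P: "module S ?P" by (rule T(1))
  fix A B :: "('b, 'm) module" and g f
  assume as: "module S A \<and> module S B \<and> g \<in> mod_hom S A B \<and> g ` carrier A = carrier B \<and> f \<in> mod_hom S ?P B"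
  then have A: "module S A" and B: "module S B" and g: "g \<in> mod_hom S A B" "g ` carrier A = carrier B"
    and f: "f \<in> mod_hom S ?P B" by auto
  let ?i = "inv_into (carrier ?F) \<phi>"
  have i: "?i \<in> mod_hom S ?P ?F" by (rule mod_hom_inv_into[OF T(2,3) F])
  obtain h where h: "h \<in> mod_hom S ?F A" "\<And>y. y \<in> carrier ?F \<Longrightarrow> g (h y) = f (\<phi> y)"
    by (rule lift_through_surj[OF g A B X mod_hom_comp[OF T(2) f]]) blast
  have "g (h (?i x)) = f x" if x: "x \<in> carrier ?P" for x
  proof -
    have "x \<in> \<phi> ` carrier ?F" using x T(3) by (simp add: bij_betw_def)
    then have "\<phi> (?i x) = x" by (rule f_inv_into_f)
    then show ?thesis using h(2)[OF mod_hom_closed[OF i x]] by simp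
  qed
  then show "\<exists>h\<in>mod_hom S ?P A. \<forall>x\<in>carrier ?P. g (h x) = f x"
    by (intro bexI[OF _ mod_hom_comp[OF i h(1)]] ballI)
qed

context localization
begin

text \<open>
  Localizing a free presentation of \<open>W\<close> with kernel \<open>L\<close> gives the next step of a projective
  resolution of the residue field.
\<close>

lemma localized_syzygy_step:
  fixes \<kappa> :: "(('a \<times> 'a) set, 'k) module"
  assumes ex: "short_exact R L (free_module R {..<m :: nat}) W f g"
    and syz: "is_syzygy Rq \<kappa> n N" and N: "module Rq N" and iso: "mod_iso Rq (loc W) N"
  obtains N' where "is_syzygy Rq \<kappa> (Suc n) N'" "module Rq N'" "mod_iso Rq (loc L) N'"
proof -
  note ex' = ex[unfolded short_exact_def]
  let ?F = "free_module R {..<m}" and ?G = "free_module Rq {..<m}"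
  have L: "module R L" and W: "module R W" and F: "module R ?F" using ex' by auto
  note G = free_module_module[OF Rq_cring, of "{..<m}"]
  note lex = loc_short_exact[OF ex, unfolded short_exact_def]
  let ?P = "transfer_module to_univ ?G"
  note T = transfer_module[OF G inj_to_univ]
  have P: "module Rq ?P" by (rule T(1))
  have proj: "projective_module Rq ?P" by (rule projective_module_transfer_free[OF Rq_cring finite_lessThan inj_to_univ])
  have fg: "fin_gen Rq ?P"
    by (rule fin_gen_image[OF T(2) _ G P free_module_fin_gen[OF Rq_cring finite_lessThan]]) (use T(3) in \<open>simp add: bij_betw_def\<close>)
  have "mod_iso Rq (loc ?F) ?P"
    by (rule mod_iso_trans[OF loc_free_iso[OF finite_lessThan] transfer_module_iso[OF G inj_to_univ]])
  then obtain \<theta> where \<theta>: "\<theta> \<in> mod_hom Rq (loc ?F) ?P" "bij_betw \<theta> (carrier (loc ?F)) (carrier ?P)"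
    unfolding mod_iso_def ..
  obtain \<nu> where \<nu>: "\<nu> \<in> mod_hom Rq (loc W) N" "bij_betw \<nu> (carrier (loc W)) (carrier N)"
    using iso unfolding mod_iso_def ..
  let ?i = "inv_into (carrier (loc ?F)) \<theta>"
  let ?g = "loc_map W g" and ?f = "loc_map ?F f"
  note LF = loc_module[OF F] and LW = loc_module[OF W] and LL = loc_module[OF L]
  have i: "?i \<in> mod_hom Rq ?P (loc ?F)" by (rule mod_hom_inv_into[OF \<theta> LF])
  have gh: "?g \<in> mod_hom Rq (loc ?F) (loc W)" and fh: "?f \<in> mod_hom Rq (loc L) (loc ?F)"
    and gs: "?g ` carrier (loc ?F) = carrier (loc W)" and fi: "inj_on ?f (carrier (loc L))"
    and fk: "?f ` carrier (loc L) = mod_ker (loc ?F) (loc W) ?g"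
    using lex by auto
  let ?h = "\<lambda>x. \<nu> (?g (?i x))"
  have h: "?h \<in> mod_hom Rq ?P N" by (rule mod_hom_comp[OF mod_hom_comp[OF i gh] \<nu>(1)])
  have \<theta>inj: "inj_on \<theta> (carrier (loc ?F))" and \<theta>s: "\<theta> ` carrier (loc ?F) = carrier ?P"
    using \<theta>(2) by (auto simp: bij_betw_def)
  have h\<theta>: "?h (\<theta> x) = \<nu> (?g x)" if "x \<in> carrier (loc ?F)" for x
    using that by (simp add: inv_into_f_f[OF \<theta>inj])
  have hs: "?h ` carrier ?P = carrier N"
  proof -
    have "?h ` carrier ?P = (\<lambda>x. \<nu> (?g x)) ` carrier (loc ?F)"
      unfolding \<theta>s[symmetric] image_image using h\<theta> by (intro image_cong refl)
    also have "\<dots> = \<nu> ` (?g ` carrier (loc ?F))" by (simp add: image_image)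
    also have "\<dots> = carrier N" unfolding gs using \<nu>(2) by (simp add: bij_betw_def)
    finally show ?thesis .
  qed
  let ?N = "?P\<lparr>carrier := mod_ker ?P N ?h\<rparr>"
  have N': "module Rq ?N" by (rule module_restrict[OF P mod_ker_submodule[OF h P N]])
  have \<nu>0: "\<nu> w = \<zero>\<^bsub>N\<^esub> \<longleftrightarrow> w = \<zero>\<^bsub>loc W\<^esub>" if "w \<in> carrier (loc W)" for w
    using \<nu> that inj_on_mod_hom_iff[OF \<nu>(1) LW N] mod_hom_zero[OF \<nu>(1) LW N] by (auto simp: bij_betw_def)
  have ker: "\<theta> ` mod_ker (loc ?F) (loc W) ?g = mod_ker ?P N ?h"
  proof (intro equalityI subsetI)
    fix y assume "y \<in> \<theta> ` mod_ker (loc ?F) (loc W) ?g"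
    then obtain x where x: "x \<in> carrier (loc ?F)" "?g x = \<zero>\<^bsub>loc W\<^esub>" "y = \<theta> x" by (auto simp: mod_ker_def)
    have "?h y = \<zero>\<^bsub>N\<^esub>" unfolding x(3) h\<theta>[OF x(1)] x(2) by (rule mod_hom_zero[OF \<nu>(1) LW N])
    then show "y \<in> mod_ker ?P N ?h" using mod_hom_closed[OF \<theta>(1) x(1)] x(3) by (simp add: mod_ker_def)
  next
    fix y assume y: "y \<in> mod_ker ?P N ?h"
    then have "y \<in> \<theta> ` carrier (loc ?F)" unfolding \<theta>s by (simp add: mod_ker_def)
    then obtain x where x: "x \<in> carrier (loc ?F)" "y = \<theta> x" by (elim imageE)
    have "\<nu> (?g x) = \<zero>\<^bsub>N\<^esub>" using y h\<theta>[OF x(1)] x(2) by (simp add: mod_ker_def)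
    then have "x \<in> mod_ker (loc ?F) (loc W) ?g"
      using \<nu>0[OF mod_hom_closed[OF gh x(1)]] x(1) by (simp add: mod_ker_def)
    then show "y \<in> \<theta> ` mod_ker (loc ?F) (loc W) ?g" using x(2) by simp
  qed
  have "mod_iso Rq (loc L) ?N"
  proof -
    let ?k = "\<lambda>x. \<theta> (?f x)"
    have im: "?k ` carrier (loc L) = mod_ker ?P N ?h" unfolding ker[symmetric] fk[symmetric] by (simp add: image_image)
    have k: "?k \<in> mod_hom Rq (loc L) ?N"
      by (rule mod_hom_corestrict[OF mod_hom_comp[OF fh \<theta>(1)]]) (rule equalityD1[OF im])
    have "inj_on ?k (carrier (loc L))"
      using comp_inj_on[OF fi inj_on_subset[OF \<theta>inj, of "?f ` carrier (loc L)"]] fk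
      by (simp add: comp_def mod_ker_def)
    then show ?thesis unfolding mod_iso_def using im by (intro bexI[OF _ k]) (simp add: bij_betw_def)
  qed
  moreover have "is_syzygy Rq \<kappa> (Suc n) ?N"
    by (rule is_syzygy.step[OF syz proj fg h hs N' mod_iso_refl])
  ultimately show ?thesis using N' by (intro that[of ?N])
qed

lemma localized_syzygy:
  assumes res: "quotient_resolution R \<qq> m d"
  shows "\<exists>N. is_syzygy Rq (residue_field_module R \<qq>) (Suc k) N \<and> module Rq N \<and>
    mod_iso Rq (loc (quotient_resolution.syzygy R m d (Suc k))) N"
proof -
  interpret qr: quotient_resolution R \<qq> m d by (rule res)
  interpret q: primeideal \<qq> R by (rule q)
  note I = q.is_ideal
  show ?thesis
  proof (induction k)
    case 0
    let ?\<kappa> = "residue_field_module R \<qq>"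
    \<comment> \<open>Elements of the residue field are sets of fractions; a fraction becomes a constant sequence.\<close>
    let ?\<phi> = "\<lambda>Y :: ('a \<times> 'a) set set. (\<lambda>y. (\<lambda>_ :: nat. y)) ` Y"
    have inj: "inj_on ?\<phi> (carrier ?\<kappa>)"
    proof (rule inj_onI)
      fix Y Z assume "?\<phi> Y = ?\<phi> Z"
      moreover have "inj (\<lambda>y :: ('a \<times> 'a) set. (\<lambda>_ :: nat. y))" by (auto simp: inj_def fun_eq_iff)
      ultimately show "Y = Z" by (simp add: inj_image_eq_iff)
    qed
    let ?N = "transfer_module ?\<phi> ?\<kappa>"
    note T = transfer_module[OF residue_field_iso(1) inj]
    have \<kappa>N: "mod_iso Rq ?\<kappa> ?N" by (rule transfer_module_iso[OF residue_field_iso(1) inj])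
    have syz: "is_syzygy Rq ?\<kappa> 0 ?N" by (rule is_syzygy.zero[OF T(1) \<kappa>N])
    have iso: "mod_iso Rq (loc (cyclic R \<qq>)) ?N"
      by (rule mod_iso_trans[OF mod_iso_sym[OF residue_field_iso(2,1)] \<kappa>N])
    obtain N' where "is_syzygy Rq ?\<kappa> (Suc 0) N'" "module Rq N'" "mod_iso Rq (loc (qr.syzygy 1)) N'"
      by (rule localized_syzygy_step[OF qr.syzygy_one_exact[OF I] syz T(1) iso])
    then show ?case by auto
  next
    case (Suc k)
    then obtain N where N: "is_syzygy Rq (residue_field_module R \<qq>) (Suc k) N" "module Rq N"
      "mod_iso Rq (loc (qr.syzygy (Suc k))) N" by blast
    have ex: "short_exact R (qr.syzygy (Suc (Suc k))) (qr.G (Suc (Suc k))) (qr.syzygy (Suc k)) (\<lambda>x. x) (d (Suc k))"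
      by (rule qr.syzygy_exact) simp
    obtain N' where "is_syzygy Rq (residue_field_module R \<qq>) (Suc (Suc k)) N'" "module Rq N'"
      "mod_iso Rq (loc (qr.syzygy (Suc (Suc k)))) N'"
      by (rule localized_syzygy_step[OF ex N])
    then show ?case by blast
  qed
qed

end

text \<open>The direct sum of the one-element list \<open>[X]\<close> is a copy of \<open>X\<close>.\<close>

lemma in_add_of_iso:
  assumes X: "X \<in> \<X>" and mX: "module R X" and N: "module R N" and iso: "mod_iso R N X"
  shows "in_add R \<X> N"
proof -
  let ?D = "direct_sum [X]"
  let ?e = "\<lambda>x. (\<lambda>i\<in>{..<Suc 0}. x)"
  have e: "?e \<in> mod_hom R X ?D"
    by (intro mod_homI) (auto simp: direct_sum_def fun_eq_iff)
  have surj: "?e ` carrier X = carrier ?D"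
  proof (intro equalityI subsetI)
    show "f \<in> carrier ?D" if "f \<in> ?e ` carrier X" for f using that mod_hom_closed[OF e] by (elim imageE) simp
    fix f assume f: "f \<in> carrier ?D"
    then have fP: "f \<in> (\<Pi>\<^sub>E i\<in>{..<Suc 0}. carrier ([X] ! i))" by (simp add: direct_sum_def)
    have "f 0 \<in> carrier X" using PiE_mem[OF fP, of 0] by simp
    moreover have "f i = ?e (f 0) i" for i using PiE_arb[OF fP, of i] by (cases "i = 0") simp_all
    then have "f = ?e (f 0)" by (rule ext)
    ultimately show "f \<in> ?e ` carrier X" by (rule image_eqI[rotated])
  qed
  have D: "module R ?D" by (rule module_image[OF mX e surj]) (auto simp: direct_sum_def fun_eq_iff)
  interpret D: module R ?D by (rule D)
  have inj: "inj_on ?e (carrier X)"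
  proof (rule inj_onI)
    fix x y assume "?e x = ?e y"
    then have "?e x 0 = ?e y 0" by (rule fun_cong)
    then show "x = y" by simp
  qed
  have "mod_iso R X ?D" unfolding mod_iso_def using e surj inj by (intro bexI[OF _ e]) (simp add: bij_betw_def)
  then have "mod_iso R N (?D\<lparr>carrier := carrier ?D\<rparr>)" using mod_iso_trans[OF iso] by simp
  moreover have "carrier ?D <+>\<^bsub>?D\<^esub> {\<zero>\<^bsub>?D\<^esub>} = carrier ?D" by (auto simp: set_add_def')
  moreover have "carrier ?D \<inter> {\<zero>\<^bsub>?D\<^esub>} = {\<zero>\<^bsub>?D\<^esub>}" by auto
  ultimately show ?thesis
    unfolding in_add_def using X D.carrier_is_submodule submodule_zero_set[OF D]
    by (intro exI[of _ "[X]"] exI[of _ "carrier ?D"] exI[of _ "{\<zero>\<^bsub>?D\<^esub>}"]) simp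
qed

theorem theorem1p2:
  fixes R :: "('a, 'r) ring_scheme" and \<pp> :: "'a set"
  assumes "cring R" and "noetherian_ring R" and "primeideal \<pp> R"
  shows "dominant R (R_cat R \<pp>)"
  unfolding dominant_def
proof (intro allI impI)
  fix \<qq> assume q: "primeideal \<qq> R"
  note R = assms(1) and noeth = assms(2)
  have I: "ideal \<qq> R" by (rule primeideal.axioms(1)[OF q])
  interpret L: localization R \<qq> by (rule localization.intro[OF R q])
  obtain m d where qr: "quotient_resolution R \<qq> m d" using exists_quotient_resolution[OF R noeth I] by blast
  interpret qr: quotient_resolution R \<qq> m d by (rule qr)
  obtain n where n: "grade_defect_bounded R (cyclic R \<qq>) n" using cyclic_grade_defect_bounded[OF R noeth I] by blast
  \<comment> \<open>Any syzygy of order at least \<open>n\<close> and at least \<open>1\<close> has defect zero.\<close>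
  let ?S = "qr.syzygy (Suc n)"
  have b: "grade_defect_bounded R ?S 0" using qr.syzygy_grade_defect[OF I n, of n] by simp
  let ?M = "transfer_module to_univ ?S"
  note S = qr.syzygy_module[of "Suc n"]
  note T = transfer_module[OF S inj_to_univ] and iso = transfer_module_iso[OF S inj_to_univ]
  have fg: "fin_gen R ?M"
    by (rule fin_gen_image[OF T(2) _ S T(1) qr.syzygy_fin_gen]) (use T(3) in \<open>simp add: bij_betw_def\<close>)
  have M: "?M \<in> R_cat R \<pp>"
    by (rule R_cat_membership[OF R noeth assms(3) T(1) fg grade_defect_bounded_iso[OF iso S T(1) b]])
  obtain N where N: "is_syzygy (loc_ring R \<qq>) (residue_field_module R \<qq>) (Suc n) N" "module (loc_ring R \<qq>) N"
    "mod_iso (loc_ring R \<qq>) (loc_module R \<qq> ?S) N" using L.localized_syzygy[OF qr, of n] by blast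
  have "mod_iso (loc_ring R \<qq>) N (loc_module R \<qq> ?M)"
    by (rule mod_iso_trans[OF mod_iso_sym[OF N(3) L.loc_module[OF S]] L.loc_iso[OF iso S T(1)]])
  moreover have "loc_module R \<qq> ?M \<in> loc_module R \<qq> ` R_cat R \<pp>" by (rule imageI[OF M])
  ultimately have "in_add (loc_ring R \<qq>) (loc_module R \<qq> ` R_cat R \<pp>) N"
    by (intro in_add_of_iso[OF _ L.loc_module[OF T(1)] N(2)])
  with N(1) show "\<exists>n N. is_syzygy (loc_ring R \<qq>) (residue_field_module R \<qq>) n N \<and>
      in_add (loc_ring R \<qq>) (loc_module R \<qq> ` R_cat R \<pp>) N" by blast
qed


end
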